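(* Let $W$ be a real random variable distributed as the limit law of the normalized writhe $W_{2n+1}=w(\pi)/n$ ($\pi\in S_{2n+1}$ uniformly random, $n\to\infty$). Then $$ \lim_{t \to \infty} \frac{\log P\left[|W|>t\right]}{t} \;=\; -\frac{\pi^2}{4}. $$
   Context: For a one-to-one function $f:\mathbb{Z}_{2n+1}\to\mathbb{R}$, where $\mathbb{Z}_{2n+1}=\mathbb{Z}/(2n+1)\mathbb{Z}$, the writhe of $f$ is $$ w(f) = \sum_{i=0}^{2n} \sum_{j=1}^{n} \mathrm{sign}\left(f(i+j)-f(i)\right), $$ where $i+j$ is taken in $\mathbb{Z}_{2n+1}$, and $\mathrm{sign}(x)=+1$ if $x>0$ and $-1$ if $x<0$. A permutation in $S_{2n+1}$ is viewed as a bijection of $\{0,\dots,2n\}$, the domain being identified with $\mathbb{Z}_{2n+1}$ and the values $0,\dots,2n$ being compared as integers. The normalized writhe $W_{2n+1}$ converges in distribution, as $n\to\infty$, to a law $W$ on $\mathbb{R}$ which is uniquely determined by its moment generating function, given near $z=0$ by $E[e^{Wz}]=\exp\left(\sum_{m=1}^\infty \frac{\lambda_m}{m}z^m\right)$, where $\lambda_m = \frac{8^m(2^m-1)B_m^2}{2(m!)^2}$ for even $m$, $\lambda_m=0$ for odd $m$, and $B_m$ is the $m$th Bernoulli number ($x/(e^x-1)=\sum_{m\ge 0}B_m x^m/m!$). *)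

theory Defs
  imports "HOL-Probability.Probability" "HOL-Combinatorics.Permutations"
begin

text \<open>The residues modulo \<open>2n+1\<close> are represented by \<open>0, \<dots>, 2n\<close>. For functions that are
  injective on this set, the argument of \<^const>\<open>sgn\<close> is never \<open>0\<close>.\<close>

definition writhe :: "nat \<Rightarrow> (nat \<Rightarrow> real) \<Rightarrow> real" where
  "writhe n f = (\<Sum>i=0..2*n. \<Sum>j=1..n. sgn (f ((i + j) mod (2*n + 1)) - f i))"

text \<open>The junk value at \<open>n = 0\<close>, where \<open>/ real n\<close> is division by zero, does not affect the limit.\<close>

definition normalized_writhe_distr :: "nat \<Rightarrow> real measure" where
  "normalized_writhe_distr n =
     distr (measure_pmf (pmf_of_set {p. p permutes {0..2*n}})) borel
       (\<lambda>p. writhe n (\<lambda>i. real (p i)) / real n)"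

end

theory Submission
  imports Defs "HOL-Real_Asymp.Real_Asymp"
begin

text \<open>A uniformly random permutation has the order type of independent uniform labels, so up to ties
  twice the writhe is a quadratic form \<open>\<Sum>i j. K i j * H (f i) (f j)\<close> in such labels \<open>f i\<close>, where \<open>K\<close> is
  the square wave on the \<open>N = 2 * n + 1\<close> positions and \<open>H\<close> the sawtooth on the \<open>L\<close> labels, that is, the
  sign kernel made degenerate. Both kernels are circulant, with largest eigenvalues about \<open>2 * N / pi\<close>
  and \<open>L / pi\<close>. Hence \<open>2 * w / N\<close> is at most \<open>2 / pi\<^sup>2\<close> times the squared length of a vector whose
  components behave like standard Gaussian ones, and the rate of decay is half of \<open>pi\<^sup>2 / 2\<close>.

  For the upper bound both kernels are replaced by step functions. The resulting form lives in a fixed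
  finite dimension, where Chernoff bounds along a finite net of directions suffice. The error is a
  degenerate form of small variance, whose exponential moments are controlled by a martingale whose
  quadratic variation is subgaussian with a small constant.

  For the lower bound the law of the labels is tilted along the top eigenvector. Under the tilted law the
  writhe concentrates at its mean by Chebyshev's inequality, and the cost of the change of measure
  is the relative entropy.

  No limit theorem is needed, since the existence of the limit law is an assumption. The labels take
  finitely many values, many more than \<open>N\<^sup>2\<close>, so that all expectations are finite sums.\<close>

section \<open>Expectations over finite product spaces\<close>

text \<open>Two demands shape the upper bound. Its prefactor has to be one constant for all
  thresholds \<open>t\<close>, but the Gaussian bound in a given direction holds only for blocks
  that are long compared with a power of \<open>t\<close>. Hence the numbers of blocks and cells,
  and with them the net, depend on the accuracy \<delta> alone, while the block length and then the
  number of labels are chosen after \<open>t\<close>. Moreover the remainder receives only the small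
  share \<eta> * t of the threshold, so it has to decay at a rate of order 1 / \<eta>. Boundedness
  of its kernel yields no such rate; smallness of its variance does.

  In the lower bound, the fluctuations under the tilted law of the writhe divided by
  \<open>N\<close> and of the logarithm of the density are of order sqrt t, while their means are of
  order \<open>t\<close>. This is why the inequality of Chebyshev suffices for large
  \<open>t\<close>.

  The rate is sharp because the exponential estimates carry the factor exp B / 2, which tends to the
  Gaussian 1/2 with the bound B on the summands. Both kernels are antisymmetric, so their
  eigenvalues are imaginary and only products of two of them are real.\<close>

locale product_weights =
  fixes L :: nat and p :: "nat \<Rightarrow> nat \<Rightarrow> real"
  assumes p_nonneg: "0 \<le> p i u" and p_sum: "(\<Sum>u<L. p i u) = 1"
begin

definition expect :: "nat \<Rightarrow> ((nat \<Rightarrow> nat) \<Rightarrow> real) \<Rightarrow> real" where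
  "expect N F = (\<Sum>f\<in>PiE {..<N} (\<lambda>_. {..<L}). (\<Prod>i<N. p i (f i)) * F f)"

lemma finite_PiE_lessThan [simp]: "finite (PiE {..<N} (\<lambda>_. {..<L}))" for N :: nat
  by (intro finite_PiE) auto

lemma expect_0: "expect 0 F = F (\<lambda>_. undefined)"
  by (simp add: expect_def)

text \<open>The last coordinate is integrated out. This recursion replaces conditional expectations:
  a quantity determined by the coordinates below \<open>j\<close> is averaged by
  \<open>expect j\<close>.\<close>

lemma expect_Suc: "expect (Suc N) F = expect N (\<lambda>f. \<Sum>v<L. p N v * F (f(N := v)))"
proof -
  let ?P = "PiE {..<N} (\<lambda>_. {..<L})"
  have inj: "inj_on (\<lambda>(y, g). g(N := y)) ({..<L} \<times> ?P)"
    by (rule inj_combinator) simp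
  have PiE: "PiE {..<Suc N} (\<lambda>_. {..<L}) = (\<lambda>(y, g). g(N := y)) ` ({..<L} \<times> ?P)"
    by (simp only: lessThan_Suc PiE_insert_eq)
  have "expect (Suc N) F = (\<Sum>(y, g)\<in>{..<L} \<times> ?P. (\<Prod>i<Suc N. p i ((g(N := y)) i)) * F (g(N := y)))"
    unfolding expect_def PiE sum.reindex[OF inj] o_def by (intro sum.cong refl) (simp only: split_beta)
  also have "\<dots> = (\<Sum>(y, g)\<in>{..<L} \<times> ?P. (\<Prod>i<N. p i (g i)) * (p N y * F (g(N := y))))"
    by (intro sum.cong refl) (clarify, simp)
  also have "\<dots> = (\<Sum>g\<in>?P. \<Sum>y<L. (\<Prod>i<N. p i (g i)) * (p N y * F (g(N := y))))"
    by (rule trans[OF sum.cartesian_product[symmetric] sum.swap])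
  also have "\<dots> = expect N (\<lambda>f. \<Sum>v<L. p N v * F (f(N := v)))"
    by (simp add: expect_def sum_distrib_left)
  finally show ?thesis .
qed

lemma expect_cong:
  assumes "\<And>f. f \<in> PiE {..<N} (\<lambda>_. {..<L}) \<Longrightarrow> F f = G f"
  shows "expect N F = expect N G"
  unfolding expect_def using assms by (intro sum.cong) auto

lemma expect_mono:
  assumes "\<And>f. f \<in> PiE {..<N} (\<lambda>_. {..<L}) \<Longrightarrow> F f \<le> G f"
  shows "expect N F \<le> expect N G"
  unfolding expect_def using assms by (intro sum_mono mult_left_mono prod_nonneg) (auto simp: p_nonneg)

lemma expect_const [simp]: "expect N (\<lambda>_. c) = c"
proof (induction N)
  case (Suc N)
  then show ?case by (simp add: expect_Suc sum_distrib_right[symmetric] p_sum)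
qed (simp add: expect_0)

lemma expect_add: "expect N (\<lambda>f. F f + G f) = expect N F + expect N G"
  by (simp add: expect_def distrib_left sum.distrib)

lemma expect_diff: "expect N (\<lambda>f. F f - G f) = expect N F - expect N G"
  by (simp add: expect_def right_diff_distrib sum_subtractf)

lemma expect_cmult: "expect N (\<lambda>f. c * F f) = c * expect N F"
  by (simp add: expect_def sum_distrib_left mult_ac)

lemma expect_sum: "expect N (\<lambda>f. \<Sum>x\<in>A. F x f) = (\<Sum>x\<in>A. expect N (F x))"
  unfolding expect_def sum_distrib_left by (rule sum.swap)

lemma expect_prod: "expect N (\<lambda>f. \<Prod>i<N. \<phi> i (f i)) = (\<Prod>i<N. \<Sum>u<L. p i u * \<phi> i u)"
proof (induction N)
  case (Suc N)
  have "expect (Suc N) (\<lambda>f. \<Prod>i<Suc N. \<phi> i (f i))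
      = expect N (\<lambda>f. (\<Sum>v<L. p N v * \<phi> N v) * (\<Prod>i<N. \<phi> i (f i)))"
    unfolding expect_Suc by (rule expect_cong) (simp add: sum_distrib_right sum_distrib_left mult_ac)
  then show ?case by (simp only: expect_cmult Suc) (simp add: mult.commute)
qed (simp add: expect_0)

lemma expect_markov:
  assumes "\<And>f. f \<in> PiE {..<N} (\<lambda>_. {..<L}) \<Longrightarrow> 0 \<le> F f" "0 < a"
  shows "expect N (\<lambda>f. of_bool (a \<le> F f)) \<le> expect N F / a"
proof -
  have "expect N (\<lambda>f. of_bool (a \<le> F f)) \<le> expect N (\<lambda>f. (1 / a) * F f)"
    using assms by (intro expect_mono) (auto simp: field_simps)
  then show ?thesis by (simp only: expect_cmult) simp
qed

lemma expect_chernoff: "expect N (\<lambda>f. of_bool (a \<le> F f)) \<le> exp (- a) * expect N (\<lambda>f. exp (F f))"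
  using expect_markov[of N "\<lambda>f. exp (F f)" "exp a"] by (simp add: exp_minus field_simps)

lemma expect_chebyshev:
  assumes "0 < a"
  shows "expect N (\<lambda>f. of_bool (a \<le> \<bar>F f\<bar>)) \<le> expect N (\<lambda>f. (F f)\<^sup>2) / a\<^sup>2"
proof -
  have "(a \<le> \<bar>x\<bar>) = (a\<^sup>2 \<le> x\<^sup>2)" for x :: real
    using assms abs_le_square_iff[of a x] by simp
  then show ?thesis using expect_markov[of N "\<lambda>f. (F f)\<^sup>2" "a\<^sup>2"] assms by simp
qed

text \<open>In both martingale lemmas \<open>D j f v\<close> is the increment when the \<open>j\<close>-th coordinate takes the
  value \<open>v\<close>; it is predictable, that is, it depends on \<open>f\<close> only through the coordinates below \<open>j\<close>.\<close>

lemma martingale_second_moment: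
  assumes pred: "\<And>j f g v. j < N \<Longrightarrow> (\<And>i. i < j \<Longrightarrow> f i = g i) \<Longrightarrow> D j f v = D j g v"
    and centred: "\<And>j f. j < N \<Longrightarrow> f \<in> PiE {..<j} (\<lambda>_. {..<L}) \<Longrightarrow> (\<Sum>v<L. p j v * D j f v) = 0"
  shows "expect N (\<lambda>f. (\<Sum>j<N. D j f (f j))\<^sup>2) = (\<Sum>j<N. expect j (\<lambda>f. \<Sum>v<L. p j v * (D j f v)\<^sup>2))"
  using assms
proof (induction N)
  case (Suc N)
  have D: "D j (f(N := v)) = D j f" if "j < Suc N" for j f v
    using that by (intro ext Suc.prems(1)) auto
  have "(\<Sum>j<Suc N. D j (f(N := v)) ((f(N := v)) j)) = (\<Sum>j<N. D j f (f j)) + D N f v" for f v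
    unfolding sum.lessThan_Suc by (intro arg_cong2[where f = "(+)"] sum.cong refl) (simp_all only: D lessThan_iff less_SucI lessI fun_upd_same fun_upd_other[OF less_imp_neq])
  then have "expect (Suc N) (\<lambda>f. (\<Sum>j<Suc N. D j f (f j))\<^sup>2)
    = expect N (\<lambda>f. \<Sum>v<L. p N v * ((\<Sum>j<N. D j f (f j)) + D N f v)\<^sup>2)"
    by (simp only: expect_Suc)
  also have "\<dots> = expect N (\<lambda>f. (\<Sum>j<N. D j f (f j))\<^sup>2 + (\<Sum>v<L. p N v * (D N f v)\<^sup>2))"
  proof (rule expect_cong)
    fix f assume f: "f \<in> PiE {..<N} (\<lambda>_. {..<L})"
    define S where "S = (\<Sum>j<N. D j f (f j))"
    have "(\<Sum>v<L. p N v * (S + D N f v)\<^sup>2)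
      = S\<^sup>2 * (\<Sum>v<L. p N v) + 2 * S * (\<Sum>v<L. p N v * D N f v) + (\<Sum>v<L. p N v * (D N f v)\<^sup>2)"
      unfolding sum_distrib_left sum.distrib[symmetric]
      by (intro sum.cong) (auto simp: power2_eq_square algebra_simps)
    then show "(\<Sum>v<L. p N v * ((\<Sum>j<N. D j f (f j)) + D N f v)\<^sup>2)
      = (\<Sum>j<N. D j f (f j))\<^sup>2 + (\<Sum>v<L. p N v * (D N f v)\<^sup>2)"
      using Suc.prems(2)[OF _ f] by (simp add: p_sum S_def)
  qed
  also have "\<dots> = expect N (\<lambda>f. (\<Sum>j<N. D j f (f j))\<^sup>2) + expect N (\<lambda>f. \<Sum>v<L. p N v * (D N f v)\<^sup>2)"
    by (rule expect_add)
  also have "expect N (\<lambda>f. (\<Sum>j<N. D j f (f j))\<^sup>2)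
      = (\<Sum>j<N. expect j (\<lambda>f. \<Sum>v<L. p j v * (D j f v)\<^sup>2))"
    by (rule Suc.IH, rule Suc.prems(1), simp, blast, rule Suc.prems(2), simp_all)
  finally show ?case by simp
qed (simp add: expect_0)

lemma independent_second_moment:
  assumes "\<And>i. i < N \<Longrightarrow> (\<Sum>u<L. p i u * Y i u) = 0"
  shows "expect N (\<lambda>f. (\<Sum>i<N. Y i (f i))\<^sup>2) = (\<Sum>i<N. \<Sum>u<L. p i u * (Y i u)\<^sup>2)"
  using martingale_second_moment[where D = "\<lambda>j f v. Y j v"] assms by simp

text \<open>The factor exp \<bar>x\<bar> / 2 is kept instead of a numerical constant because it
  tends to 1/2 at 0; the sharp decay rate depends on this limit.\<close>

lemma exp_le_quadratic: "exp x \<le> 1 + x + x\<^sup>2 / 2 * exp \<bar>x\<bar>" for x :: real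
proof -
  obtain t where t: "\<bar>t\<bar> \<le> \<bar>x\<bar>" "exp x = (\<Sum>m<2. x ^ m / fact m) + exp t / fact 2 * x ^ 2"
    using Maclaurin_exp_le[of x 2] by blast
  have "exp t * x\<^sup>2 \<le> exp \<bar>x\<bar> * x\<^sup>2" using t(1) by (intro mult_right_mono) auto
  then show ?thesis using t(2) by (simp add: numeral_2_eq_2 field_simps)
qed

lemma centred_exp_le:
  assumes "(\<Sum>v<L. p j v * X v) = 0" "\<And>v. v < L \<Longrightarrow> \<bar>X v\<bar> \<le> B"
  shows "(\<Sum>v<L. p j v * exp (X v)) \<le> exp (exp B / 2 * (\<Sum>v<L. p j v * (X v)\<^sup>2))"
proof -
  have "(\<Sum>v<L. p j v * exp (X v)) \<le> (\<Sum>v<L. p j v * (1 + X v + (X v)\<^sup>2 / 2 * exp B))"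
  proof (intro sum_mono mult_left_mono p_nonneg)
    fix v assume "v \<in> {..<L}"
    then have "(X v)\<^sup>2 / 2 * exp \<bar>X v\<bar> \<le> (X v)\<^sup>2 / 2 * exp B"
      using assms(2) by (intro mult_left_mono) auto
    then show "exp (X v) \<le> 1 + X v + (X v)\<^sup>2 / 2 * exp B" using exp_le_quadratic[of "X v"] by linarith
  qed
  also have "\<dots> = 1 + exp B / 2 * (\<Sum>v<L. p j v * (X v)\<^sup>2)"
  proof -
    have "(\<Sum>v<L. p j v * (1 + X v + (X v)\<^sup>2 / 2 * exp B))
      = (\<Sum>v<L. p j v) + (\<Sum>v<L. p j v * X v) + exp B / 2 * (\<Sum>v<L. p j v * (X v)\<^sup>2)"
      unfolding sum_distrib_left sum.distrib[symmetric] by (intro sum.cong) (auto simp: algebra_simps)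
    then show ?thesis using assms(1) by (simp add: p_sum)
  qed
  also have "\<dots> \<le> exp (exp B / 2 * (\<Sum>v<L. p j v * (X v)\<^sup>2))" by (rule exp_ge_add_one_self)
  finally show ?thesis .
qed

lemma martingale_exponential:
  assumes pred: "\<And>j f g v. j < N \<Longrightarrow> (\<And>i. i < j \<Longrightarrow> f i = g i) \<Longrightarrow> D j f v = D j g v"
    and centred: "\<And>j f. j < N \<Longrightarrow> f \<in> PiE {..<j} (\<lambda>_. {..<L}) \<Longrightarrow> (\<Sum>v<L. p j v * D j f v) = 0"
    and bounded: "\<And>j f v. j < N \<Longrightarrow> f \<in> PiE {..<j} (\<lambda>_. {..<L}) \<Longrightarrow> v < L \<Longrightarrow> \<bar>D j f v\<bar> \<le> B"
  shows "expect N (\<lambda>f. exp (\<Sum>j<N. D j f (f j) - exp B / 2 * (\<Sum>v<L. p j v * (D j f v)\<^sup>2))) \<le> 1"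
  using assms
proof (induction N)
  case (Suc N)
  define V where "V j f = exp B / 2 * (\<Sum>v<L. p j v * (D j f v)\<^sup>2)" for j f
  have D: "D j (f(N := v)) = D j f" if "j < Suc N" for j f v
    using that by (intro ext Suc.prems(1)) auto
  have V: "V j (f(N := v)) = V j f" if "j < Suc N" for j f v
    using that by (simp only: V_def D)
  have "(\<Sum>j<Suc N. D j (f(N := v)) ((f(N := v)) j) - V j (f(N := v)))
     = (\<Sum>j<N. D j f (f j) - V j f) + D N f v - V N f" for f v
    unfolding sum.lessThan_Suc add_diff_eq[symmetric]
    by (intro arg_cong2[where f = "(+)"] sum.cong refl) (simp_all only: D V lessThan_iff less_SucI lessI fun_upd_same fun_upd_other[OF less_imp_neq])
  then have "expect (Suc N) (\<lambda>f. exp (\<Sum>j<Suc N. D j f (f j) - V j f))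
    = expect N (\<lambda>f. \<Sum>v<L. p N v * exp ((\<Sum>j<N. D j f (f j) - V j f) + D N f v - V N f))"
    by (simp only: expect_Suc)
  also have "\<dots> \<le> expect N (\<lambda>f. exp (\<Sum>j<N. D j f (f j) - V j f))"
  proof (rule expect_mono)
    fix f assume f: "f \<in> PiE {..<N} (\<lambda>_. {..<L})"
    define S where "S = (\<Sum>j<N. D j f (f j) - V j f)"
    have "(\<Sum>v<L. p N v * exp (S + D N f v - V N f))
      = exp (S - V N f) * (\<Sum>v<L. p N v * exp (D N f v))"
      unfolding sum_distrib_left by (intro sum.cong) (auto simp: exp_add exp_diff)
    \<comment> \<open>The compensator \<open>V N f\<close> does not depend on the last label, so it
      leaves the inner sum and cancels the bound on the exponential moment there.\<close>
    also have "\<dots> \<le> exp (S - V N f) * exp (V N f)"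
      unfolding V_def by (intro mult_left_mono centred_exp_le Suc.prems(2,3) f) simp_all
    finally show "(\<Sum>v<L. p N v * exp ((\<Sum>j<N. D j f (f j) - V j f) + D N f v - V N f))
        \<le> exp (\<Sum>j<N. D j f (f j) - V j f)"
      by (simp add: S_def exp_diff)
  qed
  also have "\<dots> \<le> 1" unfolding V_def
    by (rule Suc.IH, rule Suc.prems(1), simp, blast, rule Suc.prems(2), simp, simp, rule Suc.prems(3), simp_all)
  finally show ?case by (simp add: V_def)
qed (simp add: expect_0)

end

section \<open>Circulant kernels\<close>

text \<open>Adding \<open>m\<close> before subtracting keeps the difference of naturals from
  truncating for \<open>a < m\<close>.\<close>

definition cdiff :: "nat \<Rightarrow> nat \<Rightarrow> nat \<Rightarrow> nat" where
  "cdiff m a b = (b + m - a) mod m"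

lemma cdiff_less: "0 < m \<Longrightarrow> cdiff m a b < m"
  by (simp add: cdiff_def)

lemma cdiff_eq_if: "a < m \<Longrightarrow> b < m \<Longrightarrow> cdiff m a b = (if a \<le> b then b - a else b + m - a)"
proof -
  assume "a < m" "b < m"
  then show ?thesis
    by (cases "a \<le> b") (simp_all add: cdiff_def flip: add_diff_assoc2)
qed

lemma bij_betw_cdiff_right: "a < m \<Longrightarrow> bij_betw (cdiff m a) {..<m} {..<m}"
  by (rule bij_betw_byWitness[where f' = "\<lambda>d. (a + d) mod m"])
    (auto simp: cdiff_less cdiff_eq_if mod_if)

lemma cdiff_involution:
  assumes "a < m" "b < m"
  shows "cdiff m (cdiff m a b) b = a"
  using assms by (subst cdiff_eq_if) (auto simp: cdiff_less cdiff_eq_if[of a m b])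

lemma bij_betw_cdiff_left: "b < m \<Longrightarrow> bij_betw (\<lambda>a. cdiff m a b) {..<m} {..<m}"
  by (rule bij_betw_byWitness[where f' = "\<lambda>d. cdiff m d b"]) (auto simp: cdiff_less cdiff_involution)

lemma sum_cdiff_right: "a < m \<Longrightarrow> (\<Sum>b<m. F (cdiff m a b)) = (\<Sum>d<m. F d)"
  by (rule sum.reindex_bij_betw[OF bij_betw_cdiff_right])

lemma sum_cdiff_left: "b < m \<Longrightarrow> (\<Sum>a<m. F (cdiff m a b)) = (\<Sum>d<m. F d)"
  by (rule sum.reindex_bij_betw[OF bij_betw_cdiff_left])

section \<open>Roots of unity and norms of circulant matrices\<close>

definition unity :: "nat \<Rightarrow> nat \<Rightarrow> complex" where
  "unity m k = cis (2 * pi * real k / real m)"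

lemma unity_power_eq_1: "0 < m \<Longrightarrow> unity m k ^ m = 1"
  unfolding unity_def Complex.DeMoivre by (simp add: cis_multiple_2pi)

lemma cnj_unity_power: "cnj (unity m k ^ d) = 1 / unity m k ^ d"
  unfolding unity_def Complex.DeMoivre cis_cnj divide_inverse cis_inverse by simp

lemma unity_0 [simp]: "unity m 0 = 1"
  by (simp add: unity_def)

lemma unity_neq_0 [simp]: "unity m k \<noteq> 0"
  by (simp add: unity_def)

lemma unity_power_cdiff:
  assumes "a < m" "b < m"
  shows "unity m k ^ cdiff m a b = unity m k ^ b / unity m k ^ a"
proof -
  have "unity m k ^ cdiff m a b * unity m k ^ a = unity m k ^ b"
    using assms unity_power_eq_1[of m k]
    by (auto simp: cdiff_eq_if power_add[symmetric]) (simp add: power_add)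
  then show ?thesis by (simp add: field_simps)
qed

text \<open>Index and exponent enter only through their product. Exchanging them turns a sum over
  frequencies into a geometric sum in a single root of unity.\<close>

lemma unity_swap: "unity m k ^ a = unity m a ^ k"
  unfolding unity_def Complex.DeMoivre by (simp add: mult_ac)

lemma unity_eq_1_iff:
  assumes "k < m"
  shows "unity m k = 1 \<longleftrightarrow> k = 0"
proof
  assume "unity m k = 1"
  then have "cos (2 * pi * real k / real m) = 1" by (simp add: unity_def cis.ctr complex_eq_iff)
  then obtain x :: int where x: "2 * pi * real k / real m = x * 2 * pi" using cos_one_2pi_int[of "2 * pi * real k / real m"] by auto
  then have "real k = x * real m" using assms by (simp add: divide_eq_eq)
  then have "int k = x * int m" by (metis of_int_eq_iff of_int_mult of_int_of_nat_eq)
  then have "int m dvd int k" by simp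
  then show "k = 0" using assms by (auto dest: zdvd_imp_le)
qed (simp)

lemma sum_root_of_unity:
  fixes r :: complex
  assumes "r ^ m = 1" "r \<noteq> 1"
  shows "(\<Sum>k<m. r ^ k) = 0"
  using assms by (simp add: geometric_sum)

lemma unity_orthogonal:
  assumes "a < m" "b < m"
  shows "(\<Sum>k<m. unity m k ^ a * cnj (unity m k ^ b)) = (if a = b then of_nat m else 0)"
proof -
  have "unity m k ^ a * cnj (unity m k ^ b) = unity m (cdiff m b a) ^ k" for k
    using unity_power_cdiff[OF assms(2,1), of k] unfolding cnj_unity_power unity_swap[of m "cdiff m b a" k] by simp
  moreover have "cdiff m b a = 0 \<longleftrightarrow> a = b" using assms by (auto simp: cdiff_eq_if)
  moreover have "cdiff m b a < m" using assms by (simp add: cdiff_less)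
  ultimately show ?thesis
    using assms by (cases "a = b") (auto simp: sum_root_of_unity unity_power_eq_1 unity_eq_1_iff)
qed

lemma parseval_finite:
  fixes x :: "nat \<Rightarrow> real"
  shows "(\<Sum>k<m. (norm (\<Sum>a<m. of_real (x a) * unity m k ^ a))\<^sup>2) = real m * (\<Sum>a<m. (x a)\<^sup>2)"
proof -
  have "complex_of_real (\<Sum>k<m. (norm (\<Sum>a<m. of_real (x a) * unity m k ^ a))\<^sup>2)
    = (\<Sum>k<m. \<Sum>a<m. \<Sum>b<m. of_real (x a) * of_real (x b) * (unity m k ^ a * cnj (unity m k ^ b)))"
    unfolding of_real_sum complex_norm_square cnj_sum sum_product
    by (intro sum.cong refl) simp
  also have "\<dots> = (\<Sum>a<m. \<Sum>b<m. \<Sum>k<m. of_real (x a) * of_real (x b) * (unity m k ^ a * cnj (unity m k ^ b)))"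
    by (subst sum.swap) (intro sum.cong refl sum.swap)
  also have "\<dots> = (\<Sum>a<m. \<Sum>b<m. of_real (x a) * of_real (x b) * (if a = b then of_nat m else 0))"
    unfolding sum_distrib_left[symmetric] by (intro sum.cong refl) (simp only: unity_orthogonal lessThan_iff)
  also have "\<dots> = complex_of_real (real m * (\<Sum>a<m. (x a)\<^sup>2))"
    by (simp add: sum_distrib_left power2_eq_square mult_ac if_distrib[of "\<lambda>z. _ * z"] cong: if_cong)
  finally show ?thesis by (simp only: of_real_eq_iff)
qed

text \<open>In Fourier space the matrix acts by multiplication. Since the row index is the one
  subtracted, the multiplier is the conjugate of the symbol, which has the same modulus; Parseval's
  identity translates the bound back.\<close>

lemma circulant_norm_le:
  fixes c x :: "nat \<Rightarrow> real"
  assumes symbol: "\<And>k. k < m \<Longrightarrow> norm (\<Sum>d<m. of_real (c d) * unity m k ^ d) \<le> \<mu>"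
  shows "(\<Sum>a<m. (\<Sum>b<m. c (cdiff m a b) * x b)\<^sup>2) \<le> \<mu>\<^sup>2 * (\<Sum>b<m. (x b)\<^sup>2)"
proof (cases "m = 0")
  case False
  then have m: "0 < m" by simp
  have conv: "norm (\<Sum>a<m. of_real (\<Sum>b<m. c (cdiff m a b) * x b) * unity m k ^ a)
      \<le> \<mu> * norm (\<Sum>b<m. of_real (x b) * unity m k ^ b)" if k: "k < m" for k
  proof -
    let ?r = "unity m k"
    have "(\<Sum>a<m. of_real (\<Sum>b<m. c (cdiff m a b) * x b) * ?r ^ a)
      = (\<Sum>b<m. of_real (x b) * ?r ^ b * (\<Sum>a<m. of_real (c (cdiff m a b)) * (?r ^ a / ?r ^ b)))"
      by (simp add: sum_distrib_left sum_distrib_right mult_ac) (rule sum.swap)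
    also have "\<dots> = (\<Sum>b<m. of_real (x b) * ?r ^ b * cnj (\<Sum>d<m. of_real (c d) * ?r ^ d))"
    proof (intro sum.cong refl arg_cong2[where f = "(*)"])
      fix b assume b: "b \<in> {..<m}"
      have "(\<Sum>a<m. of_real (c (cdiff m a b)) * (?r ^ a / ?r ^ b))
        = (\<Sum>a<m. of_real (c (cdiff m a b)) * cnj (?r ^ cdiff m a b))"
        using b unfolding cnj_unity_power
        by (intro sum.cong refl) (simp only: unity_power_cdiff lessThan_iff divide_divide_eq_right mult_1)
      also have "\<dots> = (\<Sum>d<m. of_real (c d) * cnj (?r ^ d))" using b by (intro sum_cdiff_left) simp
      finally show "(\<Sum>a<m. of_real (c (cdiff m a b)) * (?r ^ a / ?r ^ b)) = cnj (\<Sum>d<m. of_real (c d) * ?r ^ d)"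
        by simp
    qed
    also have "\<dots> = cnj (\<Sum>d<m. of_real (c d) * ?r ^ d) * (\<Sum>b<m. of_real (x b) * ?r ^ b)"
      by (simp only: sum_distrib_right[symmetric] mult.commute)
    also have "norm \<dots> \<le> \<mu> * norm (\<Sum>b<m. of_real (x b) * ?r ^ b)"
      unfolding norm_mult complex_mod_cnj by (intro mult_right_mono symbol k norm_ge_zero)
    finally show ?thesis .
  qed
  have "real m * (\<Sum>a<m. (\<Sum>b<m. c (cdiff m a b) * x b)\<^sup>2)
    = (\<Sum>k<m. (norm (\<Sum>a<m. of_real (\<Sum>b<m. c (cdiff m a b) * x b) * unity m k ^ a))\<^sup>2)"
    by (rule parseval_finite[symmetric])
  also have "\<dots> \<le> (\<Sum>k<m. (\<mu> * norm (\<Sum>b<m. of_real (x b) * unity m k ^ b))\<^sup>2)"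
    by (intro sum_mono power_mono conv) auto
  also have "\<dots> = real m * (\<mu>\<^sup>2 * (\<Sum>b<m. (x b)\<^sup>2))"
    unfolding power_mult_distrib sum_distrib_left[symmetric] parseval_finite by simp
  finally show ?thesis using m by simp
qed simp

text \<open>The two factors act on different indices, so their operator norms are applied one after
  the other. The Cauchy-Schwarz inequality passes from the norm of the image \<open>z\<close> to the
  quadratic form.\<close>

lemma tensor_norm_le:
  fixes A :: "nat \<Rightarrow> nat \<Rightarrow> real" and x :: "nat \<Rightarrow> nat \<Rightarrow> real"
  assumes A: "\<And>y. (\<Sum>a<M. (\<Sum>a'<M. A a a' * y a')\<^sup>2) \<le> \<mu>\<^sup>2 * (\<Sum>a<M. (y a)\<^sup>2)"
    and B: "\<And>y. (\<Sum>b<m. (\<Sum>b'<m. B b b' * y b')\<^sup>2) \<le> \<nu>\<^sup>2 * (\<Sum>b<m. (y b)\<^sup>2)"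
    and "0 \<le> \<mu>" "0 \<le> \<nu>"
  shows "(\<Sum>a<M. \<Sum>b<m. \<Sum>a'<M. \<Sum>b'<m. A a a' * B b b' * x a b * x a' b')
     \<le> \<mu> * \<nu> * (\<Sum>a<M. \<Sum>b<m. (x a b)\<^sup>2)"
proof -
  define y where "y a b = (\<Sum>a'<M. A a a' * x a' b)" for a b
  define z where "z a b = (\<Sum>b'<m. B b b' * y a b')" for a b
  define X where "X = (\<Sum>a<M. \<Sum>b<m. (x a b)\<^sup>2)"
  have "(\<Sum>a<M. \<Sum>b<m. (z a b)\<^sup>2) \<le> (\<Sum>a<M. \<nu>\<^sup>2 * (\<Sum>b<m. (y a b)\<^sup>2))"
    unfolding z_def by (intro sum_mono B)
  also have "\<dots> = \<nu>\<^sup>2 * (\<Sum>b<m. \<Sum>a<M. (y a b)\<^sup>2)"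
    by (simp only: sum_distrib_left[symmetric]) (subst sum.swap, rule refl)
  also have "\<dots> \<le> \<nu>\<^sup>2 * (\<Sum>b<m. \<mu>\<^sup>2 * (\<Sum>a<M. (x a b)\<^sup>2))"
    unfolding y_def by (intro mult_left_mono sum_mono A) auto
  also have "\<dots> = (\<mu> * \<nu>)\<^sup>2 * X"
    unfolding X_def by (subst sum.swap) (simp add: sum_distrib_left power_mult_distrib mult_ac)
  finally have z: "(\<Sum>a<M. \<Sum>b<m. (z a b)\<^sup>2) \<le> (\<mu> * \<nu>)\<^sup>2 * X" .
  have "(\<Sum>a<M. \<Sum>b<m. \<Sum>a'<M. \<Sum>b'<m. A a a' * B b b' * x a b * x a' b') = (\<Sum>a<M. \<Sum>b<m. x a b * z a b)"
  proof -
    have "(\<Sum>a'<M. \<Sum>b'<m. A a a' * B b b' * x a b * x a' b') = x a b * z a b" for a b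
      unfolding z_def y_def sum_distrib_left by (subst sum.swap) (simp add: mult_ac)
    then show ?thesis by (simp only:)
  qed
  also have "\<dots> = (\<Sum>(a, b)\<in>{..<M} \<times> {..<m}. x a b * z a b)" by (rule sum.cartesian_product)
  also have "\<dots> \<le> L2_set (\<lambda>(a, b). x a b) ({..<M} \<times> {..<m}) * L2_set (\<lambda>(a, b). z a b) ({..<M} \<times> {..<m})"
    by (rule order_trans[OF sum_mono L2_set_mult_ineq]) (auto simp: abs_mult[symmetric])
  also have "\<dots> = sqrt X * sqrt (\<Sum>a<M. \<Sum>b<m. (z a b)\<^sup>2)"
    unfolding L2_set_def X_def by (simp only: sum.cartesian_product case_prod_unfold)
  also have "\<dots> \<le> sqrt X * sqrt ((\<mu> * \<nu>)\<^sup>2 * X)"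
    using z by (intro mult_left_mono real_sqrt_le_mono) (auto simp: X_def sum_nonneg)
  also have "\<dots> = \<mu> * \<nu> * X"
    using assms(3,4) by (simp add: real_sqrt_mult X_def sum_nonneg)
  finally show ?thesis by (simp add: X_def)
qed

section \<open>Eigenvalues of the sawtooth and of the square wave\<close>

lemma abs_mult_cos_le_abs_sin:
  assumes "\<bar>z\<bar> \<le> pi / 2"
  shows "\<bar>z\<bar> * cos z \<le> \<bar>sin z\<bar>"
proof -
  have pos: "y * cos y \<le> sin y" if "0 \<le> y" "y \<le> pi / 2" for y :: real
  proof -
    have "sin 0 - 0 * cos 0 \<le> sin y - y * cos y"
    proof (rule DERIV_nonneg_imp_nondecreasing[OF that(1)])
      fix x assume x: "0 \<le> x" "x \<le> y"
      have "((\<lambda>x. sin x - x * cos x) has_real_derivative x * sin x) (at x)"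
        by (auto intro!: derivative_eq_intros)
      moreover have "0 \<le> x * sin x" using x that by (intro mult_nonneg_nonneg sin_ge_zero) auto
      ultimately show "\<exists>D. ((\<lambda>x. sin x - x * cos x) has_real_derivative D) (at x) \<and> 0 \<le> D" by blast
    qed
    then show ?thesis by simp
  qed
  have "\<bar>z\<bar> * cos \<bar>z\<bar> \<le> sin \<bar>z\<bar>" using assms by (intro pos) auto
  then show ?thesis by (auto simp: abs_if split: if_splits)
qed

text \<open>The value 0 at \<open>d = 0\<close> makes the function odd modulo \<open>m\<close>,
  hence of sum zero.\<close>

definition saw :: "nat \<Rightarrow> nat \<Rightarrow> real" where
  "saw m d = (if d = 0 then 0 else 1 - 2 * real d / real m)"

definition square_wave :: "nat \<Rightarrow> nat \<Rightarrow> real" where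
  "square_wave n d = (if d = 0 then 0 else if d \<le> n then 1 else -1)"

lemma sum_saw: "(\<Sum>d<m. saw m d) = 0"
proof (cases m)
  case (Suc k)
  have gauss: "(\<Sum>d<k. real (Suc d)) = real k * (real k + 1) / 2" for k
    by (induction k) (auto simp: field_simps)
  have "(\<Sum>d<m. saw m d) = (\<Sum>d<k. 1 - 2 * real (Suc d) / real m)"
    unfolding Suc by (subst sum.lessThan_Suc_shift) (simp add: saw_def)
  also have "\<dots> = real k - 2 / real m * (\<Sum>d<k. real (Suc d))"
    by (simp add: sum_subtractf sum_distrib_left del: of_nat_Suc)
  also have "\<dots> = 0" unfolding gauss Suc by (simp add: field_simps)
  finally show ?thesis .
qed simp

lemma sum_square_wave: "(\<Sum>d<2 * n + 1. square_wave n d) = 0"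
proof -
  have 1: "(\<Sum>d<n + 1. square_wave n d) = real n"
    unfolding Suc_eq_plus1[symmetric] sum.lessThan_Suc_shift by (simp add: square_wave_def)
  have "(\<Sum>d<n + 1 + k. square_wave n d) = (\<Sum>d<n + 1. square_wave n d) - real k" for k
    by (induction k) (auto simp: square_wave_def)
  from this[of n] 1 show ?thesis by (simp add: mult_2)
qed

lemma cis_double_minus_1: "cis (2 * x) - 1 = 2 * \<i> * of_real (sin x) * cis x"
proof -
  have "sin (2 * x) = 2 * sin x * cos x" "cos (2 * x) = 1 - 2 * (sin x)\<^sup>2"
    by (rule sin_double, rule cos_double_sin)
  then show ?thesis
    by (intro complex_eqI) (simp_all del: sin_double cos_double add: power2_eq_square)
qed

lemma cis_double_plus_1: "cis (2 * x) + 1 = 2 * of_real (cos x) * cis x"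
proof -
  have "sin (2 * x) = 2 * sin x * cos x" "cos (2 * x) = 2 * (cos x)\<^sup>2 - 1"
    by (rule sin_double, rule cos_double_cos)
  then show ?thesis
    by (intro complex_eqI) (simp_all del: sin_double cos_double add: power2_eq_square)
qed

text \<open>The sum of d * r^d and the geometric sum combine to (1 + r) / (1 - r), which the
  half-angle formulas turn into a cotangent. The value is imaginary because the kernel is
  odd.\<close>

lemma saw_symbol:
  assumes "0 < k" "k < m"
  shows "(\<Sum>d<m. of_real (saw m d) * unity m k ^ d) = \<i> * of_real (cot (pi * real k / real m))"
proof -
  define r where "r = unity m k"
  define x where "x = pi * real k / real m"
  have r: "r = cis (2 * x)" by (simp add: r_def x_def unity_def mult_ac)
  have rm: "r ^ m = 1" using assms by (simp add: r_def unity_power_eq_1)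
  have r1: "r \<noteq> 1" using assms by (simp add: r_def unity_eq_1_iff)
  have arith: "(r - 1) * (\<Sum>d<j. of_nat d * r ^ d) = of_nat j * r ^ j - r * (\<Sum>d<j. r ^ d)" for j
    by (induction j) (auto simp: algebra_simps)
  have sum0: "(\<Sum>d<m. r ^ d) = 0" using rm r1 by (rule sum_root_of_unity)
  have "(\<Sum>d<m. of_real (saw m d) * r ^ d)
     = (\<Sum>d<m. r ^ d - 2 / of_nat m * (of_nat d * r ^ d) - (if d = 0 then 1 else 0))"
    by (intro sum.cong refl) (auto simp: saw_def field_simps)
  also have "\<dots> = - (2 / of_nat m) * (\<Sum>d<m. of_nat d * r ^ d) - 1"
    using assms by (simp only: sum_subtractf sum0 sum_distrib_left[symmetric]) simp
  also have "(\<Sum>d<m. of_nat d * r ^ d) = of_nat m / (r - 1)"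
    using arith[of m] r1 by (simp add: sum0 rm field_simps)
  also have "- (2 / of_nat m) * (of_nat m / (r - 1)) - 1 = - (r + 1) / (r - 1)"
    using assms r1 by (simp add: field_simps)
  also have "\<dots> = \<i> * of_real (cot x)"
  proof -
    have "- (2 * of_real (cos x) * cis x) / (2 * \<i> * of_real (sin x) * cis x)
        = - (of_real (cos x) / (\<i> * of_real (sin x)))" by simp
    also have "\<dots> = \<i> * of_real (cot x)"
      by (cases "sin x = 0") (simp_all add: cot_def divide_simps)
    finally show ?thesis unfolding r cis_double_minus_1 cis_double_plus_1 .
  qed
  finally show ?thesis by (simp add: r_def x_def)
qed

text \<open>Since 2 * n + 2 = (2 * n + 1) + 1, the number \<rho> = r^(n + 1) is a square root of
  \<open>r\<close>. The two halves of the wave contribute r * G and - \<rho> * G; with r = \<rho>^2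
  their product with \<rho> + 1 is \<rho> * (r - 1) * G, a telescoping geometric sum.\<close>

lemma square_wave_symbol_mult:
  "(\<Sum>d<2 * n + 1. of_real (square_wave n d) * unity (2 * n + 1) k ^ d) * (unity (2 * n + 1) k ^ (n + 1) + 1)
    = 1 - unity (2 * n + 1) k ^ (n + 1)"
proof -
  define r where "r = unity (2 * n + 1) k"
  define \<rho> where "\<rho> = r ^ (n + 1)"
  define G where "G = (\<Sum>d<n. r ^ d)"
  have rm: "r ^ (2 * n + 1) = 1" unfolding r_def by (rule unity_power_eq_1) simp
  have "\<rho>\<^sup>2 = r ^ (2 * n + 1) * r" by (simp add: \<rho>_def power_add[symmetric] power_mult[symmetric] power2_eq_square mult_2 flip: power_Suc2)
  then have r: "r = \<rho>\<^sup>2" by (simp only: rm mult_1)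
  have rn: "r ^ n * \<rho> = 1" using rm unfolding \<rho>_def power_add[symmetric] by (simp add: mult_2)
  have G: "(r - 1) * G = r ^ n - 1" by (simp add: G_def power_diff_1_eq)
  have 1: "(\<Sum>d<n + 1. of_real (square_wave n d) * r ^ d) = r * G"
    unfolding Suc_eq_plus1[symmetric] sum.lessThan_Suc_shift by (simp add: square_wave_def G_def sum_distrib_left)
  have "(\<Sum>d<n + 1 + k. of_real (square_wave n d) * r ^ d)
      = (\<Sum>d<n + 1. of_real (square_wave n d) * r ^ d) - \<rho> * (\<Sum>d<k. r ^ d)" for k
    by (induction k) (auto simp: square_wave_def \<rho>_def algebra_simps power_add)
  from this[of n] 1 have S: "(\<Sum>d<2 * n + 1. of_real (square_wave n d) * r ^ d) = r * G - \<rho> * G"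
    by (simp add: mult_2 G_def)
  have "(r * G - \<rho> * G) * (\<rho> + 1) = \<rho> * ((r - 1) * G)" unfolding r by (simp add: algebra_simps power2_eq_square)
  also have "\<dots> = 1 - \<rho>" unfolding G using rn by (simp add: algebra_simps)
  finally show ?thesis unfolding S[symmetric] by (simp add: r_def \<rho>_def)
qed

text \<open>The index \<open>j\<close> is \<open>k\<close> halved modulo the odd number 2 * n + 1.
  It makes the symbol (1 - \<rho>) / (1 + \<rho>) a tangent at the angle belonging to
  \<open>j\<close>.\<close>

lemma square_wave_symbol:
  assumes "j < 2 * n + 1" "unity (2 * n + 1) j = unity (2 * n + 1) k ^ (n + 1)"
  shows "(\<Sum>d<2 * n + 1. of_real (square_wave n d) * unity (2 * n + 1) k ^ d)
    = - \<i> * of_real (tan (pi * real j / real (2 * n + 1)))"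
    and "cos (pi * real j / real (2 * n + 1)) \<noteq> 0"
proof -
  define y where "y = pi * real j / real (2 * n + 1)"
  have \<rho>: "unity (2 * n + 1) k ^ (n + 1) = cis (2 * y)"
    unfolding assms(2)[symmetric] by (simp add: y_def unity_def mult_ac)
  show cos: "cos (pi * real j / real (2 * n + 1)) \<noteq> 0"
  proof
    assume "cos (pi * real j / real (2 * n + 1)) = 0"
    then have "cis (2 * y) = -1" using cis_double_plus_1[of y] by (simp only: y_def of_real_0 mult_zero_right mult_zero_left add_eq_0_iff2)
    then have "unity (2 * n + 1) j = - 1" using \<rho> assms(2) by simp
    \<comment> \<open>An odd power of -1 is not 1, so the tangent has no pole at this angle.\<close>
    then show False using unity_power_eq_1[of "2 * n + 1" j] by simp
  qed
  define S where "S = (\<Sum>d<2 * n + 1. of_real (square_wave n d) * unity (2 * n + 1) k ^ d)"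
  have "S * (cis (2 * y) + 1) = - (cis (2 * y) - 1)"
    using square_wave_symbol_mult[of n k] unfolding \<rho> S_def by simp
  then have "2 * cis y * (S * of_real (cos y)) = 2 * cis y * (- \<i> * of_real (sin y))"
    unfolding cis_double_minus_1 cis_double_plus_1 by (simp add: algebra_simps)
  then have "S * of_real (cos y) = - \<i> * of_real (sin y)"
    by (subst (asm) mult_left_cancel) auto
  then have "S = - \<i> * of_real (sin y) / of_real (cos y)"
    using cos by (subst nonzero_eq_divide_eq) (auto simp: y_def)
  then show "S = - \<i> * of_real (tan (pi * real j / real (2 * n + 1)))"
    unfolding y_def[symmetric] tan_def by simp
qed

text \<open>For positive \<open>k\<close> the angle pi * k / m keeps the distance pi / m from the
  poles 0 and pi of the cotangent. Near 0 the estimate is \<bar>z\<bar> \<le> \<bar>tan z\<bar>; the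
  pole pi is reflected to 0.\<close>

lemma saw_symbol_norm_le:
  assumes "k < m"
  shows "norm (\<Sum>d<m. of_real (saw m d) * unity m k ^ d) \<le> real m / pi"
proof (cases "k = 0")
  case True
  have "(\<Sum>d<m. complex_of_real (saw m d)) = 0" using sum_saw[of m] by (simp flip: of_real_sum)
  then show ?thesis using True by simp
next
  case False
  define x where "x = pi * real k / real m"
  have k: "1 \<le> real k" "real k + 1 \<le> real m" using False assms by auto
  have x: "pi / real m \<le> x" "x \<le> pi - pi / real m" "0 < pi / real m"
    using k mult_left_mono[OF k(2), of pi] by (auto simp: x_def field_simps)
  have sin: "0 < sin x" using x by (intro sin_gt_zero) auto
  have "pi / real m * \<bar>cos x\<bar> \<le> sin x"
  proof (cases "x \<le> pi / 2")
    case True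
    have "pi / real m * cos x \<le> \<bar>x\<bar> * cos x" using x True by (intro mult_right_mono cos_ge_zero) auto
    also have "\<dots> \<le> \<bar>sin x\<bar>" using x True by (intro abs_mult_cos_le_abs_sin) auto
    moreover have "0 \<le> cos x" using x True by (intro cos_ge_zero) auto
    ultimately show ?thesis using sin by simp
  next
    case False
    have c: "0 \<le> cos (pi - x)" using x False by (intro cos_ge_zero) auto
    then have "pi / real m * cos (pi - x) \<le> \<bar>pi - x\<bar> * cos (pi - x)" using x by (intro mult_right_mono) auto
    also have "\<dots> \<le> \<bar>sin (pi - x)\<bar>" using x False by (intro abs_mult_cos_le_abs_sin) auto
    finally show ?thesis using sin c by simp
  qed
  then have "\<bar>cot x\<bar> \<le> real m / pi" using k sin by (simp add: cot_def field_simps)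
  then show ?thesis using saw_symbol[of k m] False assms by (simp add: norm_mult x_def)
qed

lemma square_wave_symbol_norm_le:
  "norm (\<Sum>d<2 * n + 1. of_real (square_wave n d) * unity (2 * n + 1) k ^ d) \<le> 2 * real (2 * n + 1) / pi"
proof -
  define m where "m = 2 * n + 1"
  \<comment> \<open>Multiplication by \<open>n + 1\<close> halves residues modulo 2 * n + 1.\<close>
  define j where "j = (k * (n + 1)) mod m"
  have m: "0 < m" and j: "j < m" by (simp_all add: m_def j_def)
  have u: "unity m k = unity m 1 ^ k" for k using unity_swap[of m 1 k] by simp
  have "unity m k ^ (n + 1) = unity m 1 ^ (k * (n + 1))"
    by (simp only: u[of k] power_mult)
  also have "\<dots> = unity m 1 ^ j"
  proof -
    have "k * (n + 1) = m * (k * (n + 1) div m) + j" by (simp add: j_def)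
    then have "unity m 1 ^ (k * (n + 1)) = (unity m 1 ^ m) ^ (k * (n + 1) div m) * unity m 1 ^ j"
      by (metis power_add power_mult)
    then show ?thesis by (simp only: unity_power_eq_1[OF m] power_one mult_1)
  qed
  also have "\<dots> = unity m j" by (rule u[symmetric])
  finally have e: "unity m j = unity m k ^ (n + 1)" ..
  define y where "y = pi * real j / real m"
  note sym = square_wave_symbol[OF j[unfolded m_def] e[unfolded m_def], folded m_def, folded y_def]
  have y: "0 \<le> y" "y \<le> pi" using j by (auto simp: y_def field_simps)
  have "pi / (2 * real m) \<le> \<bar>pi / 2 - y\<bar>"
  proof -
    \<comment> \<open>As \<open>m\<close> is odd, \<open>y\<close> stays half a grid step away from
      the pole pi / 2. For the sawtooth it was a full step, hence the additional factor 2 in this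
      bound.\<close>
    have "1 \<le> \<bar>int m - 2 * int j\<bar>" by (simp add: m_def) presburger
    then have "1 \<le> \<bar>real m - 2 * real j\<bar>" by linarith
    moreover have "pi / 2 - y = pi / (2 * real m) * (real m - 2 * real j)"
      using m by (simp add: y_def field_simps)
    then have "\<bar>pi / 2 - y\<bar> = pi / (2 * real m) * \<bar>real m - 2 * real j\<bar>"
      by (simp add: abs_mult)
    ultimately show ?thesis using mult_left_mono[of 1 "\<bar>real m - 2 * real j\<bar>" "pi / (2 * real m)"] by simp
  qed
  then have "pi / (2 * real m) * sin y \<le> \<bar>pi / 2 - y\<bar> * sin y"
    using y by (intro mult_right_mono sin_ge_zero) auto
  also have "\<dots> \<le> \<bar>cos y\<bar>"
    using abs_mult_cos_le_abs_sin[of "pi / 2 - y"] y by (auto simp: cos_diff sin_diff abs_if split: if_splits)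
  finally have "\<bar>tan y\<bar> \<le> 2 * real m / pi"
    using sym(2) m y sin_ge_zero[of y] by (simp add: tan_def field_simps)
  then show ?thesis using sym(1) unfolding m_def[symmetric] by (simp add: norm_mult)
qed

section \<open>The writhe of a random permutation\<close>

lemma square_wave_antisym:
  assumes "i < 2 * n + 1" "j < 2 * n + 1"
  shows "square_wave n (cdiff (2 * n + 1) j i) = - square_wave n (cdiff (2 * n + 1) i j)"
proof (cases i j rule: linorder_cases)
  case less
  then have "cdiff (2 * n + 1) i j = j - i" "cdiff (2 * n + 1) j i = 2 * n + 1 - (j - i)"
    using assms by (simp_all add: cdiff_eq_if)
  with less assms show ?thesis by (auto simp: square_wave_def)
next
  case equal
  then show ?thesis using assms by (simp add: cdiff_eq_if square_wave_def)
next
  case greater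
  then have "cdiff (2 * n + 1) j i = i - j" "cdiff (2 * n + 1) i j = 2 * n + 1 - (i - j)"
    using assms by (simp_all add: cdiff_eq_if)
  with greater assms show ?thesis by (auto simp: square_wave_def)
qed

text \<open>The sawtooth is the sign minus a difference of functions of one label each; in this
  sense it is the degenerate version of the sign kernel.\<close>

lemma saw_cdiff:
  assumes "u < L" "v < L"
  shows "saw L (cdiff L u v) = sgn (real v - real u) - 2 * (real v - real u) / real L"
  using assms by (auto simp: saw_def cdiff_eq_if field_simps of_nat_diff)

lemma sum_square_wave_cdiff_right:
  assumes "i < 2 * n + 1"
  shows "(\<Sum>j<2 * n + 1. square_wave n (cdiff (2 * n + 1) i j)) = 0"
  unfolding sum_cdiff_right[OF assms] by (rule sum_square_wave)

lemma sum_square_wave_cdiff_left: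
  assumes "j < 2 * n + 1"
  shows "(\<Sum>i<2 * n + 1. square_wave n (cdiff (2 * n + 1) i j)) = 0"
  unfolding sum_cdiff_left[OF assms] by (rule sum_square_wave)

text \<open>Swapping the two positions reverses the sign, so the pairs at distances n + 1 to 2 * n
  repeat those at distances 1 to n with the opposite sign. The square wave collects both, whence the
  factor 2.\<close>

lemma writhe_eq_circulant_sum:
  "2 * writhe n f = (\<Sum>i<2 * n + 1. \<Sum>j<2 * n + 1. square_wave n (cdiff (2 * n + 1) i j) * sgn (f j - f i))"
proof -
  define N where "N = 2 * n + 1"
  define P where "P i j = (of_bool (cdiff N i j \<in> {1..n}) :: real)" for i j
  have set: "{0..2 * n} = {..<N}" by (auto simp: N_def)
  have "writhe n f = (\<Sum>i<N. \<Sum>j<N. P i j * sgn (f j - f i))"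
    unfolding writhe_def set N_def[symmetric]
  proof (rule sum.cong[OF refl])
    fix i assume "i \<in> {..<N}"
    then have i: "i < N" by simp
    have "(\<Sum>d=1..n. sgn (f ((i + d) mod N) - f i)) = (\<Sum>d<N. of_bool (d \<in> {1..n}) * sgn (f ((i + d) mod N) - f i))"
      by (intro sum.mono_neutral_cong_left) (auto simp: N_def)
    also have "\<dots> = (\<Sum>j<N. P i j * sgn (f ((i + cdiff N i j) mod N) - f i))"
      unfolding P_def by (rule sum_cdiff_right[OF i, symmetric])
    also have "\<dots> = (\<Sum>j<N. P i j * sgn (f j - f i))"
      using i by (intro sum.cong refl) (auto simp: cdiff_eq_if mod_if)
    finally show "(\<Sum>d=1..n. sgn (f ((i + d) mod N) - f i)) = (\<Sum>j<N. P i j * sgn (f j - f i))" .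
  qed
  moreover have "(\<Sum>i<N. \<Sum>j<N. P i j * sgn (f j - f i)) = - (\<Sum>i<N. \<Sum>j<N. P j i * sgn (f j - f i))"
  proof -
    have "(\<Sum>i<N. \<Sum>j<N. P i j * sgn (f j - f i)) = (\<Sum>i<N. \<Sum>j<N. P j i * sgn (f i - f j))" by (rule sum.swap)
    also have "\<dots> = (\<Sum>i<N. \<Sum>j<N. - (P j i * sgn (f j - f i)))"
      by (intro sum.cong refl) (metis minus_diff_eq mult_minus_right sgn_minus)
    finally show ?thesis by (simp only: sum_negf)
  qed
  moreover have "(\<Sum>i<N. \<Sum>j<N. square_wave n (cdiff N i j) * sgn (f j - f i))
      = (\<Sum>i<N. \<Sum>j<N. P i j * sgn (f j - f i)) - (\<Sum>i<N. \<Sum>j<N. P j i * sgn (f j - f i))"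
    unfolding sum_subtractf[symmetric] left_diff_distrib[symmetric]
  proof (intro sum.cong refl arg_cong2[where f = "(*)"])
    fix i j assume "i \<in> {..<N}" "j \<in> {..<N}"
    then show "square_wave n (cdiff N i j) = P i j - P j i"
      by (auto simp: square_wave_def P_def cdiff_eq_if N_def)
  qed
  ultimately show ?thesis by (simp add: N_def)
qed

lemma sum_symmetric_eq_triangle:
  fixes T :: "nat \<Rightarrow> nat \<Rightarrow> real"
  assumes "\<And>i j. i < N \<Longrightarrow> j < N \<Longrightarrow> T j i = T i j" "\<And>i. i < N \<Longrightarrow> T i i = 0"
  shows "(\<Sum>i<N. \<Sum>j<N. T i j) = 2 * (\<Sum>j<N. \<Sum>i<j. T i j)"
  using assms
proof (induction N)
  case (Suc N)
  have IH: "(\<Sum>i<N. \<Sum>j<N. T i j) = 2 * (\<Sum>j<N. \<Sum>i<j. T i j)" by (rule Suc.IH) (simp_all add: Suc.prems)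
  have sym: "(\<Sum>j<N. T N j) = (\<Sum>i<N. T i N)" by (intro sum.cong refl Suc.prems(1)) auto
  have "(\<Sum>i<Suc N. \<Sum>j<Suc N. T i j) = (\<Sum>i<N. \<Sum>j<N. T i j) + (\<Sum>i<N. T i N) + ((\<Sum>j<N. T N j) + T N N)"
    by (simp add: sum.distrib)
  then show ?case unfolding IH sym using Suc.prems(2)[of N] by simp
qed simp

text \<open>The one-label terms meet row or column sums of the square wave, which vanish, so the
  passage to the degenerate kernel is exact. It covers ties, where both kernels are 0.\<close>

lemma writhe_eq_saw_sum:
  assumes "\<And>i. i < 2 * n + 1 \<Longrightarrow> f i < L"
  shows "2 * writhe n (\<lambda>i. real (f i))
    = (\<Sum>i<2 * n + 1. \<Sum>j<2 * n + 1. square_wave n (cdiff (2 * n + 1) i j) * saw L (cdiff L (f i) (f j)))"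
proof -
  define N where "N = 2 * n + 1"
  define K where "K i j = square_wave n (cdiff N i j)" for i j
  have "(\<Sum>i<N. \<Sum>j<N. K i j * saw L (cdiff L (f i) (f j)))
    = (\<Sum>i<N. \<Sum>j<N. K i j * sgn (real (f j) - real (f i)) - 2 / real L * (real (f j) * K i j) + 2 / real L * (real (f i) * K i j))"
    using assms by (intro sum.cong refl) (simp add: saw_cdiff N_def algebra_simps diff_divide_distrib add_divide_distrib)
  also have "\<dots> = (\<Sum>i<N. \<Sum>j<N. K i j * sgn (real (f j) - real (f i)))
     - 2 / real L * (\<Sum>i<N. \<Sum>j<N. real (f j) * K i j) + 2 / real L * (\<Sum>i<N. \<Sum>j<N. real (f i) * K i j)"
    by (simp only: sum.distrib sum_subtractf sum_distrib_left)
  also have "(\<Sum>i<N. \<Sum>j<N. real (f j) * K i j) = (\<Sum>j<N. real (f j) * (\<Sum>i<N. K i j))"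
    unfolding sum_distrib_left by (rule sum.swap)
  also have "\<dots> = 0" using sum_square_wave_cdiff_left[of _ n] by (intro sum.neutral) (simp add: K_def N_def del: sum.lessThan_Suc)
  also have "(\<Sum>i<N. \<Sum>j<N. real (f i) * K i j) = (\<Sum>i<N. real (f i) * (\<Sum>j<N. K i j))"
    by (simp only: sum_distrib_left)
  also have "\<dots> = 0" using sum_square_wave_cdiff_right[of _ n] by (intro sum.neutral) (simp add: K_def N_def del: sum.lessThan_Suc)
  finally show ?thesis by (simp only: writhe_eq_circulant_sum N_def K_def mult_zero_right diff_zero add_0_right)
qed

lemma writhe_cong_sgn:
  assumes "\<And>i j. i \<le> 2 * n \<Longrightarrow> j \<le> 2 * n \<Longrightarrow> sgn (f j - f i) = sgn (g j - g i)"
  shows "writhe n f = writhe n g"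
  unfolding writhe_def
proof (intro sum.cong refl assms)
  fix i j
  have "(i + j) mod (2 * n + 1) < 2 * n + 1" by (rule mod_less_divisor) simp
  then show "(i + j) mod (2 * n + 1) \<le> 2 * n" by simp
qed simp

lemma writhe_uminus: "writhe n (\<lambda>i. - f i) = - writhe n f"
proof -
  have "sgn (- f i - - f j) = - sgn (f i - f j)" for i j
    by (metis diff_minus_eq_add minus_diff_eq sgn_minus uminus_add_conv_diff)
  then show ?thesis unfolding writhe_def by (simp only: sum_negf)
qed

lemma sum_of_bool_eq_card: "finite S \<Longrightarrow> (\<Sum>x\<in>S. of_bool (P x)) = (of_nat (card {x \<in> S. P x}) :: real)"
  by (simp add: of_bool_def flip: sum.inter_filter)

section \<open>Random permutations and independent labels\<close>

definition perm_prob :: "nat \<Rightarrow> (real \<Rightarrow> bool) \<Rightarrow> real" where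
  "perm_prob n A = real (card {p. p permutes {0..2 * n} \<and> A (writhe n (\<lambda>i. real (p i)))}) / fact (2 * n + 1)"

lemma sum_of_bool_permutes:
  "(\<Sum>p | p permutes {0..2 * n}. of_bool (A (writhe n (\<lambda>i. real (p i))))) = perm_prob n A * fact (2 * n + 1)"
  by (subst sum_of_bool_eq_card) (simp_all add: finite_permutations perm_prob_def del: fact_Suc)

lemma rank_permutation:
  fixes f :: "nat \<Rightarrow> nat"
  assumes "inj_on f {0..m}"
  obtains \<rho> where "\<rho> permutes {0..m}"
    "\<And>i j. i \<le> m \<Longrightarrow> j \<le> m \<Longrightarrow> sgn (real (\<rho> j) - real (\<rho> i)) = sgn (real (f j) - real (f i))"
proof -
  define R where "R i = {k\<in>{0..m}. f k < f i}" for i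
  \<comment> \<open>Outside the interval this is the identity, as \<open>permutes\<close>
    demands.\<close>
  define \<rho> where "\<rho> i = (if i \<le> m then card (R i) else i)" for i
  have lt: "card (R i) < card (R j)" if "i \<le> m" "f i < f j" for i j
    by (rule psubset_card_mono) (use that in \<open>auto simp: R_def\<close>)
  have iff: "\<rho> i < \<rho> j \<longleftrightarrow> f i < f j" if "i \<le> m" "j \<le> m" for i j
  proof
    assume *: "\<rho> i < \<rho> j"
    have "f j < f i \<Longrightarrow> \<rho> j < \<rho> i" using lt that by (simp add: \<rho>_def)
    moreover have "f i = f j \<Longrightarrow> \<rho> i = \<rho> j" using that by (simp add: \<rho>_def R_def)
    ultimately show "f i < f j" using * by (cases "f i" "f j" rule: linorder_cases) auto
  qed (use lt that in \<open>simp add: \<rho>_def\<close>)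
  have "inj_on \<rho> {0..m}"
  proof (rule inj_onI, rule ccontr)
    fix i j assume ij: "i \<in> {0..m}" "j \<in> {0..m}" "\<rho> i = \<rho> j" "i \<noteq> j"
    then have "f i \<noteq> f j" using assms by (auto dest: inj_onD)
    then show False using ij iff[of i j] iff[of j i] by auto
  qed
  moreover have "\<rho> ` {0..m} \<subseteq> {0..m}"
  proof
    fix x assume "x \<in> \<rho> ` {0..m}"
    then obtain i where i: "i \<le> m" "x = card (R i)" by (auto simp: \<rho>_def)
    have "card (R i) \<le> card ({0..m} - {i})" by (rule card_mono) (auto simp: R_def)
    then show "x \<in> {0..m}" using i by simp
  qed
  ultimately have "bij_betw \<rho> {0..m} {0..m}"
    by (simp add: bij_betw_def endo_inj_surj)
  then have "\<rho> permutes {0..m}" by (rule bij_imp_permutes) (simp add: \<rho>_def)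
  moreover have "sgn (real (\<rho> j) - real (\<rho> i)) = sgn (real (f j) - real (f i))" if "i \<le> m" "j \<le> m" for i j
    using iff[OF that] iff[OF that(2,1)] by (auto simp: sgn_if)
  ultimately show ?thesis by (rule that)
qed

text \<open>Averaging over all relabellings \<open>f \<circ> \<sigma>\<close> of an injective \<open>f\<close> gives the law of a uniformly
  random permutation, whatever \<open>f\<close> is.\<close>

lemma sum_injective_eq_perm_prob:
  fixes B :: "nat set" and n :: nat
  defines "J \<equiv> {f \<in> PiE {..<2 * n + 1} (\<lambda>_. B). inj_on f {..<2 * n + 1}}"
  assumes "finite B"
  shows "(\<Sum>f\<in>J. of_bool (A (writhe n (\<lambda>i. real (f i))))) = perm_prob n A * real (card J)"
proof -
  define w where "w f = (of_bool (A (writhe n (\<lambda>i. real (f i)))) :: real)" for f :: "nat \<Rightarrow> nat"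
  define D where "D = {0..2 * n}"
  let ?S = "{\<sigma>. \<sigma> permutes D}"
  have set: "{..<2 * n + 1} = D" by (auto simp: D_def)
  have J: "f \<circ> \<sigma> \<in> J" if "f \<in> J" "\<sigma> permutes D" for f \<sigma>
  proof -
    have "f \<circ> \<sigma> \<in> PiE D (\<lambda>_. B)"
      using that permutes_in_image[OF that(2)] unfolding J_def set PiE_def Pi_def extensional_def by simp
    moreover have "inj_on (f \<circ> \<sigma>) D"
      using that(1) unfolding J_def set
      by (intro comp_inj_on[OF permutes_inj_on[OF that(2)]]) (simp add: permutes_image[OF that(2)])
    ultimately show ?thesis unfolding J_def set by simp
  qed
  have 1: "(\<Sum>f\<in>J. w (f \<circ> \<sigma>)) = (\<Sum>f\<in>J. w f)" if s: "\<sigma> permutes D" for \<sigma>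
    by (rule sum.reindex_bij_witness[where i = "\<lambda>f. f \<circ> inv \<sigma>" and j = "\<lambda>f. f \<circ> \<sigma>"])
      (use s in \<open>auto intro!: J permutes_inv simp: comp_assoc permutes_inv_o\<close>)
  have 2: "(\<Sum>\<sigma>\<in>?S. w (f \<circ> \<sigma>)) = perm_prob n A * fact (2 * n + 1)" if f: "f \<in> J" for f
  proof -
    obtain \<rho> where \<rho>: "\<rho> permutes D"
      "\<And>i j. i \<le> 2 * n \<Longrightarrow> j \<le> 2 * n \<Longrightarrow> sgn (real (\<rho> j) - real (\<rho> i)) = sgn (real (f j) - real (f i))"
      using rank_permutation[of f "2 * n"] f unfolding J_def set D_def by auto
    have "w (f \<circ> \<sigma>) = w (\<rho> \<circ> \<sigma>)" if "\<sigma> permutes D" for \<sigma>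
    proof -
      have "writhe n (\<lambda>i. real ((f \<circ> \<sigma>) i)) = writhe n (\<lambda>i. real ((\<rho> \<circ> \<sigma>) i))"
        by (rule writhe_cong_sgn) (use permutes_in_image[OF that] in \<open>simp add: \<rho>(2) D_def\<close>)
      then show ?thesis by (simp add: w_def)
    qed
    then have "(\<Sum>\<sigma>\<in>?S. w (f \<circ> \<sigma>)) = (\<Sum>\<sigma>\<in>?S. w (\<rho> \<circ> \<sigma>))" by (intro sum.cong) auto
    also have "\<dots> = (\<Sum>\<sigma>\<in>?S. w \<sigma>)"
      by (rule sum.reindex_bij_witness[where i = "\<lambda>\<sigma>. inv \<rho> \<circ> \<sigma>" and j = "\<lambda>\<sigma>. \<rho> \<circ> \<sigma>"])
        (use \<rho>(1) in \<open>auto intro!: permutes_compose permutes_inv simp: comp_assoc[symmetric] permutes_inv_o\<close>)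
    also have "\<dots> = perm_prob n A * fact (2 * n + 1)" unfolding w_def D_def by (rule sum_of_bool_permutes)
    finally show ?thesis .
  qed
  \<comment> \<open>The double sum over \<open>f\<close> and \<open>\<sigma>\<close> is evaluated in
    both orders. For fixed \<open>\<sigma>\<close>, composition permutes \<open>J\<close>; for fixed
    \<open>f\<close>, only the ranks of \<open>f\<close> matter, and these form a permutation
    themselves.\<close>
  have "fact (2 * n + 1) * (\<Sum>f\<in>J. w f) = (\<Sum>\<sigma>\<in>?S. \<Sum>f\<in>J. w (f \<circ> \<sigma>))"
    using card_permutations[of D "2 * n + 1"] by (simp add: 1 D_def del: fact_Suc)
  also have "\<dots> = (\<Sum>f\<in>J. \<Sum>\<sigma>\<in>?S. w (f \<circ> \<sigma>))" by (rule sum.swap)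
  also have "\<dots> = fact (2 * n + 1) * (perm_prob n A * real (card J))" by (simp add: 2 del: fact_Suc)
  finally show ?thesis by (simp add: w_def del: fact_Suc)
qed

lemma perm_prob_bounds: "0 \<le> perm_prob n A" "perm_prob n A \<le> 1"
proof -
  have "card {p. p permutes {0..2 * n} \<and> A (writhe n (\<lambda>i. real (p i)))} \<le> card {p. p permutes {0..2 * n}}"
    by (rule card_mono) (auto simp: finite_permutations)
  also have "\<dots> = fact (2 * n + 1)" by (rule card_permutations) auto
  finally have "real (card {p. p permutes {0..2 * n} \<and> A (writhe n (\<lambda>i. real (p i)))}) \<le> real (fact (2 * n + 1))"
    by (simp only: of_nat_le_iff)
  then show "perm_prob n A \<le> 1" unfolding perm_prob_def by (simp del: fact_Suc add: divide_le_eq)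
qed (simp add: perm_prob_def)

locale uniform_weights =
  fixes L :: nat
  assumes L_pos: "0 < L"

sublocale uniform_weights \<subseteq> product_weights L "\<lambda>_ _. 1 / real L"
  by unfold_locales (use L_pos in auto)

context uniform_weights
begin

text \<open>The birthday bound: a new label hits one of at most \<open>N\<close> old ones with
  probability at most N / L.\<close>

lemma expect_not_inj_le: "expect N (\<lambda>f. of_bool (\<not> inj_on f {..<N})) \<le> (real N)\<^sup>2 / real L"
proof (induction N)
  case (Suc N)
  have "expect (Suc N) (\<lambda>f. of_bool (\<not> inj_on f {..<Suc N}))
     \<le> expect N (\<lambda>f. of_bool (\<not> inj_on f {..<N}) + 1 / real L * real N)"
    unfolding expect_Suc
  proof (rule expect_mono)
    fix f :: "nat \<Rightarrow> nat"
    have "(\<Sum>v<L. 1 / real L * of_bool (\<not> inj_on (f(N := v)) {..<Suc N}))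
      \<le> (\<Sum>v<L. 1 / real L * (of_bool (\<not> inj_on f {..<N}) + of_bool (v \<in> f ` {..<N})))"
    proof (intro sum_mono mult_left_mono)
      fix v
      have "inj_on (f(N := v)) {..<Suc N}" if "inj_on f {..<N}" "v \<notin> f ` {..<N}"
        using that unfolding lessThan_Suc inj_on_def by auto
      then show "(of_bool (\<not> inj_on (f(N := v)) {..<Suc N}) :: real)
          \<le> of_bool (\<not> inj_on f {..<N}) + of_bool (v \<in> f ` {..<N})" by auto
    qed simp
    also have "\<dots> = of_bool (\<not> inj_on f {..<N}) + 1 / real L * (\<Sum>v<L. of_bool (v \<in> f ` {..<N}))"
      unfolding sum_distrib_left[symmetric] distrib_left sum.distrib using L_pos by simp
    also have "(\<Sum>v<L. of_bool (v \<in> f ` {..<N}) :: real) = real (card {v \<in> {..<L}. v \<in> f ` {..<N}})"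
      by (rule sum_of_bool_eq_card) simp
    also have "1 / real L * real (card {v \<in> {..<L}. v \<in> f ` {..<N}}) \<le> 1 / real L * real N"
    proof (rule mult_left_mono)
      have "card {v \<in> {..<L}. v \<in> f ` {..<N}} \<le> card (f ` {..<N})" by (rule card_mono) auto
      then show "real (card {v \<in> {..<L}. v \<in> f ` {..<N}}) \<le> real N"
        using card_image_le[of "{..<N}" f] by simp
    qed simp
    finally show "(\<Sum>v<L. 1 / real L * of_bool (\<not> inj_on (f(N := v)) {..<Suc N}))
      \<le> of_bool (\<not> inj_on f {..<N}) + 1 / real L * real N"
      by (simp only: add_left_mono)
  qed
  also have "\<dots> \<le> (real N)\<^sup>2 / real L + real N / real L" unfolding expect_add expect_const using Suc by (intro add_mono) simp_all
  also have "\<dots> \<le> (real (Suc N))\<^sup>2 / real L"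
    unfolding add_divide_distrib[symmetric] by (intro divide_right_mono) (simp_all add: power2_eq_square algebra_simps)
  finally show ?case .
qed (simp add: expect_0)

lemma expect_eq_sum: "expect N F = (\<Sum>f\<in>PiE {..<N} (\<lambda>_. {..<L}). F f) / real L ^ N"
  unfolding expect_def sum_divide_distrib by (intro sum.cong refl) (simp add: power_one_over)

text \<open>Given distinct labels the law is exactly that of a random permutation, whence
  \<open>P = perm_prob n A * q\<close>. The error is at most the collision probability
  \<open>1 - q\<close>.\<close>

lemma perm_prob_approx:
  fixes n :: nat
  defines "N \<equiv> 2 * n + 1"
  shows "\<bar>perm_prob n A - expect N (\<lambda>f. of_bool (A (writhe n (\<lambda>i. real (f i)))))\<bar> \<le> (real N)\<^sup>2 / real L"
proof -
  define w where "w f = (of_bool (A (writhe n (\<lambda>i. real (f i)))) :: real)" for f :: "nat \<Rightarrow> nat"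
  define P where "P = expect N (\<lambda>f. of_bool (inj_on f {..<N}) * w f)"
  define q where "q = expect N (\<lambda>f. of_bool (inj_on f {..<N}))"
  define J where "J = {f \<in> PiE {..<N} (\<lambda>_. {..<L}). inj_on f {..<N}}"
  have sumJ: "(\<Sum>f\<in>PiE {..<N} (\<lambda>_. {..<L}). of_bool (inj_on f {..<N}) * g f) = (\<Sum>f\<in>J. g f :: real)" for g
    unfolding J_def by (rule sum.mono_neutral_cong_right) auto
  have J: "(\<Sum>f\<in>J. w f) = perm_prob n A * real (card J)"
    unfolding w_def J_def N_def by (rule sum_injective_eq_perm_prob) simp
  have "q = real (card J) / real L ^ N" using sumJ[of "\<lambda>_. 1"] by (simp add: q_def expect_eq_sum)
  moreover have "P = (\<Sum>f\<in>J. w f) / real L ^ N" by (simp add: P_def expect_eq_sum sumJ)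
  ultimately have P: "P = perm_prob n A * q" by (simp add: J)
  have "1 - q = expect N (\<lambda>f. 1 - of_bool (inj_on f {..<N}))" by (simp add: q_def expect_diff)
  also have "\<dots> = expect N (\<lambda>f. of_bool (\<not> inj_on f {..<N}))" by (rule expect_cong) auto
  finally have q: "1 - q \<le> (real N)\<^sup>2 / real L" using expect_not_inj_le by simp
  have "expect N (\<lambda>f. of_bool (inj_on f {..<N})) \<le> expect N (\<lambda>_. 1)" by (rule expect_mono) simp
  then have q1: "0 \<le> 1 - q" by (simp add: q_def)
  have "P \<le> expect N w" unfolding P_def by (rule expect_mono) (auto simp: w_def)
  moreover have "expect N w \<le> expect N (\<lambda>f. of_bool (inj_on f {..<N}) * w f + (1 - of_bool (inj_on f {..<N})))"
    by (rule expect_mono) (auto simp: w_def)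
  then have "expect N w \<le> P + (1 - q)" by (simp add: expect_add expect_diff P_def q_def)
  moreover have "perm_prob n A - P = perm_prob n A * (1 - q)" unfolding P by (simp add: algebra_simps)
  moreover have "0 \<le> perm_prob n A * (1 - q)" "perm_prob n A * (1 - q) \<le> 1 * (1 - q)"
    using q1 by (intro mult_nonneg_nonneg mult_right_mono perm_prob_bounds; simp)+
  ultimately have "\<bar>perm_prob n A - expect N w\<bar> \<le> 1 - q" by (auto simp: abs_le_iff)
  then show ?thesis using q unfolding w_def by (rule order_trans)
qed

end

section \<open>Degenerate forms\<close>

lemma gaussian_linearisation:
  "has_bochner_integral lborel (\<lambda>x::real. exp (2 * b * x - x\<^sup>2)) (sqrt pi * exp (b\<^sup>2))"
proof -
  have "exp (2 * b * x - x\<^sup>2) = sqrt pi * exp (b\<^sup>2) * normal_density b (1 / sqrt 2) x" for x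
  proof -
    have "- (x - b)\<^sup>2 = 2 * b * x - x\<^sup>2 - b\<^sup>2" by (simp add: power2_eq_square algebra_simps)
    then show ?thesis by (simp add: normal_density_def power_divide exp_diff)
  qed
  moreover have "has_bochner_integral lborel (\<lambda>x. sqrt pi * exp (b\<^sup>2) * normal_density b (1 / sqrt 2) x)
      (sqrt pi * exp (b\<^sup>2) * 1)"
    by (intro has_bochner_integral_mult_right) (simp add: has_bochner_integral_iff)
  ultimately show ?thesis by simp
qed

lemma gaussian_half: "has_bochner_integral lborel (\<lambda>x::real. exp (- (x\<^sup>2 / 2))) (sqrt (2 * pi))"
proof -
  have "exp (- (x\<^sup>2 / 2)) = sqrt (2 * pi) * normal_density 0 1 x" for x :: real
    by (simp add: normal_density_def)
  moreover have "has_bochner_integral lborel (\<lambda>x. sqrt (2 * pi) * normal_density 0 1 x) (sqrt (2 * pi) * 1)"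
    by (intro has_bochner_integral_mult_right) (simp add: has_bochner_integral_iff)
  ultimately show ?thesis by simp
qed

context product_weights
begin

text \<open>The square is linearised by a Gaussian integral over \<open>x\<close>, whose integrand is then bounded by
  the moment generating function of \<open>S\<close> at a multiple of \<open>x\<close>.\<close>

lemma expect_exp_square_le:
  assumes mgf: "\<And>\<mu>. expect N (\<lambda>f. exp (\<mu> * S f)) \<le> exp (\<mu>\<^sup>2 * A)"
    and "0 \<le> \<beta>" "8 * \<beta> * A \<le> 1"
  shows "expect N (\<lambda>f. exp (\<beta> * (S f)\<^sup>2)) \<le> sqrt 2"
proof -
  define b where "b = sqrt \<beta>"
  have b: "b\<^sup>2 = \<beta>" using assms(2) by (simp add: b_def)
  define w where "w f = (\<Prod>i<N. p i (f i))" for f :: "nat \<Rightarrow> nat"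
  have "has_bochner_integral lborel (\<lambda>x. \<Sum>f\<in>PiE {..<N} (\<lambda>_. {..<L}). w f * exp (2 * (b * S f) * x - x\<^sup>2))
     (\<Sum>f\<in>PiE {..<N} (\<lambda>_. {..<L}). w f * (sqrt pi * exp ((b * S f)\<^sup>2)))"
    by (intro has_bochner_integral_sum has_bochner_integral_mult_right gaussian_linearisation)
  then have 1: "has_bochner_integral lborel (\<lambda>x. expect N (\<lambda>f. exp (2 * (b * S f) * x - x\<^sup>2)))
     (expect N (\<lambda>f. sqrt pi * exp ((b * S f)\<^sup>2)))"
    by (simp add: expect_def w_def)
  have le: "expect N (\<lambda>f. exp (2 * (b * S f) * x - x\<^sup>2)) \<le> exp (- (x\<^sup>2 / 2))" for x
  proof -
    have "exp (2 * (b * S f) * x - x\<^sup>2) = exp (- x\<^sup>2) * exp ((2 * b * x) * S f)" for f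
      by (simp add: exp_add[symmetric] mult_ac)
    then have "expect N (\<lambda>f. exp (2 * (b * S f) * x - x\<^sup>2)) = exp (- x\<^sup>2) * expect N (\<lambda>f. exp ((2 * b * x) * S f))"
      by (simp add: expect_cmult)
    also have "\<dots> \<le> exp (- x\<^sup>2) * exp ((2 * b * x)\<^sup>2 * A)" by (intro mult_left_mono mgf) simp
    also have "\<dots> = exp (- x\<^sup>2 + 4 * \<beta> * A * x\<^sup>2)"
      unfolding exp_add[symmetric] power_mult_distrib b by (simp add: mult_ac)
    \<comment> \<open>The hypothesis gives up at most half of the exponent x^2. The price is the
      factor sqrt 2 between the integrals of exp (- x^2 / 2) and exp (- x^2).\<close>
    also have "\<dots> \<le> exp (- (x\<^sup>2 / 2))"
      using mult_right_mono[OF assms(3), of "x\<^sup>2 / 2"] by (simp add: mult_ac)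
    finally show ?thesis .
  qed
  have "expect N (\<lambda>f. sqrt pi * exp ((b * S f)\<^sup>2)) \<le> sqrt (2 * pi)"
  proof -
    have "(LBINT x. expect N (\<lambda>f. exp (2 * (b * S f) * x - x\<^sup>2))) \<le> (LBINT x. exp (- (x\<^sup>2 / 2)))"
      by (rule integral_mono) (use 1 gaussian_half le in \<open>simp_all add: has_bochner_integral_iff\<close>)
    then show ?thesis using 1 gaussian_half by (simp add: has_bochner_integral_iff)
  qed
  then show ?thesis by (simp add: expect_cmult power_mult_distrib b real_sqrt_mult)
qed

lemma expect_exp_sum_le:
  assumes bound: "\<And>i u. i < N \<Longrightarrow> u < L \<Longrightarrow> \<bar>Y i u\<bar> \<le> b"
    and centred: "\<And>i. i < N \<Longrightarrow> (\<Sum>u<L. p i u * Y i u) = 0"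
    and var: "(\<Sum>i<N. \<Sum>u<L. p i u * (Y i u)\<^sup>2) \<le> v"
  shows "expect N (\<lambda>f. exp (\<mu> * (\<Sum>i<N. Y i (f i)))) \<le> exp (exp (\<bar>\<mu>\<bar> * b) / 2 * (\<mu>\<^sup>2 * v))"
proof -
  have "expect N (\<lambda>f. exp (\<mu> * (\<Sum>i<N. Y i (f i)))) = (\<Prod>i<N. \<Sum>u<L. p i u * exp (\<mu> * Y i u))"
    by (simp add: sum_distrib_left exp_sum expect_prod[of N "\<lambda>i u. exp (\<mu> * Y i u)"])
  also have "\<dots> \<le> (\<Prod>i<N. exp (exp (\<bar>\<mu>\<bar> * b) / 2 * (\<Sum>u<L. p i u * (\<mu> * Y i u)\<^sup>2)))"
  proof (rule prod_mono, intro conjI)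
    fix i assume i: "i \<in> {..<N}"
    show "0 \<le> (\<Sum>u<L. p i u * exp (\<mu> * Y i u))" by (intro sum_nonneg mult_nonneg_nonneg p_nonneg) simp
    have "(\<Sum>u<L. p i u * (\<mu> * Y i u)) = 0"
      using centred[of i] i by (simp add: mult.left_commute[of _ \<mu>] sum_distrib_left[symmetric])
    then show "(\<Sum>u<L. p i u * exp (\<mu> * Y i u)) \<le> exp (exp (\<bar>\<mu>\<bar> * b) / 2 * (\<Sum>u<L. p i u * (\<mu> * Y i u)\<^sup>2))"
      using i bound by (intro centred_exp_le) (auto simp: abs_mult intro!: mult_left_mono)
  qed
  also have "\<dots> = exp (exp (\<bar>\<mu>\<bar> * b) / 2 * (\<mu>\<^sup>2 * (\<Sum>i<N. \<Sum>u<L. p i u * (Y i u)\<^sup>2)))"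
    by (simp add: exp_sum[symmetric] sum_distrib_left power_mult_distrib mult_ac)
  also have "\<dots> \<le> exp (exp (\<bar>\<mu>\<bar> * b) / 2 * (\<mu>\<^sup>2 * v))"
    using var by (simp add: mult_left_mono)
  finally show ?thesis .
qed

end

context uniform_weights
begin

text \<open>The bound \<open>\<sigma>\<close> on the average variance makes the row sums subgaussian with a small
  constant: for \<open>\<bar>\<mu>\<bar> \<le> \<Lambda>\<close> by the variance, for larger \<open>\<bar>\<mu>\<bar>\<close> by boundedness alone.\<close>

lemma row_sum_exp_square_le:
  assumes "0 < \<beta>" "0 < N"
    and bound: "\<And>i u. i < N \<Longrightarrow> u < L \<Longrightarrow> \<bar>Y i u\<bar> \<le> 2"
    and centred: "\<And>i. i < N \<Longrightarrow> (\<Sum>u<L. 1 / real L * Y i u) = 0"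
    and var: "(\<Sum>i<N. \<Sum>u<L. 1 / real L * (Y i u)\<^sup>2) \<le> real N * \<sigma>"
    and \<sigma>: "\<sigma> \<le> exp (- 32 * \<beta>) / (4 * \<beta>)"
  shows "expect N (\<lambda>f. exp (\<beta> / real N * (\<Sum>i<N. Y i (f i))\<^sup>2)) \<le> sqrt 2"
proof (rule expect_exp_square_le)
  fix \<mu> :: real
  let ?S = "\<lambda>f. \<Sum>i<N. Y i (f i)"
  show "expect N (\<lambda>f. exp (\<mu> * ?S f)) \<le> exp (\<mu>\<^sup>2 * (real N / (8 * \<beta>)))"
  \<comment> \<open>Above this threshold the trivial bound \<bar>\<mu>\<bar> * 2 * N is at most
    \<mu>^2 * N / (8 * \<beta>). Up to it, exp (2 * \<bar>\<mu>\<bar>) is at most exp (32 *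
    \<beta>), which the condition on \<sigma> cancels.\<close>
  proof (cases "\<bar>\<mu>\<bar> \<le> 16 * \<beta>")
    case True
    have "exp (\<bar>\<mu>\<bar> * 2) / 2 * (\<mu>\<^sup>2 * (real N * \<sigma>)) \<le> exp (32 * \<beta>) / 2 * (\<mu>\<^sup>2 * (real N * (exp (- 32 * \<beta>) / (4 * \<beta>))))"
    proof (rule mult_mono)
      show "\<mu>\<^sup>2 * (real N * \<sigma>) \<le> \<mu>\<^sup>2 * (real N * (exp (- 32 * \<beta>) / (4 * \<beta>)))"
        using \<sigma> by (intro mult_left_mono) auto
      have "0 \<le> real N * \<sigma>"
        by (rule order_trans[OF _ var]) (intro sum_nonneg mult_nonneg_nonneg, auto)
      then show "0 \<le> \<mu>\<^sup>2 * (real N * \<sigma>)" by simp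
    qed (use True in auto)
    also have "\<dots> = \<mu>\<^sup>2 * (real N / (8 * \<beta>))" using assms(1) by (simp add: exp_minus field_simps)
    finally show ?thesis
      using expect_exp_sum_le[where Y = Y and b = 2 and v = "real N * \<sigma>" and \<mu> = \<mu> and N = N, OF bound centred var]
      by (meson exp_le_cancel_iff order_trans)
  next
    case False
    have "expect N (\<lambda>f. exp (\<mu> * ?S f)) \<le> expect N (\<lambda>_. exp (\<mu>\<^sup>2 * (real N / (8 * \<beta>))))"
    proof (rule expect_mono)
      fix f assume f: "f \<in> PiE {..<N} (\<lambda>_. {..<L})"
      have "\<bar>?S f\<bar> \<le> (\<Sum>i<N. 2)" using f by (intro order_trans[OF sum_abs] sum_mono bound) auto
      then have "\<mu> * ?S f \<le> \<bar>\<mu>\<bar> * (2 * real N)"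
        using mult_left_mono[of "\<bar>?S f\<bar>" "2 * real N" "\<bar>\<mu>\<bar>"] abs_ge_self[of "\<mu> * ?S f"] by (simp add: abs_mult)
      also have "\<dots> \<le> \<mu>\<^sup>2 * (real N / (8 * \<beta>))"
      proof -
        have "\<bar>\<mu>\<bar> * (16 * \<beta>) \<le> \<bar>\<mu>\<bar> * \<bar>\<mu>\<bar>" using False by (intro mult_left_mono) auto
        then have "\<bar>\<mu>\<bar> * (16 * \<beta>) * (real N / (8 * \<beta>)) \<le> \<mu>\<^sup>2 * (real N / (8 * \<beta>))"
          using assms(1) by (intro mult_right_mono) (auto simp: power2_eq_square)
        then show ?thesis using assms(1) by simp
      qed
      finally show "exp (\<mu> * ?S f) \<le> exp (\<mu>\<^sup>2 * (real N / (8 * \<beta>)))" by simp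
    qed
    then show ?thesis by simp
  qed
qed (use assms(1,2) in auto)

text \<open>Any rate \<open>z\<close> can be reached, at the price of a small \<sigma>. The
  martingale is taken at twice that rate, so that a large value of the form costs
  \<open>z * s\<close> either in the compensated martingale or in its quadratic variation
  \<open>V\<close>. As \<open>V\<close> is an average of squared row sums over positions and labels,
  Jensen's inequality reduces its exponential moment to
  \<open>row_sum_exp_square_le\<close>.\<close>

lemma degenerate_form_tail:
  assumes "0 < z" "0 < N"
    and bound: "\<And>i j u v. i < N \<Longrightarrow> j < N \<Longrightarrow> u < L \<Longrightarrow> v < L \<Longrightarrow> \<bar>g i j u v\<bar> \<le> 2"
    and centred_right: "\<And>i j u. i < N \<Longrightarrow> j < N \<Longrightarrow> u < L \<Longrightarrow> (\<Sum>v<L. g i j u v) = 0"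
    and centred_left: "\<And>i j v. i < N \<Longrightarrow> j < N \<Longrightarrow> v < L \<Longrightarrow> (\<Sum>u<L. g i j u v) = 0"
    and var: "\<And>j v. j < N \<Longrightarrow> v < L \<Longrightarrow> (\<Sum>i<N. \<Sum>u<L. 1 / real L * (g i j u v)\<^sup>2) \<le> real N * \<sigma>"
    and \<beta>: "\<beta> = 8 * z\<^sup>2 * exp (8 * z)"
    and \<sigma>: "\<sigma> \<le> exp (- 32 * \<beta>) / (4 * \<beta>)"
  shows "expect N (\<lambda>f. of_bool (s \<le> 2 / real N * (\<Sum>j<N. \<Sum>i<j. g i j (f i) (f j)))) \<le> 3 * exp (- (z * s))"
proof -
  \<comment> \<open>These increments add up to 2 * z * R. A row has at most \<open>N\<close> entries
    of size at most 2, so each increment is bounded by 8 * z.\<close>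
  define D where "D j f v = 4 * z / real N * (\<Sum>i<j. g i j (f i) v)" for j f v
  define R where "R f = 2 / real N * (\<Sum>j<N. \<Sum>i<j. g i j (f i) (f j))" for f
  define V where "V f = (\<Sum>j<N. exp (8 * z) / 2 * (\<Sum>v<L. 1 / real L * (D j f v)\<^sup>2))" for f
  have \<beta>_pos: "0 < \<beta>" using assms(1) by (simp add: \<beta>)
  have 1: "expect N (\<lambda>f. exp (\<Sum>j<N. D j f (f j) - exp (8 * z) / 2 * (\<Sum>v<L. 1 / real L * (D j f v)\<^sup>2))) \<le> 1"
  proof (rule martingale_exponential)
    fix j f g' v assume "j < N" "\<And>i. i < j \<Longrightarrow> f i = (g' i :: nat)"
    then show "D j f v = D j g' v" by (simp add: D_def)
  next
    fix j f assume j: "j < N" and f: "f \<in> PiE {..<j} (\<lambda>_. {..<L})"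
    have "(\<Sum>v<L. 1 / real L * D j f v) = 4 * z / real N * (1 / real L) * (\<Sum>v<L. \<Sum>i<j. g i j (f i) v)"
      unfolding D_def sum_distrib_left by (intro sum.cong refl) simp
    also have "(\<Sum>v<L. \<Sum>i<j. g i j (f i) v) = (\<Sum>i<j. \<Sum>v<L. g i j (f i) v)" by (rule sum.swap)
    also have "\<dots> = 0"
    proof (rule sum.neutral, rule ballI, rule centred_right)
      fix i assume "i \<in> {..<j}"
      then show "i < N" "j < N" "f i < L" using j PiE_mem[OF f, of i] by simp_all
    qed
    finally show "(\<Sum>v<L. 1 / real L * D j f v) = 0" by simp
  next
    fix j f v assume j: "j < N" and f: "f \<in> PiE {..<j} (\<lambda>_. {..<L})" and v: "v < L"
    have "\<bar>\<Sum>i<j. g i j (f i) v\<bar> \<le> (\<Sum>i<j. 2)"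
    proof (intro order_trans[OF sum_abs] sum_mono bound)
      fix i assume "i \<in> {..<j}"
      then show "i < N" "j < N" "f i < L" "v < L" using j v PiE_mem[OF f, of i] by simp_all
    qed
    also have "\<dots> \<le> 2 * real N" using j by simp
    finally have "\<bar>D j f v\<bar> \<le> 4 * z / real N * (2 * real N)"
      using assms(1) unfolding D_def abs_mult by (intro mult_mono) auto
    then show "\<bar>D j f v\<bar> \<le> 8 * z" using assms(2) by simp
  qed
  have "(\<Sum>j<N. D j f (f j)) = 2 * z * R f" for f
    by (simp add: D_def R_def sum_distrib_left mult_ac)
  then have mart: "expect N (\<lambda>f. exp (2 * z * R f - V f)) \<le> 1"
    using 1 by (simp only: sum_subtractf V_def)
  \<comment> \<open>Padding with zeros gives every row the length \<open>N\<close>, so that one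
    lemma serves all \<open>j\<close>.\<close>
  define S where "S j v f = (\<Sum>i<N. (if i < j then g i j (f i) v else 0))" for j v f
  have S: "(\<Sum>i<j. g i j (f i) v) = S j v f" if "j < N" for j v f
    unfolding S_def using that by (intro sum.mono_neutral_cong_left) auto
  have V: "V f = (\<Sum>j<N. \<Sum>v<L. 1 / real N * (1 / real L) * (\<beta> / real N * (S j v f)\<^sup>2))" for f
  proof -
    \<comment> \<open>The origin of \<beta>: exp (8 * z) / 2 times the square of 4 * z is 8 * z^2 *
      exp (8 * z).\<close>
    have "exp (8 * z) / 2 * (1 / real L * (D j f v)\<^sup>2) = 1 / real N * (1 / real L) * (\<beta> / real N * (S j v f)\<^sup>2)"
      if "j < N" for j v
      using S[OF that] by (simp add: D_def \<beta> power_mult_distrib power_divide power2_eq_square field_simps)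
    then show ?thesis unfolding V_def sum_distrib_left by (intro sum.cong refl) simp
  qed
  have "expect N (\<lambda>f. exp (V f)) \<le> expect N (\<lambda>f. \<Sum>x\<in>{..<N}\<times>{..<L}. 1 / real N * (1 / real L) * exp (\<beta> / real N * (S (fst x) (snd x) f)\<^sup>2))"
  proof (rule expect_mono)
    fix f
    have "convex_on UNIV (exp :: real \<Rightarrow> real)" by (rule exp_convex)
    then have "exp (\<Sum>x\<in>{..<N}\<times>{..<L}. (1 / real N * (1 / real L)) *\<^sub>R (\<beta> / real N * (S (fst x) (snd x) f)\<^sup>2))
      \<le> (\<Sum>x\<in>{..<N}\<times>{..<L}. 1 / real N * (1 / real L) * exp (\<beta> / real N * (S (fst x) (snd x) f)\<^sup>2))"
      using assms(2) L_pos by (intro convex_on_sum[where C = UNIV]) auto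
    moreover have "V f = (\<Sum>x\<in>{..<N}\<times>{..<L}. (1 / real N * (1 / real L)) *\<^sub>R (\<beta> / real N * (S (fst x) (snd x) f)\<^sup>2))"
      unfolding V sum.cartesian_product by (simp add: case_prod_unfold)
    ultimately show "exp (V f) \<le> (\<Sum>x\<in>{..<N}\<times>{..<L}. 1 / real N * (1 / real L) * exp (\<beta> / real N * (S (fst x) (snd x) f)\<^sup>2))"
      by simp
  qed
  also have "\<dots> = (\<Sum>x\<in>{..<N}\<times>{..<L}. 1 / real N * (1 / real L) * expect N (\<lambda>f. exp (\<beta> / real N * (S (fst x) (snd x) f)\<^sup>2)))"
    unfolding expect_sum expect_cmult ..
  also have "\<dots> \<le> (\<Sum>x\<in>{..<N}\<times>{..<L}. 1 / real N * (1 / real L) * sqrt 2)"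
  proof (intro sum_mono mult_left_mono)
    fix x assume "x \<in> {..<N}\<times>{..<L}"
    then have j: "fst x < N" and v: "snd x < L" by auto
    let ?Y = "\<lambda>i u. if i < fst x then g i (fst x) u (snd x) else 0"
    show "expect N (\<lambda>f. exp (\<beta> / real N * (S (fst x) (snd x) f)\<^sup>2)) \<le> sqrt 2"
      unfolding S_def
    proof (rule row_sum_exp_square_le[where Y = ?Y and \<sigma> = \<sigma>])
      fix i assume i: "i < N"
      show "(\<Sum>u<L. 1 / real L * ?Y i u) = 0"
        using centred_left[OF i j v] by (cases "i < fst x") (simp_all add: sum_divide_distrib[symmetric])
    next
      have "(\<Sum>i<N. \<Sum>u<L. 1 / real L * (?Y i u)\<^sup>2) \<le> (\<Sum>i<N. \<Sum>u<L. 1 / real L * (g i (fst x) u (snd x))\<^sup>2)"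
        by (intro sum_mono) auto
      also have "\<dots> \<le> real N * \<sigma>" by (rule var[OF j v])
      finally show "(\<Sum>i<N. \<Sum>u<L. 1 / real L * (?Y i u)\<^sup>2) \<le> real N * \<sigma>" .
    qed (use \<beta>_pos assms(2) bound j v \<sigma> in auto)
  qed simp
  also have "\<dots> = sqrt 2" using assms(2) L_pos by simp
  also have "\<dots> \<le> 2" by (simp add: real_le_lsqrt real_sqrt_le_iff sqrt_le_D)
  finally have EV: "expect N (\<lambda>f. exp (V f)) \<le> 2" .
  \<comment> \<open>If \<open>R\<close> is large, then so is the compensated martingale or its quadratic variation.\<close>
  have "expect N (\<lambda>f. of_bool (s \<le> R f)) \<le> expect N (\<lambda>f. of_bool (z * s \<le> 2 * z * R f - V f) + of_bool (z * s \<le> V f))"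
  proof (rule expect_mono)
    fix f
    have "z * s \<le> 2 * z * R f - V f \<or> z * s \<le> V f" if "s \<le> R f"
      using mult_left_mono[OF that, of z] assms(1) unfolding mult.assoc by linarith
    then show "of_bool (s \<le> R f) \<le> (of_bool (z * s \<le> 2 * z * R f - V f) + of_bool (z * s \<le> V f) :: real)" by auto
  qed
  also have "\<dots> \<le> exp (- (z * s)) * expect N (\<lambda>f. exp (2 * z * R f - V f)) + exp (- (z * s)) * expect N (\<lambda>f. exp (V f))"
    unfolding expect_add by (intro add_mono expect_chernoff)
  also have "\<dots> \<le> exp (- (z * s)) * 1 + exp (- (z * s)) * 2"
    using mart EV by (intro add_mono mult_left_mono) auto
  finally show ?thesis by (simp add: R_def)
qed

end

section \<open>Upper bound\<close>

text \<open>A finite grid of directions: rounding \<open>x / \<bar>x\<bar>\<close> towards zero to a multiple of \<open>1 / J\<close> stays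
  in the unit ball and loses at most \<open>card I / J\<close> of the length of \<open>x\<close>.\<close>

lemma finite_direction_net:
  fixes \<epsilon> :: real
  assumes "finite I" "0 < \<epsilon>"
  obtains V :: "('i \<Rightarrow> real) set"
  where "finite V" "\<And>v. v \<in> V \<Longrightarrow> (\<Sum>i\<in>I. (v i)\<^sup>2) \<le> 1"
    "\<And>x. \<exists>v\<in>V. (1 - \<epsilon>) * sqrt (\<Sum>i\<in>I. (x i)\<^sup>2) \<le> (\<Sum>i\<in>I. v i * x i)"
proof -
  obtain J :: nat where J: "real (card I) / \<epsilon> < real J" using reals_Archimedean2 by blast
  then have J_pos: "0 < real J" using assms(2) by (meson divide_nonneg_pos le_less_trans of_nat_0_le_iff)
  have J_large: "real (card I) / real J \<le> \<epsilon>" using J J_pos assms(2) by (simp add: field_simps)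
  define grid where "grid = (\<lambda>k. real_of_int k / real J) ` {- int J..int J}"
  define V where "V = {v \<in> PiE I (\<lambda>_. grid). (\<Sum>i\<in>I. (v i)\<^sup>2) \<le> 1}"
  have "finite (PiE I (\<lambda>_. grid))" using assms(1) by (intro finite_PiE) (auto simp: grid_def)
  then have "finite V" by (rule rev_finite_subset) (auto simp: V_def)
  moreover have "\<exists>v\<in>V. (1 - \<epsilon>) * sqrt (\<Sum>i\<in>I. (x i)\<^sup>2) \<le> (\<Sum>i\<in>I. v i * x i)" for x :: "'i \<Rightarrow> real"
  proof (cases "(\<Sum>i\<in>I. (x i)\<^sup>2) = 0")
    case True
    have "restrict (\<lambda>_. 0) I \<in> V" by (auto simp: V_def grid_def image_iff intro!: bexI[of _ 0])
    then show ?thesis using True by (intro bexI[of _ "restrict (\<lambda>_. 0) I"]) auto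
  next
    case False
    define r where "r = sqrt (\<Sum>i\<in>I. (x i)\<^sup>2)"
    have r2: "r\<^sup>2 = (\<Sum>i\<in>I. (x i)\<^sup>2)" by (simp add: r_def sum_nonneg)
    have r: "0 < r" using False by (simp add: r_def sum_nonneg less_le)
    define k where "k i = \<lfloor>real J * \<bar>x i\<bar> / r\<rfloor>" for i
    define v where "v = restrict (\<lambda>i. sgn (x i) * (real_of_int (k i) / real J)) I"
    have xr: "\<bar>x i\<bar> \<le> r" if "i \<in> I" for i
    proof -
      have "(x i)\<^sup>2 \<le> (\<Sum>i\<in>I. (x i)\<^sup>2)" using assms(1) that by (intro member_le_sum) auto
      then show ?thesis using r unfolding r2[symmetric] by (simp add: abs_le_square_iff[symmetric])
    qed
    have k0: "0 \<le> k i" for i using r J_pos by (simp add: k_def)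
    have k_le: "real_of_int (k i) \<le> real J * \<bar>x i\<bar> / r" for i by (simp add: k_def)
    have k_ge: "real J * \<bar>x i\<bar> / r - 1 \<le> real_of_int (k i)" for i unfolding k_def by linarith
    have kJ: "k i \<le> int J" if "i \<in> I" for i
    proof -
      have "real J * \<bar>x i\<bar> / r \<le> real J" using xr[OF that] r by (simp add: divide_le_eq mult_left_mono)
      then have "real_of_int (k i) \<le> real J" using k_le[of i] by linarith
      then show ?thesis by linarith
    qed
    have v_grid: "v i \<in> grid" if "i \<in> I" for i
    proof -
      have "v i = real_of_int (if x i = 0 then 0 else if 0 < x i then k i else - k i) / real J"
        using that by (auto simp: v_def sgn_if)
      moreover have "(if x i = 0 then 0 else if 0 < x i then k i else - k i) \<in> {- int J..int J}"
        using kJ[OF that] k0[of i] by auto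
      ultimately show ?thesis unfolding grid_def by (rule image_eqI)
    qed
    have v2: "(v i)\<^sup>2 \<le> (x i)\<^sup>2 / r\<^sup>2" if "i \<in> I" for i
    proof -
      have "\<bar>v i\<bar> \<le> real_of_int (k i) / real J"
        using that k0[of i] by (auto simp: v_def abs_mult sgn_if)
      also have "\<dots> \<le> \<bar>x i\<bar> / r" using k_le[of i] J_pos by (simp add: divide_le_eq mult.commute)
      finally have "\<bar>v i\<bar>\<^sup>2 \<le> (\<bar>x i\<bar> / r)\<^sup>2" by (intro power_mono) auto
      then show ?thesis by (simp add: power_divide)
    qed
    have "(\<Sum>i\<in>I. (v i)\<^sup>2) \<le> (\<Sum>i\<in>I. (x i)\<^sup>2 / r\<^sup>2)" by (intro sum_mono v2)
    also have "\<dots> = 1" using r by (simp add: sum_divide_distrib[symmetric] r2[symmetric])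
    finally have V: "v \<in> V" using v_grid by (auto simp: V_def v_def)
    have "(1 - \<epsilon>) * r \<le> r - real (card I) / real J * r" using mult_right_mono[OF J_large, of r] r by (simp add: left_diff_distrib)
    also have "\<dots> = (\<Sum>i\<in>I. (x i)\<^sup>2 / r) - (\<Sum>i\<in>I. r / real J)"
    proof -
      have "(\<Sum>i\<in>I. (x i)\<^sup>2 / r) = r"
        unfolding sum_divide_distrib[symmetric] r2[symmetric] using r by (simp add: power2_eq_square)
      then show ?thesis by simp
    qed
    also have "\<dots> = (\<Sum>i\<in>I. (x i)\<^sup>2 / r - r / real J)" by (simp add: sum_subtractf)
    also have "\<dots> \<le> (\<Sum>i\<in>I. v i * x i)"
    proof (rule sum_mono)
      fix i assume i: "i \<in> I"
      have "\<bar>x i\<bar> / real J \<le> r / real J" using xr[OF i] J_pos by (intro divide_right_mono) auto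
      then have "(x i)\<^sup>2 / r - r / real J \<le> \<bar>x i\<bar>\<^sup>2 / r - \<bar>x i\<bar> / real J" by simp
      also have "\<dots> = (real J * \<bar>x i\<bar> / r - 1) / real J * \<bar>x i\<bar>"
        using J_pos r by (simp add: left_diff_distrib diff_divide_distrib power2_eq_square del: abs_mult_self_eq)
      also have "\<dots> \<le> real_of_int (k i) / real J * \<bar>x i\<bar>"
        using k_ge[of i] J_pos by (intro mult_right_mono divide_right_mono) auto
      also have "\<dots> = v i * x i" using i by (auto simp: v_def sgn_if)
      finally show "(x i)\<^sup>2 / r - r / real J \<le> v i * x i" .
    qed
    finally show ?thesis using V by (auto simp: r_def)
  qed
  ultimately show ?thesis by (intro that) (auto simp: V_def)
qed

section \<open>Blocks of positions and cells of labels\<close>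

lemma sum_div_block:
  fixes F :: "nat \<Rightarrow> real"
  assumes "0 < k"
  shows "(\<Sum>i<n * k. F (i div k)) = real k * (\<Sum>a<n. F a)"
proof -
  have "(\<Sum>i<n * k. F (i div k)) = (\<Sum>a<n. \<Sum>i\<in>{a * k..<a * k + k}. F (i div k))"
    by (rule sum.nat_group[symmetric])
  also have "\<dots> = (\<Sum>a<n. \<Sum>i\<in>{a * k..<a * k + k}. F a)"
  proof (intro sum.cong refl arg_cong[where f = F])
    fix a i assume "i \<in> {a * k..<a * k + k}"
    then show "i div k = a" using assms by (intro div_nat_eqI) (auto simp: mult.commute)
  qed
  finally show ?thesis by (simp add: sum_distrib_left)
qed

lemma saw_abs_le_1: "d < m \<Longrightarrow> \<bar>saw m d\<bar> \<le> 1"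
  by (auto simp: saw_def abs_le_iff field_simps)

lemma square_wave_abs_le_1: "\<bar>square_wave n d\<bar> \<le> 1"
  by (simp add: square_wave_def)

lemma saw_antisym:
  assumes "u < L" "v < L"
  shows "saw L (cdiff L v u) = - saw L (cdiff L u v)"
  using assms sgn_minus[of "real v - real u"] by (simp add: saw_cdiff minus_divide_left[symmetric] diff_divide_distrib)

text \<open>Labels in different cells are ordered as their cells, so the signs agree. The linear
  parts differ by at most one cell width, that is 2 / m.\<close>

lemma saw_cells:
  assumes "u < m * r" "v < m * r" "u div r \<noteq> v div r"
  shows "\<bar>saw (m * r) (cdiff (m * r) u v) - saw m (cdiff m (u div r) (v div r))\<bar> \<le> 2 / real m"
proof -
  have m: "0 < m" and r: "0 < r" using assms(1) by (auto intro: Nat.gr0I)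
  define a b where "a = u div r" and "b = v div r"
  have ab: "a < m" "b < m" using assms by (simp_all add: a_def b_def less_mult_imp_div_less)
  have u: "real u = real a * real r + real (u mod r)" and v: "real v = real b * real r + real (v mod r)"
    unfolding a_def b_def by (metis div_mult_mod_eq of_nat_add of_nat_mult)+
  have "sgn (real v - real u) = sgn (real b - real a)"
  proof (cases "a < b")
    case True
    then have "u < v" unfolding a_def b_def by (meson div_le_mono leD leI)
    then show ?thesis using True by simp
  next
    case False
    then have "b < a" using assms(3) by (simp add: a_def b_def)
    then have "v < u" unfolding a_def b_def by (meson div_le_mono leD leI)
    then show ?thesis using \<open>b < a\<close> by simp
  qed
  then have "saw (m * r) (cdiff (m * r) u v) - saw m (cdiff m a b)
    = 2 / real m * ((real (u mod r) - real (v mod r)) / real r)"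
    unfolding saw_cdiff[OF assms(1,2)] saw_cdiff[OF ab] using m r by (simp add: u v field_simps)
  also have "\<bar>\<dots>\<bar> \<le> 2 / real m * 1"
  proof -
    have "\<bar>real (u mod r) - real (v mod r)\<bar> \<le> real r"
      using mod_less_divisor[OF r, of u] mod_less_divisor[OF r, of v] by linarith
    then show ?thesis unfolding abs_mult using r by (intro mult_mono) (auto simp: divide_le_eq)
  qed
  finally show ?thesis by (simp add: a_def b_def)
qed

text \<open>The half period is \<open>c * q + e\<close> with \<open>q = 2 * e + 1\<close>. Positions
  in blocks at distance \<open>D\<close> have a distance strictly between (D - 1) * q and (D + 1) *
  q, and this range meets a sign change of the wave only for \<open>D\<close> equal to 0,
  \<open>c\<close> or \<open>c + 1\<close>.\<close>

lemma square_wave_blocks: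
  assumes "i < (2 * c + 1) * (2 * e + 1)" "j < (2 * c + 1) * (2 * e + 1)"
    and d: "cdiff (2 * c + 1) (i div (2 * e + 1)) (j div (2 * e + 1)) \<notin> {0, c, c + 1}"
  shows "square_wave (2 * c * e + c + e) (cdiff ((2 * c + 1) * (2 * e + 1)) i j)
    = square_wave c (cdiff (2 * c + 1) (i div (2 * e + 1)) (j div (2 * e + 1)))"
proof -
  define q where "q = 2 * e + 1"
  define a b where "a = i div q" and "b = j div q"
  define M where "M = 2 * c + 1"
  define D where "D = cdiff M a b"
  have q: "0 < q" and "e < q" by (simp_all add: q_def)
  have ab: "a < M" "b < M" using assms(1,2) by (simp_all add: a_def b_def M_def q_def less_mult_imp_div_less)
  have i: "i = a * q + i mod q" and j: "j = b * q + j mod q" by (simp_all add: a_def b_def)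
  have mod: "i mod q < q" "j mod q < q" using q by simp_all
  have n: "2 * c * e + c + e = c * q + e" by (simp add: q_def algebra_simps)
  have D: "D \<noteq> 0" "D \<noteq> c" "D \<noteq> c + 1" using d by (auto simp: D_def M_def a_def b_def q_def)
  have "a \<noteq> b" using D(1) ab by (auto simp: D_def cdiff_eq_if)
  have "i < M * q" "j < M * q" using assms(1,2) by (simp_all add: M_def q_def)
  \<comment> \<open>The distance is \<open>D * q\<close> plus the difference of the offsets within
    the blocks, written additively to avoid truncated subtraction.\<close>
  have main: "cdiff (M * q) i j + i mod q = D * q + j mod q"
  proof (cases "a < b")
    case True
    then have "Suc a * q \<le> b * q" by (intro mult_le_mono1) simp
    then have "i \<le> j" using i j mod unfolding mult_Suc by linarith
    then have "cdiff (M * q) i j = j - i" using \<open>i < M * q\<close> \<open>j < M * q\<close> by (simp add: cdiff_eq_if)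
    moreover have "D * q + a * q = b * q" using True ab by (simp add: D_def cdiff_eq_if flip: add_mult_distrib)
    ultimately show ?thesis using i j \<open>i \<le> j\<close> by linarith
  next
    case False
    then have "b < a" using \<open>a \<noteq> b\<close> by simp
    then have "Suc b * q \<le> a * q" by (intro mult_le_mono1) simp
    then have "j < i" using i j mod unfolding mult_Suc by linarith
    then have "cdiff (M * q) i j = j + M * q - i" using \<open>i < M * q\<close> \<open>j < M * q\<close> by (simp add: cdiff_eq_if)
    moreover have "D * q + a * q = b * q + M * q" using \<open>b < a\<close> ab by (simp add: D_def cdiff_eq_if flip: add_mult_distrib)
    ultimately show ?thesis using i j \<open>j < i\<close> \<open>i < M * q\<close> by linarith
  qed
  have "square_wave (c * q + e) (cdiff (M * q) i j) = square_wave c D"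
  proof (cases "D \<le> c")
    case True
    then have "Suc D * q \<le> c * q" using D(2) by (intro mult_le_mono1) simp
    moreover have "q \<le> D * q" using D(1) by simp
    ultimately have "0 < cdiff (M * q) i j \<and> cdiff (M * q) i j \<le> c * q + e"
      using main mod unfolding mult_Suc by linarith
    then show ?thesis using True D(1) by (simp add: square_wave_def)
  next
    case False
    then have "Suc (Suc c) * q \<le> D * q" using D(3) by (intro mult_le_mono1) simp
    then have "c * q + e < cdiff (M * q) i j" 
      using main mod \<open>e < q\<close> unfolding mult_Suc by linarith
    then show ?thesis using False by (simp add: square_wave_def)
  qed
  then show ?thesis unfolding n by (simp only: D_def M_def a_def b_def q_def)
qed

text \<open>The \<open>N = M * q\<close> positions are grouped into \<open>M\<close> blocks of length \<open>q\<close>, the \<open>m * r\<close> labels into \<open>m\<close>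
  cells of length \<open>r\<close>. The error \<open>g\<close> made by replacing both kernels by their values on blocks and cells
  is small on average, but still degenerate in each label.\<close>

locale block_weights =
  fixes c e m r :: nat
  assumes m_pos: "0 < m" and r_pos: "0 < r"

sublocale block_weights \<subseteq> uniform_weights "m * r"
  by unfold_locales (use m_pos r_pos in simp)

context block_weights
begin

definition "M = 2 * c + 1"
definition "q = 2 * e + 1"
definition "N = M * q"
definition "n = 2 * c * e + c + e"
definition "K i j = square_wave n (cdiff N i j)"
definition "K_block a b = square_wave c (cdiff M a b)"
definition "H u v = saw (m * r) (cdiff (m * r) u v)"
definition "H_cell a b = saw m (cdiff m a b)"
definition "g i j u v = K i j * H u v - K_block (i div q) (j div q) * H_cell (u div r) (v div r)"

lemma M_pos: "0 < M" and q_pos: "0 < q" and N_pos: "0 < N"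
  by (simp_all add: M_def q_def N_def)

lemma N_eq: "N = 2 * n + 1"
  by (simp add: N_def M_def q_def n_def algebra_simps)

lemma block_less: "i < N \<Longrightarrow> i div q < M"
  by (simp add: N_def less_mult_imp_div_less)

lemma cell_less: "u < m * r \<Longrightarrow> u div r < m"
  by (simp add: less_mult_imp_div_less)

lemma kernel_bounds: "\<bar>K i j\<bar> \<le> 1" "\<bar>K_block a b\<bar> \<le> 1" "\<bar>H u v\<bar> \<le> 1" "\<bar>H_cell a b\<bar> \<le> 1"
  using m_pos r_pos
  by (simp_all add: K_def K_block_def H_def H_cell_def square_wave_abs_le_1 saw_abs_le_1 cdiff_less)

lemma kernel_antisym:
  "i < N \<Longrightarrow> j < N \<Longrightarrow> K j i = - K i j"
  "a < M \<Longrightarrow> b < M \<Longrightarrow> K_block b a = - K_block a b"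
  "u < m * r \<Longrightarrow> v < m * r \<Longrightarrow> H v u = - H u v"
  "a < m \<Longrightarrow> b < m \<Longrightarrow> H_cell b a = - H_cell a b"
  unfolding K_def K_block_def H_def H_cell_def N_eq M_def
  by (rule square_wave_antisym, assumption, assumption)+ (rule saw_antisym, assumption, assumption)+

lemma H_centred: "u < m * r \<Longrightarrow> (\<Sum>v<m * r. H u v) = 0"
  unfolding H_def by (subst sum_cdiff_right) (simp_all only: sum_saw)

lemma H_cell_centred: "a < m \<Longrightarrow> (\<Sum>b<m. H_cell a b) = 0"
  unfolding H_cell_def by (subst sum_cdiff_right) (simp_all only: sum_saw)

lemma g_centred_right:
  assumes "u < m * r"
  shows "(\<Sum>v<m * r. g i j u v) = 0"
proof -
  have "(\<Sum>v<m * r. H_cell (u div r) (v div r)) = 0"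
    using sum_div_block[OF r_pos, of "H_cell (u div r)" m] H_cell_centred[OF cell_less[OF assms]] by simp
  then show ?thesis
    unfolding g_def sum_subtractf sum_distrib_left[symmetric] H_centred[OF assms] by simp
qed

lemma g_symmetric:
  assumes "i < N" "j < N" "u < m * r" "v < m * r"
  shows "g j i v u = g i j u v"
  unfolding g_def kernel_antisym(1)[OF assms(1,2)] kernel_antisym(3)[OF assms(3,4)]
    kernel_antisym(2)[OF block_less[OF assms(1)] block_less[OF assms(2)]]
    kernel_antisym(4)[OF cell_less[OF assms(3)] cell_less[OF assms(4)]] by simp

lemma g_centred_left:
  assumes "i < N" "j < N" "v < m * r"
  shows "(\<Sum>u<m * r. g i j u v) = 0"
  using g_centred_right[OF assms(3), of j i] g_symmetric[OF assms(2,1,3)] by simp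

lemma g_bound: "\<bar>g i j u v\<bar> \<le> 2"
proof -
  have "\<bar>g i j u v\<bar> \<le> \<bar>K i j\<bar> * \<bar>H u v\<bar> + \<bar>K_block (i div q) (j div q)\<bar> * \<bar>H_cell (u div r) (v div r)\<bar>"
    unfolding g_def abs_mult[symmetric] by (rule abs_triangle_ineq4)
  also have "\<dots> \<le> 1 * 1 + 1 * 1" by (intro add_mono mult_mono kernel_bounds) auto
  finally show ?thesis by simp
qed

text \<open>The remaining block distances are those on which the square wave is constant.\<close>

definition bad :: "nat \<Rightarrow> nat \<Rightarrow> bool" where
  "bad a b \<longleftrightarrow> cdiff M a b \<in> {0, c, c + 1}"

text \<open>Three sources of error: bad block distances, where only \<bar>g\<bar> \<le> 2 is known;
  labels in a common cell, where the cell kernel vanishes; and the cell width, whose contribution 4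
  / m^2 is weakened to 4 / m.\<close>

lemma g_square_le:
  assumes "i < N" "j < N" "u < m * r" "v < m * r"
  shows "(g i j u v)\<^sup>2 \<le> 4 / real m + of_bool (u div r = v div r) + 4 * of_bool (bad (i div q) (j div q))"
proof (cases "bad (i div q) (j div q)")
  case True
  have "\<bar>g i j u v\<bar>\<^sup>2 \<le> 2\<^sup>2" by (intro power_mono g_bound) simp
  then show ?thesis using True by (simp add: add_increasing)
next
  case False
  then have K: "K i j = K_block (i div q) (j div q)"
    using square_wave_blocks[of i c e j] assms(1,2)
    unfolding bad_def K_def K_block_def n_def N_def M_def q_def by blast
  have "\<bar>g i j u v\<bar> = \<bar>K i j\<bar> * \<bar>H u v - H_cell (u div r) (v div r)\<bar>"
    unfolding g_def K[symmetric] by (simp add: abs_mult flip: right_diff_distrib)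
  also have "\<dots> \<le> 1 * \<bar>H u v - H_cell (u div r) (v div r)\<bar>" by (intro mult_right_mono kernel_bounds) simp
  finally have g: "\<bar>g i j u v\<bar> \<le> \<bar>H u v - H_cell (u div r) (v div r)\<bar>" by simp
  show ?thesis
  proof (cases "u div r = v div r")
    case True
    then have "H_cell (u div r) (v div r) = 0"
      using kernel_antisym(4)[of "u div r" "u div r"] cell_less[OF assms(3)] by simp
    then have "\<bar>g i j u v\<bar> \<le> 1" using g kernel_bounds(3)[of u v] by simp
    then have "\<bar>g i j u v\<bar>\<^sup>2 \<le> 1\<^sup>2" by (intro power_mono) auto
    then show ?thesis using True by (simp add: add_increasing add_increasing2)
  next
    case neq: False
    have "\<bar>g i j u v\<bar> \<le> 2 / real m"
      using g saw_cells[OF assms(3,4) neq] unfolding H_def H_cell_def by linarith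
    then have "\<bar>g i j u v\<bar>\<^sup>2 \<le> (2 / real m)\<^sup>2" by (intro power_mono) auto
    also have "\<dots> = 4 / real m * (1 / real m)" by (simp add: power2_eq_square)
    also have "\<dots> \<le> 4 / real m * 1" using m_pos by (intro mult_left_mono) auto
    finally show ?thesis using neq by (simp add: add_increasing2)
  qed
qed

text \<open>A common cell has probability 1 / m, which turns 4 / m into 5 / m. At most three of the
  \<open>M\<close> block distances are bad, with weight 4 each.\<close>

lemma g_variance:
  assumes "j < N" "v < m * r"
  shows "(\<Sum>i<N. \<Sum>u<m * r. 1 / real (m * r) * (g i j u v)\<^sup>2) \<le> real N * (5 / real m + 12 / real M)"
proof -
  have cells: "(\<Sum>u<m * r. of_bool (u div r = v div r)) = real r"
    using sum_div_block[OF r_pos, of "\<lambda>b. of_bool (b = v div r)" m] cell_less[OF assms(2)]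
    by (simp add: of_bool_def sum.delta)
  have "(\<Sum>a<M. of_bool (bad a (j div q))) = (\<Sum>d<M. of_bool (d \<in> {0, c, c + 1}) :: real)"
    unfolding bad_def using block_less[OF assms(1)] by (rule sum_cdiff_left)
  also have "\<dots> \<le> real (card {0, c, c + 1})"
    unfolding sum_of_bool_eq_card[OF finite_lessThan] of_nat_le_iff by (rule card_mono) auto
  also have "\<dots> \<le> 3" by (simp add: card_insert_if)
  finally have "real q * (\<Sum>a<M. of_bool (bad a (j div q))) \<le> real q * 3" by (rule mult_left_mono) simp
  then have blocks: "(\<Sum>i<N. of_bool (bad (i div q) (j div q))) \<le> real q * 3"
    unfolding N_def sum_div_block[OF q_pos, of "\<lambda>a. of_bool (bad a (j div q))" M] .
  have "(\<Sum>i<N. \<Sum>u<m * r. 1 / real (m * r) * (g i j u v)\<^sup>2)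
    \<le> (\<Sum>i<N. \<Sum>u<m * r. 1 / real (m * r) * (4 / real m + of_bool (u div r = v div r) + 4 * of_bool (bad (i div q) (j div q))))"
    using assms by (intro sum_mono mult_left_mono g_square_le) auto
  also have "\<dots> = (\<Sum>i<N. 5 / real m + 4 * of_bool (bad (i div q) (j div q)))"
  proof (intro sum.cong refl)
    fix i
    have "(\<Sum>u<m * r. 4 / real m + of_bool (u div r = v div r) + 4 * of_bool (bad (i div q) (j div q)))
      = real (m * r) * (4 / real m + 4 * of_bool (bad (i div q) (j div q))) + real r"
      unfolding sum.distrib cells by (simp add: algebra_simps)
    then show "(\<Sum>u<m * r. 1 / real (m * r) * (4 / real m + of_bool (u div r = v div r) + 4 * of_bool (bad (i div q) (j div q))))
      = 5 / real m + 4 * of_bool (bad (i div q) (j div q))"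
      unfolding sum_distrib_left[symmetric] using m_pos r_pos by (simp add: field_simps)
  qed
  also have "\<dots> = real N * (5 / real m) + 4 * (\<Sum>i<N. of_bool (bad (i div q) (j div q)))"
    by (simp add: sum.distrib sum_distrib_left)
  also have "\<dots> \<le> real N * (5 / real m) + 4 * (real q * 3)" using blocks by simp
  also have "\<dots> = real N * (5 / real m + 12 / real M)" using M_pos by (simp add: N_def field_simps)
  finally show ?thesis .
qed

definition "form f = 1 / real N * (\<Sum>i<N. \<Sum>j<N. K_block (i div q) (j div q) * H_cell (f i div r) (f j div r))"
definition "remainder f = 2 / real N * (\<Sum>j<N. \<Sum>i<j. g i j (f i) (f j))"

lemma writhe_decomposition:
  assumes f: "f \<in> PiE {..<N} (\<lambda>_. {..<m * r})"
  shows "2 * writhe n (\<lambda>i. real (f i)) / real N = form f + remainder f"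
proof -
  have fi: "f i < m * r" if "i < N" for i using PiE_mem[OF f, of i] that by simp
  have "2 * writhe n (\<lambda>i. real (f i)) = (\<Sum>i<N. \<Sum>j<N. K i j * H (f i) (f j))"
    unfolding K_def H_def N_eq by (rule writhe_eq_saw_sum) (simp add: fi N_eq)
  also have "\<dots> = (\<Sum>i<N. \<Sum>j<N. K_block (i div q) (j div q) * H_cell (f i div r) (f j div r)) + (\<Sum>i<N. \<Sum>j<N. g i j (f i) (f j))"
    by (simp add: g_def sum.distrib[symmetric])
  also have "(\<Sum>i<N. \<Sum>j<N. g i j (f i) (f j)) = 2 * (\<Sum>j<N. \<Sum>i<j. g i j (f i) (f j))"
  proof (rule sum_symmetric_eq_triangle)
    fix i assume i: "i < N"
    have "K i i = 0" "K_block (i div q) (i div q) = 0"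
      using kernel_antisym(1)[OF i i] kernel_antisym(2)[OF block_less[OF i] block_less[OF i]] by simp_all
    then show "g i i (f i) (f i) = 0" by (simp add: g_def)
  qed (simp add: g_symmetric fi)
  finally show ?thesis by (simp add: form_def remainder_def add_divide_distrib)
qed

lemma remainder_tail:
  assumes "0 < z" "\<beta> = 8 * z\<^sup>2 * exp (8 * z)"
    and "5 / real m + 12 / real M \<le> exp (- 32 * \<beta>) / (4 * \<beta>)"
  shows "expect N (\<lambda>f. of_bool (s \<le> remainder f)) \<le> 3 * exp (- (z * s))"
  unfolding remainder_def
  by (rule degenerate_form_tail[OF assms(1) N_pos g_bound g_centred_right g_centred_left g_variance assms(2,3)]) assumption+

end

section \<open>The quadratic form in fixed dimension\<close>

context block_weights
begin

text \<open>The numbers of positions of a given block with labels in a given cell, centred and rescaled to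
  have variance at most one in every direction.\<close>

definition "rescale = sqrt (real m / real q)"
definition "occupation f a b = (\<Sum>i<N. of_bool (i div q = a \<and> f i div r = b) :: real)"
definition "deviation f a b = occupation f a b - real q / real m"
definition "project v f = (\<Sum>a<M. \<Sum>b<m. v (a, b) * (rescale * deviation f a b))"

lemma sum_occupation:
  assumes f: "f \<in> PiE {..<N} (\<lambda>_. {..<m * r})"
  shows "(\<Sum>i<N. F (i div q) (f i div r)) = (\<Sum>a<M. \<Sum>b<m. occupation f a b * F a b)"
proof -
  have "(\<Sum>a<M. \<Sum>b<m. of_bool (i div q = a \<and> f i div r = b) * F a b) = F (i div q) (f i div r)"
    if "i < N" for i
  proof -
    have fi: "f i div r < m" using PiE_mem[OF f, of i] that by (intro cell_less) simp
    have "(\<Sum>a<M. \<Sum>b<m. of_bool (i div q = a \<and> f i div r = b) * F a b)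
        = (\<Sum>a<M. if a = i div q then (\<Sum>b<m. if b = f i div r then F a b else 0) else 0)"
      by (intro sum.cong refl) (auto intro!: sum.cong)
    then show ?thesis using fi block_less[OF that] by (simp add: sum.delta)
  qed
  then have "(\<Sum>i<N. F (i div q) (f i div r)) = (\<Sum>i<N. \<Sum>a<M. \<Sum>b<m. of_bool (i div q = a \<and> f i div r = b) * F a b)"
    by (intro sum.cong) auto
  also have "\<dots> = (\<Sum>a<M. \<Sum>i<N. \<Sum>b<m. of_bool (i div q = a \<and> f i div r = b) * F a b)" by (rule sum.swap)
  also have "\<dots> = (\<Sum>a<M. \<Sum>b<m. \<Sum>i<N. of_bool (i div q = a \<and> f i div r = b) * F a b)"
    by (rule sum.cong[OF refl]) (rule sum.swap)
  finally show ?thesis by (simp add: occupation_def sum_distrib_right)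
qed

text \<open>The cell kernel is centred in either index, so the mean occupation q / m drops out of
  both arguments. Then the spectral bounds 2 * M / pi and m / pi apply; after division by
  \<open>N = M * q\<close> the factor m / q goes into \<open>rescale\<close> and 2 / pi^2 is
  left.\<close>

lemma form_le:
  assumes f: "f \<in> PiE {..<N} (\<lambda>_. {..<m * r})"
  shows "form f \<le> 2 / pi\<^sup>2 * (\<Sum>a<M. \<Sum>b<m. (rescale * deviation f a b)\<^sup>2)"
proof -
  have cell: "(\<Sum>b'<m. H_cell b b' * occupation f a' b') = (\<Sum>b'<m. H_cell b b' * deviation f a' b')" if "b < m" for b a'
  proof -
    have "(\<Sum>b'<m. H_cell b b' * deviation f a' b')
      = (\<Sum>b'<m. H_cell b b' * occupation f a' b') - real q / real m * (\<Sum>b'<m. H_cell b b')"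
      by (simp add: deviation_def right_diff_distrib sum_subtractf sum_distrib_left sum_divide_distrib mult.commute)
    then show ?thesis by (simp add: H_cell_centred[OF that])
  qed
  define G where "G a b = (\<Sum>a'<M. \<Sum>b'<m. K_block a a' * H_cell b b' * deviation f a' b')" for a b
  have G_centred: "(\<Sum>b<m. G a b) = 0" for a
  proof -
    have H0: "(\<Sum>b<m. H_cell b b') = 0" if "b' < m" for b'
    proof -
      have "(\<Sum>b<m. H_cell b b') = (\<Sum>b<m. - H_cell b' b)"
        using that by (intro sum.cong refl kernel_antisym(4)) auto
      then show ?thesis using H_cell_centred[OF that] by (simp add: sum_negf)
    qed
    have "(\<Sum>b<m. G a b) = (\<Sum>a'<M. \<Sum>b<m. \<Sum>b'<m. K_block a a' * H_cell b b' * deviation f a' b')"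
      unfolding G_def by (rule sum.swap)
    also have "\<dots> = (\<Sum>a'<M. \<Sum>b'<m. \<Sum>b<m. K_block a a' * H_cell b b' * deviation f a' b')"
      by (rule sum.cong[OF refl]) (rule sum.swap)
    also have "\<dots> = (\<Sum>a'<M. \<Sum>b'<m. K_block a a' * deviation f a' b' * (\<Sum>b<m. H_cell b b'))"
      unfolding sum_distrib_left by (intro sum.cong refl) simp
    also have "\<dots> = 0" by (simp add: H0)
    finally show ?thesis .
  qed
  have inner: "(\<Sum>j<N. K_block a (j div q) * H_cell b (f j div r)) = G a b" if "b < m" for a b
  proof -
    have "(\<Sum>j<N. K_block a (j div q) * H_cell b (f j div r)) = (\<Sum>a'<M. K_block a a' * (\<Sum>b'<m. H_cell b b' * occupation f a' b'))"
      using sum_occupation[OF f, of "\<lambda>a' b'. K_block a a' * H_cell b b'"] by (simp add: sum_distrib_left mult_ac)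
    then show ?thesis unfolding cell[OF that] G_def by (simp add: sum_distrib_left mult_ac)
  qed
  have "(\<Sum>i<N. \<Sum>j<N. K_block (i div q) (j div q) * H_cell (f i div r) (f j div r)) = (\<Sum>i<N. G (i div q) (f i div r))"
  proof (intro sum.cong refl inner)
    fix i assume "i \<in> {..<N}"
    then show "f i div r < m" using PiE_mem[OF f, of i] by (intro cell_less) simp
  qed
  also have "\<dots> = (\<Sum>a<M. \<Sum>b<m. occupation f a b * G a b)" by (rule sum_occupation[OF f])
  also have "\<dots> = (\<Sum>a<M. \<Sum>b<m. deviation f a b * G a b)"
  proof (rule sum.cong[OF refl])
    fix a
    have "(\<Sum>b<m. deviation f a b * G a b) = (\<Sum>b<m. occupation f a b * G a b) - real q / real m * (\<Sum>b<m. G a b)"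
      by (simp add: deviation_def left_diff_distrib sum_subtractf sum_distrib_left sum_divide_distrib)
    then show "(\<Sum>b<m. occupation f a b * G a b) = (\<Sum>b<m. deviation f a b * G a b)" by (simp add: G_centred)
  qed
  also have "\<dots> = (\<Sum>a<M. \<Sum>b<m. \<Sum>a'<M. \<Sum>b'<m. K_block a a' * H_cell b b' * deviation f a b * deviation f a' b')"
    by (simp add: G_def sum_distrib_left mult_ac)
  also have "\<dots> \<le> (2 * real M / pi) * (real m / pi) * (\<Sum>a<M. \<Sum>b<m. (deviation f a b)\<^sup>2)"
  proof (rule tensor_norm_le)
    show "(\<Sum>a<M. (\<Sum>a'<M. K_block a a' * y a')\<^sup>2) \<le> (2 * real M / pi)\<^sup>2 * (\<Sum>a<M. (y a)\<^sup>2)" for y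
      unfolding K_block_def by (rule circulant_norm_le) (simp only: M_def square_wave_symbol_norm_le)
    show "(\<Sum>b<m. (\<Sum>b'<m. H_cell b b' * y b')\<^sup>2) \<le> (real m / pi)\<^sup>2 * (\<Sum>b<m. (y b)\<^sup>2)" for y
      unfolding H_cell_def by (rule circulant_norm_le) (rule saw_symbol_norm_le)
  qed simp_all
  finally have "form f \<le> 1 / real N * ((2 * real M / pi) * (real m / pi) * (\<Sum>a<M. \<Sum>b<m. (deviation f a b)\<^sup>2))"
    unfolding form_def by (rule mult_left_mono) simp
  also have "\<dots> = 2 / pi\<^sup>2 * (real m / real q * (\<Sum>a<M. \<Sum>b<m. (deviation f a b)\<^sup>2))"
    using M_pos q_pos by (simp add: N_def power2_eq_square field_simps)
  also have "real m / real q * (\<Sum>a<M. \<Sum>b<m. (deviation f a b)\<^sup>2) = (\<Sum>a<M. \<Sum>b<m. (rescale * deviation f a b)\<^sup>2)"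
    by (simp add: rescale_def power_mult_distrib sum_distrib_left)
  finally show ?thesis .
qed

text \<open>The projection is a sum of independent terms, one for each position, centred by the cell
  average of \<open>v\<close>. Centring only lowers the variance. Over the \<open>q\<close>
  positions of a block the scale m / q cancels against the cell probability 1 / m, so the total
  variance is at most the squared length of \<open>v\<close>.\<close>

lemma project_mgf_le:
  assumes v: "(\<Sum>a<M. \<Sum>b<m. (v (a, b))\<^sup>2) \<le> 1"
  shows "expect N (\<lambda>f. exp (\<mu> * project v f)) \<le> exp (exp (\<bar>\<mu>\<bar> * (2 * rescale)) / 2 * \<mu>\<^sup>2)"
proof -
  define avg where "avg a = 1 / real m * (\<Sum>b<m. v (a, b))" for a
  define Y where "Y i u = rescale * (v (i div q, u div r) - avg (i div q))" for i u
  have L: "(\<Sum>u<m * r. 1 / real (m * r) * F (u div r)) = 1 / real m * (\<Sum>b<m. F b)" for F :: "nat \<Rightarrow> real"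
    unfolding sum_distrib_left[symmetric] sum_div_block[OF r_pos] using m_pos r_pos by simp
  have project: "project v f = (\<Sum>i<N. Y i (f i))" if f: "f \<in> PiE {..<N} (\<lambda>_. {..<m * r})" for f
  proof -
    have "(\<Sum>a<M. \<Sum>b<m. v (a, b) * deviation f a b)
      = (\<Sum>a<M. \<Sum>b<m. occupation f a b * v (a, b)) - (\<Sum>a<M. \<Sum>b<m. v (a, b) * (real q / real m))"
      by (simp add: deviation_def right_diff_distrib sum_subtractf mult.commute)
    also have "(\<Sum>a<M. \<Sum>b<m. occupation f a b * v (a, b)) = (\<Sum>i<N. v (i div q, f i div r))"
      by (rule sum_occupation[OF f, symmetric])
    also have "(\<Sum>a<M. \<Sum>b<m. v (a, b) * (real q / real m)) = real q * (\<Sum>a<M. avg a)"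
      by (simp add: avg_def sum_distrib_left sum_distrib_right sum_divide_distrib mult_ac)
    also have "\<dots> = (\<Sum>i<N. avg (i div q))" unfolding N_def by (rule sum_div_block[OF q_pos, symmetric])
    finally have "(\<Sum>a<M. \<Sum>b<m. v (a, b) * deviation f a b) = (\<Sum>i<N. v (i div q, f i div r) - avg (i div q))"
      by (simp add: sum_subtractf)
    then have "rescale * (\<Sum>a<M. \<Sum>b<m. v (a, b) * deviation f a b) = (\<Sum>i<N. Y i (f i))"
      by (simp add: Y_def sum_distrib_left)
    then show ?thesis by (simp add: project_def sum_distrib_left mult.left_commute)
  qed
  have v1: "\<bar>v (a, b)\<bar> \<le> 1" if "a < M" "b < m" for a b
  proof -
    have "(v (a, b))\<^sup>2 \<le> (\<Sum>b<m. (v (a, b))\<^sup>2)" using that by (intro member_le_sum) auto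
    also have "\<dots> \<le> (\<Sum>a<M. \<Sum>b<m. (v (a, b))\<^sup>2)" using that
      by (intro member_le_sum[of a _ "\<lambda>a. \<Sum>b<m. (v (a, b))\<^sup>2"]) (auto intro: sum_nonneg)
    also note v
    finally show ?thesis by (simp add: abs_square_le_1)
  qed
  have "expect N (\<lambda>f. exp (\<mu> * project v f)) = expect N (\<lambda>f. exp (\<mu> * (\<Sum>i<N. Y i (f i))))"
    by (rule expect_cong) (simp only: project)
  also have "\<dots> \<le> exp (exp (\<bar>\<mu>\<bar> * (2 * rescale)) / 2 * (\<mu>\<^sup>2 * 1))"
  proof (rule expect_exp_sum_le)
    fix i u assume i: "i < N" and u: "u < m * r"
    have "\<bar>\<Sum>b<m. v (i div q, b)\<bar> \<le> (\<Sum>b<m. 1)"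
      using block_less[OF i] by (intro order_trans[OF sum_abs] sum_mono v1) auto
    then have "\<bar>avg (i div q)\<bar> \<le> 1" using m_pos by (simp add: avg_def abs_mult)
    moreover have "\<bar>v (i div q, u div r)\<bar> \<le> 1" by (intro v1 block_less i cell_less u)
    ultimately have "\<bar>v (i div q, u div r) - avg (i div q)\<bar> \<le> 2" by linarith
    then have "rescale * \<bar>v (i div q, u div r) - avg (i div q)\<bar> \<le> rescale * 2"
      by (rule mult_left_mono) (simp add: rescale_def)
    then show "\<bar>Y i u\<bar> \<le> 2 * rescale" by (simp add: Y_def abs_mult rescale_def)
  next
    fix i
    have "(\<Sum>u<m * r. 1 / real (m * r) * Y i u) = 1 / real m * (\<Sum>b<m. rescale * (v (i div q, b) - avg (i div q)))"
      unfolding Y_def by (rule L)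
    also have "\<dots> = 0"
      unfolding sum_distrib_left[symmetric] using m_pos by (simp add: sum_subtractf avg_def)
    finally show "(\<Sum>u<m * r. 1 / real (m * r) * Y i u) = 0" .
  next
    have "(\<Sum>i<N. \<Sum>u<m * r. 1 / real (m * r) * (Y i u)\<^sup>2)
       \<le> (\<Sum>i<N. real m / real q * (1 / real m * (\<Sum>b<m. (v (i div q, b))\<^sup>2)))"
    proof (rule sum_mono)
      fix i
      have "(\<Sum>b<m. (v (i div q, b) - avg (i div q))\<^sup>2)
         = (\<Sum>b<m. (v (i div q, b))\<^sup>2) - 2 * avg (i div q) * (\<Sum>b<m. v (i div q, b)) + real m * (avg (i div q))\<^sup>2"
        by (simp add: power2_diff sum.distrib sum_subtractf sum_distrib_left mult_ac)
      also have "(\<Sum>b<m. v (i div q, b)) = real m * avg (i div q)" using m_pos by (simp add: avg_def)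
      finally have var: "(\<Sum>b<m. (v (i div q, b) - avg (i div q))\<^sup>2) \<le> (\<Sum>b<m. (v (i div q, b))\<^sup>2)"
        by (simp add: power2_eq_square)
      have "(\<Sum>u<m * r. 1 / real (m * r) * (Y i u)\<^sup>2) = 1 / real m * (\<Sum>b<m. (rescale * (v (i div q, b) - avg (i div q)))\<^sup>2)"
        unfolding Y_def by (rule L)
      also have "\<dots> = real m / real q * (1 / real m * (\<Sum>b<m. (v (i div q, b) - avg (i div q))\<^sup>2))"
        by (simp add: power_mult_distrib rescale_def sum_distrib_left)
      also have "\<dots> \<le> real m / real q * (1 / real m * (\<Sum>b<m. (v (i div q, b))\<^sup>2))"
        using var by (intro mult_left_mono) auto
      finally show "(\<Sum>u<m * r. 1 / real (m * r) * (Y i u)\<^sup>2)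
        \<le> real m / real q * (1 / real m * (\<Sum>b<m. (v (i div q, b))\<^sup>2))" .
    qed
    also have "\<dots> = real q * (\<Sum>a<M. real m / real q * (1 / real m * (\<Sum>b<m. (v (a, b))\<^sup>2)))"
      unfolding N_def by (rule sum_div_block[OF q_pos])
    also have "\<dots> = (\<Sum>a<M. \<Sum>b<m. (v (a, b))\<^sup>2)"
      using m_pos q_pos by (simp add: sum_distrib_left)
    finally show "(\<Sum>i<N. \<Sum>u<m * r. 1 / real (m * r) * (Y i u)\<^sup>2) \<le> 1" using v by simp
  qed
  finally show ?thesis by simp
qed

text \<open>The Chernoff parameter is \<open>s\<close> itself, the optimal one for a standard
  Gaussian. For long blocks \<open>rescale\<close> is small and the exponent is close to - s^2 /
  2.\<close>

lemma project_tail: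
  assumes "(\<Sum>a<M. \<Sum>b<m. (v (a, b))\<^sup>2) \<le> 1" "0 \<le> s"
  shows "expect N (\<lambda>f. of_bool (s \<le> project v f)) \<le> exp (s\<^sup>2 / 2 * exp (2 * s * rescale) - s\<^sup>2)"
proof -
  have "expect N (\<lambda>f. of_bool (s \<le> project v f)) \<le> expect N (\<lambda>f. of_bool (s\<^sup>2 \<le> s * project v f))"
    using assms(2) by (intro expect_mono) (auto simp: power2_eq_square intro!: mult_left_mono)
  also have "\<dots> \<le> exp (- s\<^sup>2) * expect N (\<lambda>f. exp (s * project v f))" by (rule expect_chernoff)
  also have "\<dots> \<le> exp (- s\<^sup>2) * exp (exp (\<bar>s\<bar> * (2 * rescale)) / 2 * s\<^sup>2)"
    by (intro mult_left_mono project_mgf_le assms(1)) simp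
  also have "\<dots> = exp (s\<^sup>2 / 2 * exp (2 * s * rescale) - s\<^sup>2)"
    unfolding exp_add[symmetric] using assms(2) by (simp add: mult_ac)
  finally show ?thesis .
qed

text \<open>If the form reaches \<open>t\<close>, the deviation vector has squared length at least
  pi^2 / 2 * t, and some direction of the net sees at least the fraction 1 - \<epsilon> of its
  length. The cost is a union bound over \<open>V\<close>.\<close>

lemma form_tail:
  assumes V: "finite V" "\<And>v. v \<in> V \<Longrightarrow> (\<Sum>i\<in>{..<M} \<times> {..<m}. (v i)\<^sup>2) \<le> 1"
    "\<And>x. \<exists>v\<in>V. (1 - \<epsilon>) * sqrt (\<Sum>i\<in>{..<M} \<times> {..<m}. (x i)\<^sup>2) \<le> (\<Sum>i\<in>{..<M} \<times> {..<m}. v i * x i)"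
    and "\<epsilon> \<le> 1" "0 \<le> t"
    and s: "s = (1 - \<epsilon>) * sqrt (pi\<^sup>2 / 2 * t)"
  shows "expect N (\<lambda>f. of_bool (t \<le> form f)) \<le> real (card V) * exp (s\<^sup>2 / 2 * exp (2 * s * rescale) - s\<^sup>2)"
proof -
  have s0: "0 \<le> s" using assms(4,5) by (simp add: s)
  have "expect N (\<lambda>f. of_bool (t \<le> form f)) \<le> expect N (\<lambda>f. \<Sum>v\<in>V. of_bool (s \<le> project v f))"
  proof (rule expect_mono)
    fix f assume f: "f \<in> PiE {..<N} (\<lambda>_. {..<m * r})"
    define x where "x = (\<lambda>(a, b). rescale * deviation f a b)"
    have "\<exists>v\<in>V. s \<le> project v f" if "t \<le> form f"
    proof -
      obtain v where v: "v \<in> V" "(1 - \<epsilon>) * sqrt (\<Sum>i\<in>{..<M} \<times> {..<m}. (x i)\<^sup>2) \<le> (\<Sum>i\<in>{..<M} \<times> {..<m}. v i * x i)"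
        using V(3) by blast
      have "t \<le> 2 / pi\<^sup>2 * (\<Sum>a<M. \<Sum>b<m. (rescale * deviation f a b)\<^sup>2)" using that form_le[OF f] by linarith
      then have "pi\<^sup>2 / 2 * t \<le> (\<Sum>a<M. \<Sum>b<m. (rescale * deviation f a b)\<^sup>2)" by (simp add: field_simps)
      also have "\<dots> = (\<Sum>i\<in>{..<M} \<times> {..<m}. (x i)\<^sup>2)"
        unfolding sum.cartesian_product x_def by (rule sum.cong) auto
      finally have "s \<le> (1 - \<epsilon>) * sqrt (\<Sum>i\<in>{..<M} \<times> {..<m}. (x i)\<^sup>2)"
        unfolding s using assms(4) by (intro mult_left_mono real_sqrt_le_mono) auto
      also note v(2)
      also have "(\<Sum>i\<in>{..<M} \<times> {..<m}. v i * x i) = project v f"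
        unfolding project_def sum.cartesian_product x_def by (rule sum.cong) auto
      finally show ?thesis using v(1) by blast
    qed
    moreover have "of_bool (s \<le> project v f) \<le> (\<Sum>v\<in>V. of_bool (s \<le> project v f) :: real)" if "v \<in> V" for v
      using that V(1) by (intro member_le_sum) auto
    ultimately show "of_bool (t \<le> form f) \<le> (\<Sum>v\<in>V. of_bool (s \<le> project v f) :: real)"
      by (cases "t \<le> form f") (fastforce, simp add: sum_nonneg)
  qed
  also have "\<dots> \<le> (\<Sum>v\<in>V. exp (s\<^sup>2 / 2 * exp (2 * s * rescale) - s\<^sup>2))"
    unfolding expect_sum
  proof (intro sum_mono project_tail s0)
    fix v assume "v \<in> V"
    then show "(\<Sum>a<M. \<Sum>b<m. (v (a, b))\<^sup>2) \<le> 1" using V(2)[of v] by (simp add: sum.cartesian_product case_prod_unfold)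
  qed
  finally show ?thesis by simp
qed

text \<open>The threshold is split into (1 - \<eta>) * t for the form and \<eta> * t for the
  remainder. The outer factor 1 - \<eta> in \<open>s\<close> is the loss of the net.\<close>

lemma writhe_tail:
  assumes V: "finite V" "\<And>v. v \<in> V \<Longrightarrow> (\<Sum>i\<in>{..<M} \<times> {..<m}. (v i)\<^sup>2) \<le> 1"
    "\<And>x. \<exists>v\<in>V. (1 - \<eta>) * sqrt (\<Sum>i\<in>{..<M} \<times> {..<m}. (x i)\<^sup>2) \<le> (\<Sum>i\<in>{..<M} \<times> {..<m}. v i * x i)"
    and "\<eta> \<le> 1" "0 \<le> t"
    and s: "s = (1 - \<eta>) * sqrt (pi\<^sup>2 / 2 * ((1 - \<eta>) * t))"
    and "0 < z" "\<beta> = 8 * z\<^sup>2 * exp (8 * z)"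
    and "5 / real m + 12 / real M \<le> exp (- 32 * \<beta>) / (4 * \<beta>)"
  shows "expect N (\<lambda>f. of_bool (t \<le> 2 * writhe n (\<lambda>i. real (f i)) / real N))
     \<le> real (card V) * exp (s\<^sup>2 / 2 * exp (2 * s * rescale) - s\<^sup>2) + 3 * exp (- (z * (\<eta> * t)))"
proof -
  have "expect N (\<lambda>f. of_bool (t \<le> 2 * writhe n (\<lambda>i. real (f i)) / real N))
    \<le> expect N (\<lambda>f. of_bool ((1 - \<eta>) * t \<le> form f) + of_bool (\<eta> * t \<le> remainder f))"
  proof (rule expect_mono)
    fix f assume "f \<in> PiE {..<N} (\<lambda>_. {..<m * r})"
    then have "2 * writhe n (\<lambda>i. real (f i)) / real N = form f + remainder f" by (rule writhe_decomposition)
    moreover have "(1 - \<eta>) * t + \<eta> * t = t" by (simp add: algebra_simps)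
    ultimately have "(1 - \<eta>) * t \<le> form f \<or> \<eta> * t \<le> remainder f" if "t \<le> 2 * writhe n (\<lambda>i. real (f i)) / real N"
      using that by linarith
    then show "of_bool (t \<le> 2 * writhe n (\<lambda>i. real (f i)) / real N)
      \<le> (of_bool ((1 - \<eta>) * t \<le> form f) + of_bool (\<eta> * t \<le> remainder f) :: real)" by auto
  qed
  also have "\<dots> \<le> real (card V) * exp (s\<^sup>2 / 2 * exp (2 * s * rescale) - s\<^sup>2) + 3 * exp (- (z * (\<eta> * t)))"
    unfolding expect_add
    by (intro add_mono remainder_tail[OF assms(7-9)] form_tail[OF V assms(4) _ s]) (use assms(4,5) in auto)
  finally show ?thesis .
qed

end

text \<open>Only the \<open>n\<close> for which \<open>2 * n + 1\<close> is divisible by a fixed number of blocks are treated; this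
  is enough, because the convergence in law is given.\<close>

lemma upper_tail_frequently:
  assumes "0 < \<delta>"
  shows "\<exists>C>0. \<forall>t\<ge>0. \<exists>\<^sub>F n in sequentially. perm_prob n (\<lambda>w. t < w / real n) \<le> C * exp (- ((pi\<^sup>2 / 4 - \<delta>) * t))"
proof -
  define \<eta> where "\<eta> = min (1 / 2) (\<delta> / pi\<^sup>2)"
  have \<eta>: "0 < \<eta>" "\<eta> \<le> 1 / 2" "pi\<^sup>2 * \<eta> \<le> \<delta>"
  proof -
    have "pi\<^sup>2 * \<eta> \<le> pi\<^sup>2 * (\<delta> / pi\<^sup>2)" by (intro mult_left_mono) (auto simp: \<eta>_def)
    then show "pi\<^sup>2 * \<eta> \<le> \<delta>" by simp
    show "\<eta> \<le> 1 / 2" unfolding \<eta>_def by (rule min.cobounded1)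
  qed (use assms in \<open>simp add: \<eta>_def\<close>)
  \<comment> \<open>Of the four factors 1 - \<eta>, two are the squared loss of the net, one is the
    share of the form, and one pays for replacing w / n by 2 * w / N.\<close>
  have bernoulli: "1 - 4 * \<eta> \<le> (1 - \<eta>) ^ 4" using Bernoulli_inequality[of "- \<eta>" 4] \<eta> by simp
  have rate4: "pi\<^sup>2 / 4 - \<delta> \<le> pi\<^sup>2 / 4 * (1 - \<eta>) ^ 4"
    using mult_left_mono[OF bernoulli, of "pi\<^sup>2 / 4"] \<eta> by (simp add: algebra_simps)
  have rate1: "pi\<^sup>2 / 4 - \<delta> \<le> pi\<^sup>2 / 4 * (1 - \<eta>)"
    using \<eta> assms by (simp add: algebra_simps)
  \<comment> \<open>With this rate the remainder, given only the share \<eta> of the threshold,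
    still decays as fast as required of the form.\<close>
  define z where "z = pi\<^sup>2 / (4 * \<eta>)"
  define \<beta> where "\<beta> = 8 * z\<^sup>2 * exp (8 * z)"
  have z: "0 < z" using \<eta> by (simp add: z_def)
  then have "0 < \<beta>" by (simp add: \<beta>_def)
  define T where "T = exp (- 32 * \<beta>) / (4 * \<beta>)"
  have T: "0 < T" using \<open>0 < \<beta>\<close> by (simp add: T_def)
  \<comment> \<open>There will be \<open>k\<close> cells and 2 * k + 1 blocks, with error at most 5
    / k + 12 / k = 17 / k.\<close>
  obtain k :: nat where k: "17 / T < real k" using reals_Archimedean2 by blast
  then have k_pos: "0 < real k" using T by (meson divide_nonneg_pos le_less_trans less_imp_le zero_le_numeral)
  have small: "5 / real k + 12 / real (2 * k + 1) \<le> T"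
  proof -
    have "12 / real (2 * k + 1) \<le> 12 / real k" using k_pos by (intro divide_left_mono) auto
    then have "5 / real k + 12 / real (2 * k + 1) \<le> 5 / real k + 12 / real k" by simp
    also have "\<dots> = 17 / real k" by (simp add: add_divide_distrib[symmetric])
    also have "\<dots> \<le> T" using k k_pos T by (simp add: field_simps)
    finally show ?thesis .
  qed
  obtain V :: "(nat \<times> nat \<Rightarrow> real) set" where V: "finite V"
    "\<And>v. v \<in> V \<Longrightarrow> (\<Sum>i\<in>{..<2 * k + 1} \<times> {..<k}. (v i)\<^sup>2) \<le> 1"
    "\<And>x. \<exists>v\<in>V. (1 - \<eta>) * sqrt (\<Sum>i\<in>{..<2 * k + 1} \<times> {..<k}. (x i)\<^sup>2) \<le> (\<Sum>i\<in>{..<2 * k + 1} \<times> {..<k}. v i * x i)"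
    by (rule finite_direction_net[of "{..<2 * k + 1} \<times> {..<k}" \<eta>]) (use \<eta> in auto)
  \<comment> \<open>One constant for all \<open>t\<close>: 3 for the remainder, 1 for collisions of
    labels, the rest for the form.\<close>
  define C where "C = 4 + real (card V) * exp 1"
  have "\<exists>\<^sub>F n in sequentially. perm_prob n (\<lambda>w. t < w / real n) \<le> C * exp (- ((pi\<^sup>2 / 4 - \<delta>) * t))"
    if t: "0 \<le> t" for t
  proof -
    define t' where "t' = (1 - \<eta>) * t"
    have t': "0 \<le> t'" using \<eta> t by (simp add: t'_def)
    define s where "s = (1 - \<eta>) * sqrt (pi\<^sup>2 / 2 * ((1 - \<eta>) * t'))"
    define E where "E = exp (- ((pi\<^sup>2 / 4 - \<delta>) * t))"
    have "s\<^sup>2 = (1 - \<eta>)\<^sup>2 * (pi\<^sup>2 / 2 * ((1 - \<eta>) * t'))"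
      unfolding s_def power_mult_distrib using \<eta> t' by simp
    also have "\<dots> = 2 * (pi\<^sup>2 / 4 * (1 - \<eta>) ^ 4 * t)" by (simp add: t'_def power2_eq_square power4_eq_xxxx)
    finally have s2: "- s\<^sup>2 / 2 \<le> - ((pi\<^sup>2 / 4 - \<delta>) * t)"
      using mult_right_mono[OF rate4 t] by linarith
    \<comment> \<open>Now \<open>t\<close> is fixed. As the blocks grow, the exponent in the tail of
      the form tends to - s^2 / 2; an excess of 1 is allowed, which is the factor exp 1 in
      \<open>C\<close>.\<close>
    have "(\<lambda>e. s\<^sup>2 / 2 * exp (2 * s * sqrt (real k / real (2 * e + 1))) - s\<^sup>2 / 2)
        \<longlonglongrightarrow> s\<^sup>2 / 2 * exp (2 * s * sqrt 0) - s\<^sup>2 / 2"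
    proof (intro tendsto_intros)
      show "(\<lambda>e. real k / real (2 * e + 1)) \<longlonglongrightarrow> 0" by real_asymp
    qed
    then have ev1: "\<forall>\<^sub>F e in sequentially. s\<^sup>2 / 2 * exp (2 * s * sqrt (real k / real (2 * e + 1))) - s\<^sup>2 / 2 < 1"
      by (rule order_tendstoD(2)) simp
    have ev2: "\<forall>\<^sub>F e in sequentially. 1 / real (2 * e + 1) < \<eta>"
    proof (rule order_tendstoD(2)[OF _ \<eta>(1)])
      show "(\<lambda>e. 1 / real (2 * e + 1)) \<longlonglongrightarrow> 0" by real_asymp
    qed
    have "\<exists>n\<ge>n0. perm_prob n (\<lambda>w. t < w / real n) \<le> C * E" for n0
    proof -
      have "\<forall>\<^sub>F e in sequentially. n0 \<le> e \<and> 1 / real (2 * e + 1) < \<eta>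
          \<and> s\<^sup>2 / 2 * exp (2 * s * sqrt (real k / real (2 * e + 1))) - s\<^sup>2 / 2 < 1"
        by (intro eventually_conj eventually_ge_at_top ev1 ev2)
      then obtain e where e: "n0 \<le> e" "1 / real (2 * e + 1) < \<eta>"
        "s\<^sup>2 / 2 * exp (2 * s * sqrt (real k / real (2 * e + 1))) - s\<^sup>2 / 2 < 1"
        using eventually_happens'[OF sequentially_bot] by blast
      define n where "n = 2 * k * e + k + e"
      define N where "N = 2 * n + 1"
      \<comment> \<open>With this many labels a collision has probability at most \<open>E\<close>,
        the size of the bound to be proved.\<close>
      obtain r :: nat where r: "(real N)\<^sup>2 / E < real r" using reals_Archimedean2 by blast
      have E: "0 < E" by (simp add: E_def)
      then have r_pos: "0 < r" using r by (metis divide_nonneg_pos le_less_trans of_nat_0_less_iff zero_le_power2)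
      interpret B: block_weights k e k r
        by unfold_locales (use r_pos k_pos in auto)
      have n_eq: "B.n = n" by (simp add: B.n_def n_def)
      have N_eq: "B.N = N" by (simp only: B.N_eq n_eq N_def)
      have M_eq: "B.M = 2 * k + 1" by (simp add: B.M_def)
      have "1 / real N \<le> 1 / real (2 * e + 1)" by (rule divide_left_mono) (simp_all add: N_def n_def add_pos_nonneg)
      then have N_large: "1 / real N \<le> \<eta>" using e(2) by simp
      have "perm_prob n (\<lambda>w. t < w / real n)
        \<le> B.expect N (\<lambda>f. of_bool (t < writhe n (\<lambda>i. real (f i)) / real n)) + (real N)\<^sup>2 / real (k * r)"
        using B.perm_prob_approx[of n "\<lambda>w. t < w / real n"] unfolding N_def by linarith
      also have "B.expect N (\<lambda>f. of_bool (t < writhe n (\<lambda>i. real (f i)) / real n))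
        \<le> B.expect N (\<lambda>f. of_bool (t' \<le> 2 * writhe n (\<lambda>i. real (f i)) / real N))"
      proof (rule B.expect_mono)
        fix f :: "nat \<Rightarrow> nat"
        let ?w = "writhe n (\<lambda>i. real (f i))"
        have "t' \<le> 2 * ?w / real N" if "t < ?w / real n"
        proof -
          have n: "0 < real n" using that t by (cases "n = 0") auto
          have "t' \<le> (1 - 1 / real N) * t" unfolding t'_def using N_large t by (intro mult_right_mono) auto
          also have "1 - 1 / real N = 2 * real n / real N" by (simp add: N_def field_simps)
          also have "2 * real n / real N * t \<le> 2 * real n / real N * (?w / real n)"
            using that by (intro mult_left_mono) auto
          also have "\<dots> = 2 * ?w / real N" using n by simp
          finally show ?thesis .
        qed
        then show "of_bool (t < ?w / real n) \<le> (of_bool (t' \<le> 2 * ?w / real N) :: real)" by auto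
      qed
      also have "\<dots> \<le> real (card V) * exp (s\<^sup>2 / 2 * exp (2 * s * B.rescale) - s\<^sup>2) + 3 * exp (- (z * (\<eta> * t')))"
        using B.writhe_tail[of V \<eta> t' s z \<beta>] V \<eta> t' s_def z \<beta>_def small unfolding n_eq N_eq M_eq T_def by simp
      also have "\<dots> \<le> real (card V) * (exp 1 * E) + 3 * E"
      proof (intro add_mono mult_left_mono)
        have "s\<^sup>2 / 2 * exp (2 * s * B.rescale) - s\<^sup>2 \<le> 1 + (- s\<^sup>2 / 2)"
          using e(3) by (simp add: B.rescale_def B.q_def)
        also have "\<dots> \<le> 1 + - ((pi\<^sup>2 / 4 - \<delta>) * t)" using s2 by simp
        finally show "exp (s\<^sup>2 / 2 * exp (2 * s * B.rescale) - s\<^sup>2) \<le> exp 1 * E"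
          unfolding E_def exp_add[symmetric] by simp
        have "z * (\<eta> * t') = pi\<^sup>2 / 4 * (1 - \<eta>) * t" using \<eta> by (simp add: z_def t'_def)
        then show "exp (- (z * (\<eta> * t'))) \<le> E" using mult_right_mono[OF rate1 t] by (simp add: E_def)
      qed auto
      also have "(real N)\<^sup>2 / real (k * r) \<le> E"
      proof -
        have "(real N)\<^sup>2 \<le> E * real r" using r E by (simp add: field_simps)
        also have "\<dots> \<le> E * real (k * r)"
        proof (rule mult_left_mono)
          have "r \<le> k * r" using k_pos by simp
          then show "real r \<le> real (k * r)" by (simp only: of_nat_le_iff)
        qed (use E in simp)
        finally show ?thesis using k_pos r_pos by (simp add: divide_le_eq)
      qed
      finally have "perm_prob n (\<lambda>w. t < w / real n) \<le> C * E" by (simp add: C_def algebra_simps)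
      moreover have "n0 \<le> n" using e(1) by (simp add: n_def)
      ultimately show ?thesis by blast
    qed
    then show ?thesis unfolding frequently_sequentially E_def by blast
  qed
  moreover have "0 < C" by (simp add: C_def add_pos_nonneg)
  ultimately show ?thesis by blast
qed

section \<open>Lower bound\<close>

text \<open>The difference of the two sides has derivative y^3 / (1 + y), which has the sign of y,
  so it is smallest at 0.\<close>

lemma ln_one_plus_le_cubic:
  fixes x :: real
  assumes "- 1 < x"
  shows "ln (1 + x) \<le> x - x\<^sup>2 / 2 + x ^ 3 / 3"
proof -
  define F where "F y = y - y\<^sup>2 / 2 + y ^ 3 / 3 - ln (1 + y)" for y :: real
  have deriv: "(F has_real_derivative y ^ 3 / (1 + y)) (at y)" if "- 1 < y" for y
  proof -
    have "(F has_real_derivative (1 - y + y\<^sup>2 - 1 / (1 + y))) (at y)"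
      unfolding F_def using that by (auto intro!: derivative_eq_intros simp: power2_eq_square)
    moreover have "1 - y + y\<^sup>2 - 1 / (1 + y) = y ^ 3 / (1 + y)"
      using that by (simp add: field_simps power2_eq_square power3_eq_cube)
    ultimately show ?thesis by simp
  qed
  have "F 0 \<le> F x"
  proof (cases "0 \<le> x")
    case True
    show ?thesis
    proof (rule DERIV_nonneg_imp_nondecreasing[OF True])
      fix y assume "0 \<le> y" "y \<le> x"
      then show "\<exists>D. (F has_real_derivative D) (at y) \<and> 0 \<le> D"
        using deriv[of y] by (intro exI[of _ "y ^ 3 / (1 + y)"]) auto
    qed
  next
    case False
    then have "x \<le> 0" by simp
    then show ?thesis
    proof (rule DERIV_nonpos_imp_nonincreasing)
      fix y assume "x \<le> y" "y \<le> 0"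
      then show "\<exists>D. (F has_real_derivative D) (at y) \<and> D \<le> 0"
        using deriv[of y] assms
        by (intro exI[of _ "y ^ 3 / (1 + y)"]) (auto simp: divide_le_0_iff power3_eq_cube mult_nonneg_nonpos mult_nonpos_nonpos)
    qed
  qed
  then show ?thesis by (simp add: F_def)
qed

text \<open>The left side is the integrand of a relative entropy. Averaged over a cosine of
  amplitude \<epsilon>, the linear term vanishes and the quadratic one gives \<epsilon>^2 /
  4.\<close>

lemma one_plus_mult_ln_le:
  fixes x :: real
  assumes "\<bar>x\<bar> \<le> 1 / 2"
  shows "(1 + x) * ln (1 + x) \<le> x + x\<^sup>2 / 2 + \<bar>x\<bar> ^ 3"
proof -
  have "(1 + x) * ln (1 + x) \<le> (1 + x) * (x - x\<^sup>2 / 2 + x ^ 3 / 3)"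
    using assms by (intro mult_left_mono ln_one_plus_le_cubic) auto
  also have "\<dots> = x + x\<^sup>2 / 2 + x ^ 3 * (x / 3 - 1 / 6)"
    by (simp add: field_simps power2_eq_square power3_eq_cube)
  also have "x ^ 3 * (x / 3 - 1 / 6) \<le> \<bar>x\<bar> ^ 3 * 1"
  proof -
    have "\<bar>x / 3 - 1 / 6\<bar> \<le> 1" using assms by (simp add: abs_le_iff)
    then have "\<bar>x ^ 3\<bar> * \<bar>x / 3 - 1 / 6\<bar> \<le> \<bar>x ^ 3\<bar> * 1" by (rule mult_left_mono) simp
    then show ?thesis
      using abs_ge_self[of "x ^ 3 * (x / 3 - 1 / 6)"] unfolding abs_mult power_abs by linarith
  qed
  finally show ?thesis by simp
qed

lemma abs_ln_one_plus_le:
  fixes x :: real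
  assumes "\<bar>x\<bar> \<le> 1 / 2"
  shows "\<bar>ln (1 + x)\<bar> \<le> 2 * \<bar>x\<bar>"
proof -
  have "\<bar>ln (1 + x) - x\<bar> \<le> 2 * x\<^sup>2" by (rule abs_ln_one_plus_x_minus_x_bound[OF assms])
  also have "2 * x\<^sup>2 \<le> \<bar>x\<bar>"
    using mult_left_mono[OF assms, of "2 * \<bar>x\<bar>"] by (simp add: power2_eq_square)
  finally show ?thesis by linarith
qed

section \<open>Trigonometric eigenvectors of the kernels\<close>

lemma unity_power_eq_cis: "unity m k ^ u = cis (2 * pi * real k * real u / real m)"
  by (simp add: unity_def Complex.DeMoivre mult_ac)

lemma sum_cis_period:
  assumes "0 < k" "k < L"
  shows "(\<Sum>u<L. cis (2 * pi * real k * real u / real L - \<phi>)) = 0"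
proof -
  have "(\<Sum>u<L. cis (2 * pi * real k * real u / real L - \<phi>)) = cis (- \<phi>) * (\<Sum>u<L. unity L k ^ u)"
    by (simp add: unity_power_eq_cis sum_distrib_left cis_mult)
  also have "(\<Sum>u<L. unity L k ^ u) = 0"
    using assms by (intro sum_root_of_unity) (simp_all add: unity_power_eq_1 unity_eq_1_iff)
  finally show ?thesis by simp
qed

text \<open>Applied with k = 1 and k = 2, which is the origin of the assumption
  \<open>3 \<le> L\<close> on the number of labels.\<close>

lemma sum_cos_sin_period:
  assumes "0 < k" "k < L"
  shows "(\<Sum>u<L. cos (2 * pi * real k * real u / real L - \<phi>)) = 0"
    and "(\<Sum>u<L. sin (2 * pi * real k * real u / real L - \<phi>)) = 0"
  using arg_cong[OF sum_cis_period[OF assms, of \<phi>], of Re] arg_cong[OF sum_cis_period[OF assms, of \<phi>], of Im]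
  by simp_all

lemma circulant_character:
  assumes "u < m"
  shows "(\<Sum>v<m. of_real (c (cdiff m u v)) * unity m k ^ v) = unity m k ^ u * (\<Sum>d<m. of_real (c d) * unity m k ^ d)"
proof -
  have "(\<Sum>v<m. of_real (c (cdiff m u v)) * unity m k ^ v)
    = (\<Sum>v<m. unity m k ^ u * (of_real (c (cdiff m u v)) * unity m k ^ cdiff m u v))"
    using assms by (intro sum.cong refl) (simp add: unity_power_cdiff)
  also have "\<dots> = unity m k ^ u * (\<Sum>d<m. of_real (c d) * unity m k ^ d)"
    unfolding sum_distrib_left[symmetric]
    by (intro arg_cong[where f = "(*) (unity m k ^ u)"] sum_cdiff_right[OF assms])
  finally show ?thesis .
qed

lemma circulant_cis:
  assumes "u < m"
  shows "(\<Sum>v<m. of_real (c (cdiff m u v)) * cis (2 * pi * real v / real m - \<phi>))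
    = cis (2 * pi * real u / real m - \<phi>) * (\<Sum>d<m. of_real (c d) * unity m 1 ^ d)"
proof -
  have cis: "cis (2 * pi * real v / real m - \<phi>) = cis (- \<phi>) * unity m 1 ^ v" for v
    by (simp add: unity_power_eq_cis cis_mult)
  have "(\<Sum>v<m. of_real (c (cdiff m u v)) * cis (2 * pi * real v / real m - \<phi>))
    = cis (- \<phi>) * (\<Sum>v<m. of_real (c (cdiff m u v)) * unity m 1 ^ v)"
    unfolding cis sum_distrib_left by (intro sum.cong refl) (simp only: mult_ac)
  then show ?thesis unfolding circulant_character[OF assms] cis by (simp only: mult_ac)
qed

text \<open>The eigenvalue of the sawtooth at the first frequency is imaginary, so a cosine becomes
  a multiple of the sine with the same phase.\<close>

lemma sum_saw_cos:
  assumes "u < L" "2 \<le> L"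
  shows "(\<Sum>v<L. saw L (cdiff L u v) * cos (2 * pi * real v / real L - \<phi>))
    = - cot (pi / real L) * sin (2 * pi * real u / real L - \<phi>)"
proof -
  have "(\<Sum>d<L. of_real (saw L d) * unity L 1 ^ d) = \<i> * of_real (cot (pi / real L))"
    using saw_symbol[of 1 L] assms(2) by simp
  then show ?thesis using arg_cong[OF circulant_cis[OF assms(1), of "saw L" \<phi>], of Re] by simp
qed

text \<open>With the phase of position \<open>i\<close> subtracted, the character is 1 at
  \<open>i\<close>, so the imaginary part reads off the eigenvalue.\<close>

lemma sum_square_wave_sin:
  assumes "i < 2 * n + 1" "0 < n"
  shows "(\<Sum>j<2 * n + 1. square_wave n (cdiff (2 * n + 1) i j) * sin (2 * pi * real j / real (2 * n + 1) - 2 * pi * real i / real (2 * n + 1)))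
    = cot (pi / (2 * real (2 * n + 1)))"
proof -
  define N where "N = 2 * n + 1"
  have N: "0 < real N" by (simp add: N_def)
  \<comment> \<open>The index \<open>n + 1\<close> is 1 halved modulo \<open>N\<close>. Its angle
    lies just beyond pi / 2, where the tangent is largest in modulus.\<close>
  have "unity N (n + 1) = unity N 1 ^ (n + 1)" using unity_swap[of N 1 "n + 1"] by simp
  then have sym: "(\<Sum>d<N. of_real (square_wave n d) * unity N 1 ^ d) = - \<i> * of_real (tan (pi * real (n + 1) / real N))"
    unfolding N_def using assms(2) by (intro square_wave_symbol) auto
  have "pi * real (n + 1) / real N = pi / 2 + pi / (2 * real N)" using N by (simp add: N_def field_simps)
  then have "tan (pi * real (n + 1) / real N) = - cot (pi / (2 * real N))"
    by (simp add: tan_def cot_def sin_add cos_add)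
  then have "(\<Sum>d<N. of_real (square_wave n d) * unity N 1 ^ d) = \<i> * of_real (cot (pi / (2 * real N)))"
    by (simp only: sym) simp
  then show ?thesis
    using arg_cong[OF circulant_cis[OF assms(1)[folded N_def], of "square_wave n" "2 * pi * real i / real N"], of Im]
    unfolding N_def[symmetric] by simp
qed

text \<open>The tilted law favours labels along a top eigenvector of the form. With \<open>N * \<epsilon>\<^sup>2\<close> fixed, its relative
  entropy with respect to the uniform law is about \<open>N * \<epsilon>\<^sup>2 / 4\<close>, and the writhe divided by \<open>n\<close> has mean about
  \<open>N * \<epsilon>\<^sup>2 / pi\<^sup>2\<close>.\<close>

locale tilted =
  fixes n L :: nat and \<epsilon> :: real
  assumes n_pos: "0 < n" and L_ge: "3 \<le> L" and eps: "0 \<le> \<epsilon>" "\<epsilon> \<le> 1 / 2"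
begin

definition "N = 2 * n + 1"
definition "\<phi> i = 2 * pi * real i / real N" for i :: nat
text \<open>The real part of a product of first characters in the label and in the position. Their
  opposite orientation makes the product of the two imaginary eigenvalues positive.\<close>

definition "x i u = \<epsilon> * cos (2 * pi * real u / real L - \<phi> i)" for i u :: nat

lemma x_bound: "\<bar>x i u\<bar> \<le> \<epsilon>"
  using mult_left_mono[OF abs_cos_le_one eps(1)] eps(1) by (simp add: x_def abs_mult)

lemma x_half: "\<bar>x i u\<bar> \<le> 1 / 2"
  using x_bound[of i u] eps(2) by linarith

lemma L_pos: "0 < L" and N_pos: "0 < N"
  using L_ge by (auto simp: N_def)

lemma sum_x: "(\<Sum>u<L. x i u) = 0"
  using sum_cos_sin_period(1)[of 1 L "\<phi> i"] L_ge by (simp add: x_def sum_distrib_left[symmetric])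

lemma sum_x_square: "(\<Sum>u<L. (x i u)\<^sup>2) = \<epsilon>\<^sup>2 * (real L / 2)"
proof -
  have "(x i u)\<^sup>2 = \<epsilon>\<^sup>2 * (1 / 2 + 1 / 2 * cos (2 * pi * real 2 * real u / real L - 2 * \<phi> i))" for u
  proof -
    have "2 * pi * real 2 * real u / real L - 2 * \<phi> i = 2 * (2 * pi * real u / real L - \<phi> i)" by (simp add: algebra_simps)
    then show ?thesis by (simp only: x_def power_mult_distrib cos_double_cos) (simp add: field_simps)
  qed
  then have "(\<Sum>u<L. (x i u)\<^sup>2) = \<epsilon>\<^sup>2 * (real L * (1 / 2) + 1 / 2 * (\<Sum>u<L. cos (2 * pi * real 2 * real u / real L - 2 * \<phi> i)))"
    by (simp only: sum_distrib_left[symmetric] sum.distrib) simp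
  also have "(\<Sum>u<L. cos (2 * pi * real 2 * real u / real L - 2 * \<phi> i)) = 0"
    using L_ge by (intro sum_cos_sin_period) auto
  finally show ?thesis by simp
qed

end

sublocale tilted \<subseteq> P: uniform_weights L
  by unfold_locales (rule L_pos)

sublocale tilted \<subseteq> Q: product_weights L "\<lambda>i u. (1 + x i u) / real L"
proof
  fix i u
  show "0 \<le> (1 + x i u) / real L" using x_half[of i u] by simp
  show "(\<Sum>u<L. (1 + x i u) / real L) = 1"
    using L_pos by (simp add: sum_divide_distrib[symmetric] sum.distrib sum_x)
qed

context tilted
begin

definition "log_ratio f = (\<Sum>i<N. ln (1 + x i (f i)))"

text \<open>The density of the tilted law with respect to the uniform one is the exponential of
  \<open>log_ratio\<close>, so where the latter is below \<open>s\<close>, passing to the uniform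
  law costs at most the factor exp s.\<close>

lemma change_of_measure:
  "Q.expect N (\<lambda>f. of_bool (A f \<and> log_ratio f < s)) \<le> exp s * P.expect N (\<lambda>f. of_bool (A f))"
proof -
  have "(\<Prod>i<N. (1 + x i (f i)) / real L) * of_bool (A f \<and> log_ratio f < s)
    \<le> exp s * ((\<Prod>i<N. 1 / real L) * of_bool (A f))" for f
  proof -
    have "(\<Prod>i<N. (1 + x i (f i)) / real L) = (\<Prod>i<N. exp (ln (1 + x i (f i)))) * (\<Prod>i<N. 1 / real L)"
      unfolding prod.distrib[symmetric]
    proof (intro prod.cong refl)
      fix i show "(1 + x i (f i)) / real L = exp (ln (1 + x i (f i))) * (1 / real L)"
        using x_half[of i "f i"] by simp
    qed
    also have "(\<Prod>i<N. exp (ln (1 + x i (f i)))) = exp (log_ratio f)" by (simp add: log_ratio_def exp_sum)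
    finally have eq: "(\<Prod>i<N. (1 + x i (f i)) / real L) = exp (log_ratio f) * (\<Prod>i<N. 1 / real L)" .
    show ?thesis
    proof (cases "A f \<and> log_ratio f < s")
      case True
      then show ?thesis unfolding eq by (simp add: mult_right_mono divide_right_mono)
    next
      case False
      then show ?thesis by (auto intro!: mult_nonneg_nonneg prod_nonneg)
    qed
  qed
  then show ?thesis
    unfolding Q.expect_def P.expect_def sum_distrib_left by (intro sum_mono) auto
qed

lemma Q_expect_bounded:
  assumes "\<And>u. u < L \<Longrightarrow> Y u \<le> b"
  shows "(\<Sum>u<L. (1 + x i u) / real L * Y u) \<le> b"
proof -
  have "(\<Sum>u<L. (1 + x i u) / real L * Y u) \<le> (\<Sum>u<L. (1 + x i u) / real L * b)"
    using assms Q.p_nonneg by (intro sum_mono mult_left_mono) auto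
  also have "\<dots> = b" by (simp only: sum_distrib_right[symmetric] Q.p_sum mult_1)
  finally show ?thesis .
qed

lemma log_ratio_tail:
  assumes "0 < \<rho>"
  shows "Q.expect N (\<lambda>f. of_bool (real N * (\<epsilon>\<^sup>2 / 4 + \<epsilon> ^ 3) + \<rho> \<le> log_ratio f)) \<le> real N * (4 * \<epsilon>)\<^sup>2 / \<rho>\<^sup>2"
proof -
  \<comment> \<open>The relative entropy of the law of the i-th label; summed over \<open>i\<close>
    it is the tilted mean of \<open>log_ratio\<close>.\<close>
  define \<kappa> where "\<kappa> i = (\<Sum>u<L. (1 + x i u) / real L * ln (1 + x i u))" for i
  have ln_bound: "\<bar>ln (1 + x i u)\<bar> \<le> 2 * \<epsilon>" for i u
    using abs_ln_one_plus_le[OF x_half[of i u]] x_bound[of i u] by linarith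
  have \<kappa>_le: "\<kappa> i \<le> \<epsilon>\<^sup>2 / 4 + \<epsilon> ^ 3" for i
  proof -
    have "\<kappa> i = 1 / real L * (\<Sum>u<L. (1 + x i u) * ln (1 + x i u))"
      by (simp add: \<kappa>_def sum_distrib_left)
    also have "\<dots> \<le> 1 / real L * (\<Sum>u<L. x i u + (x i u)\<^sup>2 / 2 + \<epsilon> ^ 3)"
    proof (intro mult_left_mono sum_mono)
      fix u
      have "\<bar>x i u\<bar> ^ 3 \<le> \<epsilon> ^ 3" by (intro power_mono x_bound) simp
      then show "(1 + x i u) * ln (1 + x i u) \<le> x i u + (x i u)\<^sup>2 / 2 + \<epsilon> ^ 3"
        using one_plus_mult_ln_le[OF x_half[of i u]] by linarith
    qed simp
    also have "\<dots> = \<epsilon>\<^sup>2 / 4 + \<epsilon> ^ 3"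
    proof -
      have "(\<Sum>u<L. x i u + (x i u)\<^sup>2 / 2 + \<epsilon> ^ 3) = \<epsilon>\<^sup>2 * (real L / 2) / 2 + real L * \<epsilon> ^ 3"
        by (simp only: sum.distrib sum_x sum_divide_distrib[symmetric] sum_x_square) simp
      then show ?thesis using L_pos by (simp add: field_simps)
    qed
    finally show ?thesis .
  qed
  have \<kappa>_abs: "\<bar>\<kappa> i\<bar> \<le> 2 * \<epsilon>" for i
  proof -
    have "\<kappa> i \<le> 2 * \<epsilon>" unfolding \<kappa>_def using ln_bound by (intro Q_expect_bounded) (simp add: abs_le_iff)
    moreover have "(\<Sum>u<L. (1 + x i u) / real L * - ln (1 + x i u)) \<le> 2 * \<epsilon>"
    proof (rule Q_expect_bounded)
      show "- ln (1 + x i u) \<le> 2 * \<epsilon>" for u using ln_bound[of i u] by linarith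
    qed
    then have "- \<kappa> i \<le> 2 * \<epsilon>" by (simp add: \<kappa>_def sum_negf)
    ultimately show ?thesis by linarith
  qed
  define Y where "Y i u = ln (1 + x i u) - \<kappa> i" for i u
  have "Q.expect N (\<lambda>f. of_bool (real N * (\<epsilon>\<^sup>2 / 4 + \<epsilon> ^ 3) + \<rho> \<le> log_ratio f))
    \<le> Q.expect N (\<lambda>f. of_bool (\<rho> \<le> \<bar>\<Sum>i<N. Y i (f i)\<bar>))"
  proof (rule Q.expect_mono)
    fix f
    have "(\<Sum>i<N. \<kappa> i) \<le> real N * (\<epsilon>\<^sup>2 / 4 + \<epsilon> ^ 3)"
      using sum_mono[of "{..<N}" \<kappa> "\<lambda>_. \<epsilon>\<^sup>2 / 4 + \<epsilon> ^ 3"] \<kappa>_le by simp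
    moreover have "(\<Sum>i<N. Y i (f i)) = log_ratio f - (\<Sum>i<N. \<kappa> i)"
      by (simp add: Y_def log_ratio_def sum_subtractf)
    ultimately have "\<rho> \<le> \<bar>\<Sum>i<N. Y i (f i)\<bar>" if "real N * (\<epsilon>\<^sup>2 / 4 + \<epsilon> ^ 3) + \<rho> \<le> log_ratio f"
      using that by linarith
    then show "of_bool (real N * (\<epsilon>\<^sup>2 / 4 + \<epsilon> ^ 3) + \<rho> \<le> log_ratio f) \<le> (of_bool (\<rho> \<le> \<bar>\<Sum>i<N. Y i (f i)\<bar>) :: real)" by auto
  qed
  also have "\<dots> \<le> Q.expect N (\<lambda>f. (\<Sum>i<N. Y i (f i))\<^sup>2) / \<rho>\<^sup>2" by (rule Q.expect_chebyshev[OF assms])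
  also have "Q.expect N (\<lambda>f. (\<Sum>i<N. Y i (f i))\<^sup>2) = (\<Sum>i<N. \<Sum>u<L. (1 + x i u) / real L * (Y i u)\<^sup>2)"
  proof (rule Q.independent_second_moment)
    fix i
    have "(\<Sum>u<L. (1 + x i u) / real L * Y i u) = \<kappa> i - (\<Sum>u<L. (1 + x i u) / real L) * \<kappa> i"
      by (simp only: Y_def right_diff_distrib sum_subtractf sum_distrib_right \<kappa>_def)
    then show "(\<Sum>u<L. (1 + x i u) / real L * Y i u) = 0" by (simp only: Q.p_sum mult_1 diff_self)
  qed
  also have "\<dots> \<le> (\<Sum>i<N. (4 * \<epsilon>)\<^sup>2)"
  proof (intro sum_mono Q_expect_bounded)
    fix i u
    have "\<bar>Y i u\<bar> \<le> 4 * \<epsilon>" using ln_bound[of i u] \<kappa>_abs[of i] unfolding Y_def by linarith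
    then have "\<bar>Y i u\<bar>\<^sup>2 \<le> (4 * \<epsilon>)\<^sup>2" by (intro power_mono) auto
    then show "(Y i u)\<^sup>2 \<le> (4 * \<epsilon>)\<^sup>2" by simp
  qed
  also have "\<dots> = real N * (4 * \<epsilon>)\<^sup>2" by simp
  finally show ?thesis by (simp add: divide_right_mono)
qed

end

section \<open>Concentration of the writhe under the tilted law\<close>

context tilted
begin

text \<open>Hoeffding decomposition of \<open>H\<close> under the tilted law: \<open>A\<close> is its projection on one label, \<open>r\<close> the
  degenerate part.\<close>

definition "K i j = square_wave n (cdiff N i j)"
definition "H u v = saw L (cdiff L u v)"
definition "saw_rate = cot (pi / real L) / real L"
definition "A j u = - (\<epsilon> * saw_rate) * sin (2 * pi * real u / real L - \<phi> j)"
definition "pair_mean i j = \<epsilon>\<^sup>2 / 2 * saw_rate * sin (\<phi> j - \<phi> i)"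
definition "r i j u v = H u v - A j u + A i v + pair_mean i j"
definition "B i u = (\<Sum>j<N. K i j * A j u)"
definition "b i = (\<Sum>j<N. K i j * pair_mean i j)"
definition "mean = real N * \<epsilon>\<^sup>2 / 4 * saw_rate * cot (pi / (2 * real N))"

lemma saw_rate_bound: "\<bar>saw_rate\<bar> \<le> 1"
proof -
  have "norm (\<i> * complex_of_real (cot (pi / real L))) \<le> real L / pi"
    using saw_symbol_norm_le[of 1 L] saw_symbol[of 1 L] L_ge by simp
  then have "\<bar>cot (pi / real L)\<bar> \<le> real L / pi" by (simp add: norm_mult)
  also have "\<dots> \<le> real L / 1" using pi_ge_two by (intro divide_left_mono) auto
  finally show ?thesis using L_pos by (simp add: saw_rate_def)
qed

lemma A_bound: "\<bar>A j u\<bar> \<le> \<epsilon>"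
proof -
  have "\<bar>A j u\<bar> = \<epsilon> * (\<bar>saw_rate\<bar> * \<bar>sin (2 * pi * real u / real L - \<phi> j)\<bar>)"
    using eps(1) by (simp add: A_def abs_mult)
  also have "\<dots> \<le> \<epsilon> * (1 * 1)"
    using eps(1) saw_rate_bound abs_sin_le_one by (intro mult_left_mono mult_mono) auto
  finally show ?thesis by simp
qed

lemma pair_mean_bound: "\<bar>pair_mean i j\<bar> \<le> \<epsilon>"
proof -
  have "\<bar>pair_mean i j\<bar> = \<epsilon>\<^sup>2 / 2 * (\<bar>saw_rate\<bar> * \<bar>sin (\<phi> j - \<phi> i)\<bar>)"
    by (simp add: pair_mean_def abs_mult)
  also have "\<dots> \<le> \<epsilon>\<^sup>2 / 2 * (1 * 1)"
    using saw_rate_bound abs_sin_le_one by (intro mult_left_mono mult_mono) auto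
  also have "\<dots> \<le> \<epsilon>" using mult_right_mono[OF eps(2) eps(1)] eps(1) by (simp add: power2_eq_square)
  finally show ?thesis .
qed

lemma pair_mean_antisym: "pair_mean j i = - pair_mean i j"
proof -
  have e: "\<phi> i - \<phi> j = - (\<phi> j - \<phi> i)" by simp
  show ?thesis by (simp only: pair_mean_def e sin_minus mult_minus_right)
qed

lemma A_eq:
  assumes "u < L"
  shows "(\<Sum>v<L. (1 + x j v) / real L * H u v) = A j u"
proof -
  have "(\<Sum>v<L. (1 + x j v) / real L * H u v)
    = 1 / real L * ((\<Sum>v<L. H u v) + \<epsilon> * (\<Sum>v<L. H u v * cos (2 * pi * real v / real L - \<phi> j)))"
    unfolding sum_distrib_left sum.distrib[symmetric]
    by (intro sum.cong refl) (simp add: x_def field_simps)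
  also have "(\<Sum>v<L. H u v) = 0" unfolding H_def sum_cdiff_right[OF assms] by (rule sum_saw)
  also have "(\<Sum>v<L. H u v * cos (2 * pi * real v / real L - \<phi> j)) = - cot (pi / real L) * sin (2 * pi * real u / real L - \<phi> j)"
    unfolding H_def using L_ge by (intro sum_saw_cos assms) simp
  finally show ?thesis by (simp add: A_def saw_rate_def)
qed

text \<open>The product of cosine and sine splits into a part of double frequency, which sums to 0
  over a period, and a constant that depends only on the difference of the phases.\<close>

lemma pair_mean_eq: "(\<Sum>u<L. (1 + x i u) / real L * A j u) = pair_mean i j"
proof -
  have "x i u * A j u = - (\<epsilon>\<^sup>2 * saw_rate / 2) * sin (2 * pi * real 2 * real u / real L - (\<phi> i + \<phi> j)) + \<epsilon>\<^sup>2 * saw_rate / 2 * sin (\<phi> j - \<phi> i)" for u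
  proof -
    define a where "a = 2 * pi * real u / real L"
    have "cos (a - \<phi> i) * sin (a - \<phi> j) = (sin ((a - \<phi> i) + (a - \<phi> j)) - sin ((a - \<phi> i) - (a - \<phi> j))) / 2"
      by (rule cos_times_sin)
    moreover have "(a - \<phi> i) + (a - \<phi> j) = 2 * pi * real 2 * real u / real L - (\<phi> i + \<phi> j)" by (simp add: a_def)
    moreover have "(a - \<phi> i) - (a - \<phi> j) = \<phi> j - \<phi> i" by simp
    ultimately have e: "cos (a - \<phi> i) * sin (a - \<phi> j)
      = (sin (2 * pi * real 2 * real u / real L - (\<phi> i + \<phi> j)) - sin (\<phi> j - \<phi> i)) / 2" by (simp only:)
    have "x i u * A j u = - (\<epsilon>\<^sup>2 * saw_rate) * (cos (a - \<phi> i) * sin (a - \<phi> j))"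
      unfolding x_def A_def a_def power2_eq_square by simp
    then show ?thesis unfolding e by (simp add: diff_divide_distrib right_diff_distrib)
  qed
  then have "(\<Sum>u<L. x i u * A j u) = - (\<epsilon>\<^sup>2 * saw_rate / 2) * (\<Sum>u<L. sin (2 * pi * real 2 * real u / real L - (\<phi> i + \<phi> j)))
      + real L * (\<epsilon>\<^sup>2 * saw_rate / 2 * sin (\<phi> j - \<phi> i))"
    by (simp only: sum.distrib sum_distrib_left[symmetric]) simp
  also have "(\<Sum>u<L. sin (2 * pi * real 2 * real u / real L - (\<phi> i + \<phi> j))) = 0"
    using L_ge by (intro sum_cos_sin_period) auto
  finally have xA: "(\<Sum>u<L. x i u * A j u) = real L * pair_mean i j" by (simp add: pair_mean_def)
  have "(\<Sum>u<L. A j u) = 0"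
    unfolding A_def sum_distrib_left[symmetric] using sum_cos_sin_period(2)[of 1 L "\<phi> j"] L_ge by simp
  moreover have "(\<Sum>u<L. (1 + x i u) / real L * A j u) = 1 / real L * ((\<Sum>u<L. A j u) + (\<Sum>u<L. x i u * A j u))"
    unfolding sum_distrib_left sum.distrib[symmetric] by (intro sum.cong refl) (simp add: field_simps)
  ultimately show ?thesis using xA L_pos by simp
qed

text \<open>The projection of \<open>H\<close> on its second label is \<open>- A i v\<close> because
  \<open>H\<close> is antisymmetric; this explains the sign of that term in
  \<open>r\<close>.\<close>

lemma r_centred_right:
  assumes "u < L"
  shows "(\<Sum>v<L. (1 + x j v) / real L * r i j u v) = 0"
proof -
  have "(\<Sum>v<L. (1 + x j v) / real L * r i j u v)
    = (\<Sum>v<L. (1 + x j v) / real L * H u v) - (\<Sum>v<L. (1 + x j v) / real L) * A j u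
      + (\<Sum>v<L. (1 + x j v) / real L * A i v) + (\<Sum>v<L. (1 + x j v) / real L) * pair_mean i j"
    by (simp only: r_def distrib_left right_diff_distrib sum.distrib sum_subtractf sum_distrib_right)
  then show ?thesis
    unfolding A_eq[OF assms] pair_mean_eq Q.p_sum pair_mean_antisym[of j i] by simp
qed

lemma K_antisym: "i < N \<Longrightarrow> j < N \<Longrightarrow> K j i = - K i j"
  unfolding K_def N_def by (rule square_wave_antisym)

lemma K_bound: "\<bar>K i j\<bar> \<le> 1"
  by (simp add: K_def square_wave_abs_le_1)

lemma r_antisym:
  assumes "u < L" "v < L"
  shows "r j i v u = - r i j u v"
  using saw_antisym[OF assms] pair_mean_antisym[of j i] unfolding r_def H_def by linarith

lemma r_centred_left:
  assumes "v < L"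
  shows "(\<Sum>u<L. (1 + x i u) / real L * r i j u v) = 0"
proof -
  have "(\<Sum>u<L. (1 + x i u) / real L * r i j u v) = (\<Sum>u<L. - ((1 + x i u) / real L * r j i v u))"
    using r_antisym[OF _ assms] by (intro sum.cong refl) simp
  then show ?thesis using r_centred_right[OF assms, of i j] by (simp only: sum_negf)
qed

lemma r_bound: "\<bar>r i j u v\<bar> \<le> 3"
proof -
  have "\<bar>H u v\<bar> \<le> 1" unfolding H_def using L_pos by (intro saw_abs_le_1 cdiff_less)
  then show ?thesis
    using A_bound[of j u] A_bound[of i v] pair_mean_bound[of i j] eps(2) unfolding r_def by linarith
qed

lemma sum_b: "(\<Sum>i<N. b i) = 2 * mean"
proof -
  have "b i = \<epsilon>\<^sup>2 / 2 * saw_rate * cot (pi / (2 * real N))" if "i < N" for i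
  proof -
    have "b i = \<epsilon>\<^sup>2 / 2 * saw_rate * (\<Sum>j<N. K i j * sin (\<phi> j - \<phi> i))"
      unfolding b_def pair_mean_def sum_distrib_left by (intro sum.cong refl) simp
    also have "(\<Sum>j<N. K i j * sin (\<phi> j - \<phi> i)) = cot (pi / (2 * real N))"
      unfolding K_def \<phi>_def N_def using that n_pos unfolding N_def by (rule sum_square_wave_sin)
    finally show ?thesis .
  qed
  then have "(\<Sum>i<N. b i) = (\<Sum>i<N. \<epsilon>\<^sup>2 / 2 * saw_rate * cot (pi / (2 * real N)))"
    by (intro sum.cong refl) simp
  then show ?thesis by (simp add: mean_def)
qed

text \<open>Since \<open>K\<close> and \<open>H\<close> are both antisymmetric, the projections on
  the two labels of a pair contribute equally. As \<open>b\<close> sums to twice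
  \<open>mean\<close>, subtracting \<open>mean\<close> centres each \<open>B i\<close> at its
  expectation \<open>b i\<close>.\<close>

lemma writhe_hoeffding:
  assumes f: "f \<in> PiE {..<N} (\<lambda>_. {..<L})"
  shows "writhe n (\<lambda>i. real (f i)) - mean = (\<Sum>j<N. \<Sum>i<j. K i j * r i j (f i) (f j)) + (\<Sum>i<N. B i (f i) - b i)"
proof -
  have fi: "f i < L" if "i < N" for i using PiE_mem[OF f, of i] that by simp
  have "2 * writhe n (\<lambda>i. real (f i)) = (\<Sum>i<N. \<Sum>j<N. K i j * H (f i) (f j))"
    unfolding K_def H_def N_def by (rule writhe_eq_saw_sum) (simp add: fi N_def)
  also have "\<dots> = (\<Sum>i<N. \<Sum>j<N. K i j * r i j (f i) (f j)) + (\<Sum>i<N. \<Sum>j<N. K i j * A j (f i))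
      + (\<Sum>i<N. \<Sum>j<N. - (K i j * A i (f j))) - (\<Sum>i<N. \<Sum>j<N. K i j * pair_mean i j)"
    unfolding sum.distrib[symmetric] sum_subtractf[symmetric]
    by (intro sum.cong refl) (simp add: r_def algebra_simps)
  also have "(\<Sum>i<N. \<Sum>j<N. - (K i j * A i (f j))) = (\<Sum>i<N. \<Sum>j<N. - (K j i * A j (f i)))" by (rule sum.swap)
  also have "\<dots> = (\<Sum>i<N. \<Sum>j<N. K i j * A j (f i))"
  proof (intro sum.cong refl)
    fix i j assume "i \<in> {..<N}" "j \<in> {..<N}"
    then have "K j i = - K i j" by (intro K_antisym) simp_all
    then show "- (K j i * A j (f i)) = K i j * A j (f i)" by simp
  qed
  also have "(\<Sum>i<N. \<Sum>j<N. K i j * r i j (f i) (f j)) = 2 * (\<Sum>j<N. \<Sum>i<j. K i j * r i j (f i) (f j))"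
  proof (rule sum_symmetric_eq_triangle)
    fix i j assume ij: "i < N" "j < N"
    show "K j i * r j i (f j) (f i) = K i j * r i j (f i) (f j)"
      unfolding K_antisym[OF ij] r_antisym[OF fi[OF ij(1)] fi[OF ij(2)]] by simp
  next
    fix i assume "i < N"
    then show "K i i * r i i (f i) (f i) = 0" using K_antisym[of i i] by simp
  qed
  finally have "2 * writhe n (\<lambda>i. real (f i)) = 2 * (\<Sum>j<N. \<Sum>i<j. K i j * r i j (f i) (f j)) + 2 * (\<Sum>i<N. B i (f i)) - (\<Sum>i<N. b i)"
    by (simp add: B_def b_def)
  then show ?thesis by (simp add: sum_b sum_subtractf)
qed

text \<open>Distinct pairs are orthogonal: martingale increments in \<open>j\<close>, and within one
  increment independent centred terms in \<open>i\<close>. So the bound only counts pairs.\<close>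

lemma degenerate_second_moment:
  "Q.expect N (\<lambda>f. (\<Sum>j<N. \<Sum>i<j. K i j * r i j (f i) (f j))\<^sup>2) \<le> 9 * (real N)\<^sup>2"
proof -
  define D where "D j f v = (\<Sum>i<j. K i j * r i j (f i) v)" for j f v
  have "Q.expect N (\<lambda>f. (\<Sum>j<N. D j f (f j))\<^sup>2) = (\<Sum>j<N. Q.expect j (\<lambda>f. \<Sum>v<L. (1 + x j v) / real L * (D j f v)\<^sup>2))"
  proof (rule Q.martingale_second_moment)
    fix j f g v assume "j < N" "\<And>i. i < j \<Longrightarrow> f i = (g i :: nat)"
    then show "D j f v = D j g v" by (simp add: D_def)
  next
    fix j f assume "j < N" and f: "f \<in> PiE {..<j} (\<lambda>_. {..<L})"
    have "(\<Sum>v<L. (1 + x j v) / real L * D j f v) = (\<Sum>v<L. \<Sum>i<j. K i j * ((1 + x j v) / real L * r i j (f i) v))"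
      unfolding D_def sum_distrib_left by (intro sum.cong refl) (simp only: mult.left_commute)
    also have "\<dots> = (\<Sum>i<j. \<Sum>v<L. K i j * ((1 + x j v) / real L * r i j (f i) v))" by (rule sum.swap)
    also have "\<dots> = (\<Sum>i<j. K i j * (\<Sum>v<L. (1 + x j v) / real L * r i j (f i) v))" by (simp only: sum_distrib_left)
    also have "\<dots> = 0"
    proof (rule sum.neutral, rule ballI)
      fix i assume "i \<in> {..<j}"
      then have "f i < L" using PiE_mem[OF f, of i] by simp
      then show "K i j * (\<Sum>v<L. (1 + x j v) / real L * r i j (f i) v) = 0" by (simp only: r_centred_right mult_zero_right)
    qed
    finally show "(\<Sum>v<L. (1 + x j v) / real L * D j f v) = 0" .
  qed
  also have "\<dots> \<le> (\<Sum>j<N. 9 * real N)"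
  proof (rule sum_mono)
    fix j assume "j \<in> {..<N}"
    then have j: "j < N" by simp
    have row: "Q.expect j (\<lambda>f. (D j f v)\<^sup>2) \<le> 9 * real N" if v: "v < L" for v
    proof -
      have "Q.expect j (\<lambda>f. (D j f v)\<^sup>2) = (\<Sum>i<j. \<Sum>u<L. (1 + x i u) / real L * (K i j * r i j u v)\<^sup>2)"
        unfolding D_def
      proof (rule Q.independent_second_moment)
        fix i
        have "(\<Sum>u<L. (1 + x i u) / real L * (K i j * r i j u v)) = K i j * (\<Sum>u<L. (1 + x i u) / real L * r i j u v)"
          unfolding sum_distrib_left by (intro sum.cong refl) (simp only: mult.left_commute)
        then show "(\<Sum>u<L. (1 + x i u) / real L * (K i j * r i j u v)) = 0" by (simp only: r_centred_left[OF v] mult_zero_right)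
      qed
      also have "\<dots> \<le> (\<Sum>i<j. 9)"
      proof (intro sum_mono Q_expect_bounded)
        fix i u
        have "\<bar>K i j * r i j u v\<bar> \<le> 1 * 3" unfolding abs_mult by (intro mult_mono K_bound r_bound) auto
        then have "\<bar>K i j * r i j u v\<bar>\<^sup>2 \<le> 3\<^sup>2" by (intro power_mono) auto
        then show "(K i j * r i j u v)\<^sup>2 \<le> 9" by simp
      qed
      also have "\<dots> \<le> 9 * real N" using j by simp
      finally show ?thesis .
    qed
    have "Q.expect j (\<lambda>f. \<Sum>v<L. (1 + x j v) / real L * (D j f v)\<^sup>2) = (\<Sum>v<L. (1 + x j v) / real L * Q.expect j (\<lambda>f. (D j f v)\<^sup>2))"
      by (simp only: Q.expect_sum Q.expect_cmult)
    also have "\<dots> \<le> 9 * real N" by (rule Q_expect_bounded) (rule row)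
    finally show "Q.expect j (\<lambda>f. \<Sum>v<L. (1 + x j v) / real L * (D j f v)\<^sup>2) \<le> 9 * real N" .
  qed
  also have "\<dots> = 9 * (real N)\<^sup>2" by (simp add: power2_eq_square)
  finally show ?thesis by (simp only: D_def)
qed

lemma linear_second_moment:
  "Q.expect N (\<lambda>f. (\<Sum>i<N. B i (f i) - b i)\<^sup>2) \<le> real N * (2 * (real N * \<epsilon>))\<^sup>2"
proof -
  have "Q.expect N (\<lambda>f. (\<Sum>i<N. B i (f i) - b i)\<^sup>2) = (\<Sum>i<N. \<Sum>u<L. (1 + x i u) / real L * (B i u - b i)\<^sup>2)"
  proof (rule Q.independent_second_moment)
    fix i
    have "(\<Sum>u<L. (1 + x i u) / real L * B i u) = (\<Sum>u<L. \<Sum>j<N. K i j * ((1 + x i u) / real L * A j u))"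
      unfolding B_def sum_distrib_left by (intro sum.cong refl) (simp only: mult.left_commute)
    also have "\<dots> = (\<Sum>j<N. \<Sum>u<L. K i j * ((1 + x i u) / real L * A j u))" by (rule sum.swap)
    also have "\<dots> = b i" by (simp only: sum_distrib_left[symmetric] pair_mean_eq b_def)
    finally have "(\<Sum>u<L. (1 + x i u) / real L * B i u) = b i" .
    moreover have "(\<Sum>u<L. (1 + x i u) / real L * (B i u - b i)) = (\<Sum>u<L. (1 + x i u) / real L * B i u) - (\<Sum>u<L. (1 + x i u) / real L) * b i"
      by (simp only: right_diff_distrib sum_subtractf sum_distrib_right)
    ultimately show "(\<Sum>u<L. (1 + x i u) / real L * (B i u - b i)) = 0" by (simp only: Q.p_sum mult_1 diff_self)
  qed
  also have "\<dots> \<le> (\<Sum>i<N. (2 * (real N * \<epsilon>))\<^sup>2)"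
  proof (intro sum_mono Q_expect_bounded)
    fix i u
    have "\<bar>B i u\<bar> \<le> (\<Sum>j<N. \<epsilon>)"
      unfolding B_def
    proof (intro order_trans[OF sum_abs] sum_mono)
      fix j
      have "\<bar>K i j\<bar> * \<bar>A j u\<bar> \<le> 1 * \<epsilon>" by (intro mult_mono K_bound A_bound) auto
      then show "\<bar>K i j * A j u\<bar> \<le> \<epsilon>" by (simp add: abs_mult)
    qed
    moreover have "\<bar>b i\<bar> \<le> (\<Sum>j<N. \<epsilon>)"
      unfolding b_def
    proof (intro order_trans[OF sum_abs] sum_mono)
      fix j
      have "\<bar>K i j\<bar> * \<bar>pair_mean i j\<bar> \<le> 1 * \<epsilon>" by (intro mult_mono K_bound pair_mean_bound) auto
      then show "\<bar>K i j * pair_mean i j\<bar> \<le> \<epsilon>" by (simp add: abs_mult)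
    qed
    ultimately have "\<bar>B i u - b i\<bar> \<le> 2 * (real N * \<epsilon>)" by simp
    then have "\<bar>B i u - b i\<bar>\<^sup>2 \<le> (2 * (real N * \<epsilon>))\<^sup>2" by (intro power_mono) auto
    then show "(B i u - b i)\<^sup>2 \<le> (2 * (real N * \<epsilon>))\<^sup>2" by simp
  qed
  finally show ?thesis by simp
qed

text \<open>Both second moments are at most of order N^2 when N * \<epsilon>^2 is fixed, so the
  bound depends on \<open>N\<close> only through that product. It becomes small when \<tau> is a
  fixed fraction of a large N * \<epsilon>^2.\<close>

lemma writhe_concentration:
  assumes "0 < \<tau>"
  shows "Q.expect N (\<lambda>f. of_bool (real N * \<tau> \<le> \<bar>writhe n (\<lambda>i. real (f i)) - mean\<bar>)) \<le> (18 + 8 * (real N * \<epsilon>\<^sup>2)) / \<tau>\<^sup>2"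
proof -
  let ?R = "\<lambda>f. \<Sum>j<N. \<Sum>i<j. K i j * r i j (f i) (f j)" and ?S = "\<lambda>f. \<Sum>i<N. B i (f i) - b i"
  have "Q.expect N (\<lambda>f. of_bool (real N * \<tau> \<le> \<bar>writhe n (\<lambda>i. real (f i)) - mean\<bar>))
    \<le> Q.expect N (\<lambda>f. (writhe n (\<lambda>i. real (f i)) - mean)\<^sup>2) / (real N * \<tau>)\<^sup>2"
    using assms N_pos by (intro Q.expect_chebyshev) simp
  also have "\<dots> \<le> (2 * (9 * (real N)\<^sup>2) + 2 * (real N * (2 * (real N * \<epsilon>))\<^sup>2)) / (real N * \<tau>)\<^sup>2"
  proof (rule divide_right_mono)
    have "Q.expect N (\<lambda>f. (writhe n (\<lambda>i. real (f i)) - mean)\<^sup>2) \<le> Q.expect N (\<lambda>f. 2 * (?R f)\<^sup>2 + 2 * (?S f)\<^sup>2)"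
    proof (rule Q.expect_mono)
      fix f assume f: "f \<in> PiE {..<N} (\<lambda>_. {..<L})"
      show "(writhe n (\<lambda>i. real (f i)) - mean)\<^sup>2 \<le> 2 * (?R f)\<^sup>2 + 2 * (?S f)\<^sup>2"
        unfolding writhe_hoeffding[OF f] using zero_le_power2[of "?R f - ?S f"]
        unfolding power2_sum power2_diff by linarith
    qed
    also have "\<dots> = 2 * Q.expect N (\<lambda>f. (?R f)\<^sup>2) + 2 * Q.expect N (\<lambda>f. (?S f)\<^sup>2)"
      by (simp only: Q.expect_add Q.expect_cmult)
    also have "\<dots> \<le> 2 * (9 * (real N)\<^sup>2) + 2 * (real N * (2 * (real N * \<epsilon>))\<^sup>2)"
      using degenerate_second_moment linear_second_moment by simp
    finally show "Q.expect N (\<lambda>f. (writhe n (\<lambda>i. real (f i)) - mean)\<^sup>2) \<le> 2 * (9 * (real N)\<^sup>2) + 2 * (real N * (2 * (real N * \<epsilon>))\<^sup>2)" .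
  qed simp
  also have "\<dots> = (18 + 8 * (real N * \<epsilon>\<^sup>2)) / \<tau>\<^sup>2"
    using N_pos assms by (simp add: field_simps power2_eq_square)
  finally show ?thesis .
qed

end

text \<open>The choice N * \<epsilon>^2 = pi^2 * t * (1 + \<delta>) puts the tilted mean of w / n
  near t * (1 + \<delta>). The entropy is then about pi^2 / 4 * t * (1 + \<delta>); the second
  \<delta> is the Chebyshev margin \<rho>, and the summand 1 absorbs N * \<epsilon>^3. Two failure
  probabilities of at most 1/4 leave 1/2.\<close>

lemma lower_tail_at:
  fixes \<delta> t :: real
  assumes \<delta>: "0 < \<delta>" "\<delta> \<le> 1" and t: "0 < t"
    and fail1: "(18 + 8 * (pi\<^sup>2 * t * (1 + \<delta>))) / (t * \<delta> / 4)\<^sup>2 \<le> 1 / 4"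
    and fail2: "16 * (pi\<^sup>2 * t * (1 + \<delta>)) / (pi\<^sup>2 / 4 * t * \<delta>)\<^sup>2 \<le> 1 / 4"
  shows "\<forall>\<^sub>F n in sequentially. exp (- (pi\<^sup>2 / 4 * (1 + 2 * \<delta>) * t + 1)) / 4 \<le> perm_prob n (\<lambda>w. t < w / real n)"
proof -
  define c2 where "c2 = pi\<^sup>2 * t * (1 + \<delta>)"
  define \<epsilon> where "\<epsilon> n = sqrt (c2 / real (2 * n + 1))" for n
  define E where "E = exp (- (pi\<^sup>2 / 4 * (1 + 2 * \<delta>) * t + 1))"
  \<comment> \<open>Each of the two eigenvalues may fall short of its limit by the fraction
    \<gamma>; jointly they lose at most \<delta> / 4.\<close>
  define \<gamma> where "\<gamma> = \<delta> / 8"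
  have c2: "0 < c2" using \<delta> t by (simp add: c2_def)
  have \<epsilon>_lim: "\<epsilon> \<longlonglongrightarrow> 0"
  proof -
    have "(\<lambda>n. c2 / real (2 * n + 1)) \<longlonglongrightarrow> 0" by real_asymp
    then show ?thesis unfolding \<epsilon>_def using tendsto_real_sqrt by fastforce
  qed
  have ev1: "\<forall>\<^sub>F n in sequentially. \<epsilon> n < 1 / 2" by (rule order_tendstoD(2)[OF \<epsilon>_lim]) simp
  have ev2: "\<forall>\<^sub>F n in sequentially. \<epsilon> n < 1 / c2" by (rule order_tendstoD(2)[OF \<epsilon>_lim]) (use c2 in simp)
  have "(\<lambda>n. cot (pi / (2 * real (2 * n + 1))) / real (2 * n + 1)) \<longlonglongrightarrow> 2 / pi"
    unfolding cot_def by real_asymp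
  then have ev3: "\<forall>\<^sub>F n in sequentially. 2 / pi * (1 - \<gamma>) < cot (pi / (2 * real (2 * n + 1))) / real (2 * n + 1)"
    by (rule order_tendstoD(1)) (use \<delta> in \<open>simp add: \<gamma>_def field_simps\<close>)
  have "(\<lambda>L. cot (pi / real L) / real L) \<longlonglongrightarrow> 1 / pi"
    unfolding cot_def by (real_asymp simp add: inverse_eq_divide)
  then have evL: "\<forall>\<^sub>F L in sequentially. 1 / pi * (1 - \<gamma>) < cot (pi / real L) / real L"
    by (rule order_tendstoD(1)) (use \<delta> in \<open>simp add: \<gamma>_def field_simps\<close>)
  have E: "0 < E" by (simp add: E_def)
  have "E / 4 \<le> perm_prob n (\<lambda>w. t < w / real n)"
    if n: "0 < n" "\<epsilon> n < 1 / 2" "\<epsilon> n < 1 / c2"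
      "2 / pi * (1 - \<gamma>) < cot (pi / (2 * real (2 * n + 1))) / real (2 * n + 1)" for n
  proof -
    define N where "N = 2 * n + 1"
    have N: "0 < real N" by (simp add: N_def)
    have "(\<lambda>L. (real N)\<^sup>2 / real L) \<longlonglongrightarrow> 0" by real_asymp
    then have "\<forall>\<^sub>F L in sequentially. (real N)\<^sup>2 / real L < E / 4" by (rule order_tendstoD(2)) (use E in simp)
    then have "\<forall>\<^sub>F L in sequentially. 3 \<le> L \<and> (real N)\<^sup>2 / real L < E / 4 \<and> 1 / pi * (1 - \<gamma>) < cot (pi / real L) / real L"
      by (intro eventually_conj eventually_ge_at_top evL)
    then obtain L where L: "3 \<le> L" "(real N)\<^sup>2 / real L < E / 4" "1 / pi * (1 - \<gamma>) < cot (pi / real L) / real L"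
      using eventually_happens'[OF sequentially_bot] by blast
    interpret T: tilted n L "\<epsilon> n"
      by unfold_locales (use n L c2 in \<open>auto simp: \<epsilon>_def\<close>)
    have N_eq: "T.N = N" by (simp add: T.N_def N_def)
    have eps2: "real N * (\<epsilon> n)\<^sup>2 = c2" using c2 by (simp add: \<epsilon>_def N_def)
    have eps3: "real N * \<epsilon> n ^ 3 \<le> 1"
    proof -
      have "real N * \<epsilon> n ^ 3 = (real N * (\<epsilon> n)\<^sup>2) * \<epsilon> n" by (simp add: power3_eq_cube power2_eq_square)
      also have "\<dots> \<le> c2 * (1 / c2)" unfolding eps2 using n(3) c2 by (intro mult_left_mono) auto
      finally show ?thesis using c2 by simp
    qed
    have mean: "real N * (t / 2 + t * \<delta> / 4) \<le> T.mean"
    proof -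
      have \<gamma>: "0 \<le> 1 - \<gamma>" using \<delta> by (simp add: \<gamma>_def)
      have "(1 / pi * (1 - \<gamma>)) * (2 / pi * (1 - \<gamma>) * real N) \<le> T.saw_rate * cot (pi / (2 * real N))"
      proof (rule mult_mono)
        show "1 / pi * (1 - \<gamma>) \<le> T.saw_rate" using L(3) by (simp add: T.saw_rate_def)
        show "2 / pi * (1 - \<gamma>) * real N \<le> cot (pi / (2 * real N))"
          using n(4) N unfolding N_def[symmetric] by (simp add: less_divide_eq less_imp_le)
        have "0 \<le> 1 / pi * (1 - \<gamma>)" using \<gamma> by simp
        also note less_imp_le[OF L(3)]
        finally show "0 \<le> T.saw_rate" by (simp only: T.saw_rate_def)
        show "0 \<le> 2 / pi * (1 - \<gamma>) * real N" using \<gamma> by simp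
      qed
      then have "c2 / 4 * ((1 / pi * (1 - \<gamma>)) * (2 / pi * (1 - \<gamma>) * real N)) \<le> c2 / 4 * (T.saw_rate * cot (pi / (2 * real N)))"
        using c2 by (intro mult_left_mono) auto
      also have "\<dots> = T.mean" by (simp add: T.mean_def N_eq eps2[symmetric])
      also have "c2 / 4 * ((1 / pi * (1 - \<gamma>)) * (2 / pi * (1 - \<gamma>) * real N)) = real N * (t / 2) * ((1 + \<delta>) * (1 - \<gamma>)\<^sup>2)"
        by (simp add: c2_def power2_eq_square field_simps)
      finally have *: "real N * (t / 2) * ((1 + \<delta>) * (1 - \<gamma>)\<^sup>2) \<le> T.mean" .
      have "1 + \<delta> / 2 \<le> (1 + \<delta>) * (1 - \<delta> / 4)"
      proof -
        have "(1 + \<delta>) * (1 - \<delta> / 4) = 1 + 3 / 4 * \<delta> - \<delta> * \<delta> / 4" by (simp add: field_simps)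
        moreover have "\<delta> * \<delta> \<le> \<delta>" using \<delta> by (intro mult_left_le) auto
        ultimately show ?thesis by linarith
      qed
      also have "\<dots> \<le> (1 + \<delta>) * (1 - \<gamma>)\<^sup>2"
        using \<delta>(1) by (intro mult_left_mono) (simp_all add: \<gamma>_def power2_diff)
      finally have "real N * (t / 2) * (1 + \<delta> / 2) \<le> real N * (t / 2) * ((1 + \<delta>) * (1 - \<gamma>)\<^sup>2)"
        using N t by (intro mult_left_mono) auto
      with * show ?thesis by (simp add: algebra_simps)
    qed
    define A where "A f \<longleftrightarrow> t < writhe n (\<lambda>i. real (f i)) / real n" for f :: "nat \<Rightarrow> nat"
    define \<rho> where "\<rho> = pi\<^sup>2 / 4 * t * \<delta>"
    define s where "s = real N * ((\<epsilon> n)\<^sup>2 / 4 + \<epsilon> n ^ 3) + \<rho>"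
    have "s = real N * (\<epsilon> n)\<^sup>2 / 4 + real N * \<epsilon> n ^ 3 + \<rho>" by (simp add: s_def algebra_simps)
    also have "\<dots> \<le> c2 / 4 + 1 + \<rho>" using eps2 eps3 by simp
    also have "\<dots> = pi\<^sup>2 / 4 * (1 + 2 * \<delta>) * t + 1" by (simp add: c2_def \<rho>_def field_simps)
    finally have "s \<le> pi\<^sup>2 / 4 * (1 + 2 * \<delta>) * t + 1" .
    then have exp_s: "E \<le> exp (- s)" by (simp add: E_def)
    \<comment> \<open>Three events cover everything: the desired one with a controlled density, a
      large density, and a writhe far from its mean.\<close>
    have "1 \<le> T.Q.expect N (\<lambda>f. of_bool (A f \<and> T.log_ratio f < s) + of_bool (s \<le> T.log_ratio f)
        + of_bool (real N * (t * \<delta> / 4) \<le> \<bar>writhe n (\<lambda>i. real (f i)) - T.mean\<bar>))"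
    proof -
      have "T.Q.expect N (\<lambda>_. 1) \<le> T.Q.expect N (\<lambda>f. of_bool (A f \<and> T.log_ratio f < s) + of_bool (s \<le> T.log_ratio f)
        + of_bool (real N * (t * \<delta> / 4) \<le> \<bar>writhe n (\<lambda>i. real (f i)) - T.mean\<bar>))"
      proof (rule T.Q.expect_mono)
        fix f :: "nat \<Rightarrow> nat"
        let ?w = "writhe n (\<lambda>i. real (f i))"
        have "A f" if "\<bar>?w - T.mean\<bar> < real N * (t * \<delta> / 4)"
        proof -
          have "real N * (t / 2) < ?w" using that mean unfolding distrib_left by linarith
          moreover have "t * real n < real N * (t / 2)" using t by (simp add: N_def algebra_simps)
          ultimately show ?thesis using n(1) by (simp add: A_def less_divide_eq)
        qed
        then show "1 \<le> of_bool (A f \<and> T.log_ratio f < s) + of_bool (s \<le> T.log_ratio f)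
            + (of_bool (real N * (t * \<delta> / 4) \<le> \<bar>?w - T.mean\<bar>) :: real)" by (auto simp: not_le)
      qed
      then show ?thesis by simp
    qed
    also have "\<dots> = T.Q.expect N (\<lambda>f. of_bool (A f \<and> T.log_ratio f < s)) + T.Q.expect N (\<lambda>f. of_bool (s \<le> T.log_ratio f))
        + T.Q.expect N (\<lambda>f. of_bool (real N * (t * \<delta> / 4) \<le> \<bar>writhe n (\<lambda>i. real (f i)) - T.mean\<bar>))"
      by (simp only: T.Q.expect_add)
    also have "\<dots> \<le> exp s * T.P.expect N (\<lambda>f. of_bool (A f)) + 1 / 4 + 1 / 4"
    proof (intro add_mono)
      show "T.Q.expect N (\<lambda>f. of_bool (A f \<and> T.log_ratio f < s)) \<le> exp s * T.P.expect N (\<lambda>f. of_bool (A f))"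
        using T.change_of_measure[of A s] by (simp only: N_eq)
      have "0 < \<rho>" using \<delta> t by (simp add: \<rho>_def)
      moreover have "real N * (4 * \<epsilon> n)\<^sup>2 / \<rho>\<^sup>2 \<le> 1 / 4"
        using fail2 eps2 by (simp add: \<rho>_def c2_def[symmetric] power_mult_distrib)
      ultimately show "T.Q.expect N (\<lambda>f. of_bool (s \<le> T.log_ratio f)) \<le> 1 / 4"
        using T.log_ratio_tail[of \<rho>] unfolding s_def N_eq by linarith
      have "0 < t * \<delta> / 4" using \<delta> t by simp
      then show "T.Q.expect N (\<lambda>f. of_bool (real N * (t * \<delta> / 4) \<le> \<bar>writhe n (\<lambda>i. real (f i)) - T.mean\<bar>)) \<le> 1 / 4"
        using T.writhe_concentration[of "t * \<delta> / 4"] fail1 unfolding N_eq eps2 c2_def by linarith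
    qed
    finally have "1 / 2 \<le> exp s * T.P.expect N (\<lambda>f. of_bool (A f))" by simp
    then have "exp (- s) * (1 / 2) \<le> exp (- s) * (exp s * T.P.expect N (\<lambda>f. of_bool (A f)))" by (rule mult_left_mono) simp
    also have "\<dots> = T.P.expect N (\<lambda>f. of_bool (A f))" by (simp add: exp_minus field_simps)
    finally have "E / 2 \<le> T.P.expect N (\<lambda>f. of_bool (A f))" using exp_s by simp
    \<comment> \<open>Half of \<open>E / 2\<close> is given up for collisions of labels.\<close>
    then show ?thesis
      using T.P.perm_prob_approx[of n "\<lambda>w. t < w / real n"] L(2) unfolding A_def N_def[symmetric] by linarith
  qed
  then show ?thesis
    unfolding E_def[symmetric]
    using eventually_conj[OF eventually_gt_at_top[of 0] eventually_conj[OF ev1 eventually_conj[OF ev2 ev3]]]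
    by (auto elim!: eventually_mono)
qed

lemma lower_tail_eventually:
  fixes \<delta> :: real
  assumes "0 < \<delta>" "\<delta> \<le> 1"
  shows "\<forall>\<^sub>F t in at_top. \<forall>\<^sub>F n in sequentially.
    exp (- (pi\<^sup>2 / 4 * (1 + 2 * \<delta>) * t + 1)) / 4 \<le> perm_prob n (\<lambda>w. t < w / real n)"
proof -
  have "((\<lambda>t. (18 + 8 * (pi\<^sup>2 * t * (1 + \<delta>))) / (t * \<delta> / 4)\<^sup>2) \<longlongrightarrow> 0) at_top"
    using assms(1) by real_asymp
  then have "\<forall>\<^sub>F t in at_top. (18 + 8 * (pi\<^sup>2 * t * (1 + \<delta>))) / (t * \<delta> / 4)\<^sup>2 < 1 / 4"
    by (rule order_tendstoD(2)) simp
  moreover have "((\<lambda>t. 16 * (pi\<^sup>2 * t * (1 + \<delta>)) / (pi\<^sup>2 / 4 * t * \<delta>)\<^sup>2) \<longlongrightarrow> 0) at_top"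
    using assms(1) by real_asymp
  then have "\<forall>\<^sub>F t in at_top. 16 * (pi\<^sup>2 * t * (1 + \<delta>)) / (pi\<^sup>2 / 4 * t * \<delta>)\<^sup>2 < 1 / 4"
    by (rule order_tendstoD(2)) simp
  ultimately show ?thesis using eventually_gt_at_top[of 0]
    by eventually_elim (rule lower_tail_at[OF assms], auto)
qed

section \<open>The limit law\<close>

lemma perm_prob_mono:
  assumes "\<And>w. A w \<Longrightarrow> B w"
  shows "perm_prob n A \<le> perm_prob n B"
proof -
  have "card {p. p permutes {0..2 * n} \<and> A (writhe n (\<lambda>i. real (p i)))}
    \<le> card {p. p permutes {0..2 * n} \<and> B (writhe n (\<lambda>i. real (p i)))}"
  proof (rule card_mono)
    show "finite {p. p permutes {0..2 * n} \<and> B (writhe n (\<lambda>i. real (p i)))}"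
      by (rule finite_subset[OF _ finite_permutations[of "{0..2 * n}"]]) auto
  qed (use assms in auto)
  then show ?thesis unfolding perm_prob_def by (intro divide_right_mono) (simp_all del: fact_Suc)
qed

lemma perm_prob_not: "perm_prob n (\<lambda>w. \<not> A w) = 1 - perm_prob n A"
proof -
  let ?S = "{p. p permutes {0..2 * n}}"
  have "perm_prob n A * fact (2 * n + 1) + perm_prob n (\<lambda>w. \<not> A w) * fact (2 * n + 1) = (\<Sum>p\<in>?S. 1)"
    unfolding sum_of_bool_permutes[symmetric] sum.distrib[symmetric] by (intro sum.cong refl) auto
  also have "\<dots> = fact (2 * n + 1)"
    using card_permutations[of "{0..2 * n}" "2 * n + 1"] by (simp del: fact_Suc)
  finally have "(perm_prob n A + perm_prob n (\<lambda>w. \<not> A w)) * fact (2 * n + 1) = 1 * fact (2 * n + 1)"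
    by (simp only: distrib_right mult_1)
  then have "perm_prob n A + perm_prob n (\<lambda>w. \<not> A w) = 1" by (subst (asm) mult_right_cancel) simp_all
  then show ?thesis by linarith
qed

text \<open>Reversing the order of the values, v to 2 * n - v, negates the writhe.\<close>

lemma perm_prob_uminus: "perm_prob n (\<lambda>w. A (- w)) = perm_prob n A"
proof -
  let ?S = "{p. p permutes {0..2 * n}}"
  define \<rho> where "\<rho> i = (if i \<le> 2 * n then 2 * n - i else i)" for i
  have "bij_betw \<rho> {0..2 * n} {0..2 * n}"
    by (rule bij_betw_byWitness[where f' = \<rho>]) (auto simp: \<rho>_def)
  then have \<rho>: "\<rho> permutes {0..2 * n}" by (rule bij_imp_permutes) (simp add: \<rho>_def)
  have w: "writhe n (\<lambda>i. real ((\<rho> \<circ> p) i)) = - writhe n (\<lambda>i. real (p i))" if p: "p permutes {0..2 * n}" for p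
  proof -
    have "writhe n (\<lambda>i. real ((\<rho> \<circ> p) i)) = writhe n (\<lambda>i. - real (p i))"
    proof (rule writhe_cong_sgn)
      fix i j assume "i \<le> 2 * n" "j \<le> 2 * n"
      then have "p i \<le> 2 * n" "p j \<le> 2 * n" using permutes_in_image[OF p] by auto
      then have "real ((\<rho> \<circ> p) j) - real ((\<rho> \<circ> p) i) = - real (p j) - - real (p i)" by (simp add: \<rho>_def of_nat_diff)
      then show "sgn (real ((\<rho> \<circ> p) j) - real ((\<rho> \<circ> p) i)) = sgn (- real (p j) - - real (p i))" by (simp only:)
    qed
    then show ?thesis by (simp only: writhe_uminus)
  qed
  have "(\<Sum>p\<in>?S. of_bool (A (writhe n (\<lambda>i. real (p i)))) :: real) = (\<Sum>p\<in>?S. of_bool (A (writhe n (\<lambda>i. real ((\<rho> \<circ> p) i)))))"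
    by (rule sum.reindex_bij_witness[where i = "\<lambda>\<sigma>. \<rho> \<circ> \<sigma>" and j = "\<lambda>\<sigma>. inv \<rho> \<circ> \<sigma>"])
      (use \<rho> in \<open>auto intro!: permutes_compose permutes_inv simp: comp_assoc[symmetric] permutes_inv_o simp del: o_apply\<close>)
  also have "\<dots> = (\<Sum>p\<in>?S. of_bool (A (- writhe n (\<lambda>i. real (p i)))))"
    by (intro sum.cong refl) (simp only: w mem_Collect_eq)
  finally show ?thesis unfolding sum_of_bool_permutes sum_of_bool_permutes[where A = "\<lambda>w. A (- w)"] by (simp del: fact_Suc)
qed

lemma cdf_normalized_writhe: "cdf (normalized_writhe_distr n) x = perm_prob n (\<lambda>w. w / real n \<le> x)"
proof -
  let ?S = "{p. p permutes {0..2 * n}}"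
  have "id \<in> ?S" by (simp add: permutes_id)
  then have S: "finite ?S" "?S \<noteq> {}" by (auto simp only: finite_permutations finite_atLeastAtMost)
  have "cdf (normalized_writhe_distr n) x
    = measure (measure_pmf (pmf_of_set ?S)) {p. writhe n (\<lambda>i. real (p i)) / real n \<le> x}"
    unfolding cdf_def normalized_writhe_distr_def by (subst measure_distr) (auto simp: vimage_def)
  also have "\<dots> = real (card (?S \<inter> {p. writhe n (\<lambda>i. real (p i)) / real n \<le> x})) / real (card ?S)"
    by (rule measure_pmf_of_set[OF S(2,1)])
  also have "card ?S = fact (2 * n + 1)" by (rule card_permutations) auto
  also have "?S \<inter> {p. writhe n (\<lambda>i. real (p i)) / real n \<le> x} = {p. p permutes {0..2 * n} \<and> writhe n (\<lambda>i. real (p i)) / real n \<le> x}"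
    by auto
  finally show ?thesis by (simp add: perm_prob_def del: fact_Suc)
qed

context
  fixes M :: "'a measure" and W :: "'a \<Rightarrow> real"
  assumes prob: "prob_space M"
    and W: "W \<in> borel_measurable M"
    and conv: "weak_conv_m normalized_writhe_distr (distr M borel W)"
begin

interpretation prob_space M by (rule prob)

lemma real_distr: "real_distribution (distr M borel W)"
  using W by (rule real_distribution_distr)

lemma cdf_W: "cdf (distr M borel W) x = prob {\<omega> \<in> space M. W \<omega> \<le> x}"
  unfolding cdf_def using W by (subst measure_distr) (auto simp: vimage_def Int_def conj_commute)

text \<open>Weak convergence gives information only at continuity points of the limit. Such points
  lie within any given distance of a threshold, and shifting a threshold by a constant changes an
  exponential bound only by a constant factor.\<close>

lemma continuity_point:
  assumes "a < b"
  obtains x where "a < x" "x < b" "isCont (cdf (distr M borel W)) x"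
proof -
  interpret D: real_distribution "distr M borel W" by (rule real_distr)
  have "countable {x. \<not> isCont (cdf (distr M borel W)) x}"
    by (rule mono_ctble_discont) (simp add: mono_def D.cdf_nondecreasing)
  then have "\<exists>x\<in>{a<..<b}. x \<notin> {x. \<not> isCont (cdf (distr M borel W)) x}"
    using assms by (intro open_minus_countable) auto
  then show ?thesis using that by auto
qed

lemma cdf_limit:
  assumes "isCont (cdf (distr M borel W)) x"
  shows "(\<lambda>n. perm_prob n (\<lambda>w. w / real n \<le> x)) \<longlonglongrightarrow> prob {\<omega> \<in> space M. W \<omega> \<le> x}"
  using conv assms unfolding weak_conv_m_def weak_conv_def cdf_W cdf_normalized_writhe by blast

lemma upper_tail_limit_law:
  assumes "0 < \<delta>" "\<delta> < pi\<^sup>2 / 4"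
  shows "\<exists>C>0. \<forall>t\<ge>2. prob {\<omega> \<in> space M. t < \<bar>W \<omega>\<bar>} \<le> C * exp (- ((pi\<^sup>2 / 4 - \<delta>) * t))"
proof -
  define \<kappa> where "\<kappa> = pi\<^sup>2 / 4 - \<delta>"
  obtain C where C: "0 < C"
    "\<And>t. 0 \<le> t \<Longrightarrow> \<exists>\<^sub>F n in sequentially. perm_prob n (\<lambda>w. t < w / real n) \<le> C * exp (- (\<kappa> * t))"
    using upper_tail_frequently[OF assms(1)] unfolding \<kappa>_def by blast
  have \<kappa>: "0 < \<kappa>" using assms(2) by (simp add: \<kappa>_def)
  have "prob {\<omega> \<in> space M. t < \<bar>W \<omega>\<bar>} \<le> (2 * C * exp (2 * \<kappa>)) * exp (- (\<kappa> * t))" if t: "2 \<le> t" for t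
  proof -
    \<comment> \<open>The shift makes room for continuity points near \<open>t\<close> and
      \<open>- t\<close>; it costs the factor exp (2 * \<kappa>).\<close>
    define s where "s = t - 2"
    have s: "0 \<le> s" using t by (simp add: s_def)
    have right: "prob {\<omega> \<in> space M. t < W \<omega>} \<le> C * exp (- (\<kappa> * s))"
    proof -
      obtain y where y: "t - 1 < y" "y < t" "isCont (cdf (distr M borel W)) y" by (rule continuity_point[of "t - 1" t]) auto
      have lim: "(\<lambda>n. perm_prob n (\<lambda>w. y < w / real n)) \<longlonglongrightarrow> 1 - prob {\<omega> \<in> space M. W \<omega> \<le> y}"
        using tendsto_diff[OF tendsto_const[of 1] cdf_limit[OF y(3)]]
        unfolding perm_prob_not[symmetric] by (simp only: not_le)
      have "1 - prob {\<omega> \<in> space M. W \<omega> \<le> y} \<le> C * exp (- (\<kappa> * s))"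
      \<comment> \<open>A bound for infinitely many \<open>n\<close> suffices, because a limit above
        it would violate it for all large \<open>n\<close>.\<close>
      proof (rule ccontr)
        assume "\<not> ?thesis"
        then have "\<forall>\<^sub>F n in sequentially. C * exp (- (\<kappa> * s)) < perm_prob n (\<lambda>w. y < w / real n)"
          by (intro order_tendstoD(1)[OF lim]) simp
        then have "\<forall>\<^sub>F n in sequentially. \<not> perm_prob n (\<lambda>w. s < w / real n) \<le> C * exp (- (\<kappa> * s))"
        proof eventually_elim
          case (elim n)
          have "perm_prob n (\<lambda>w. y < w / real n) \<le> perm_prob n (\<lambda>w. s < w / real n)"
            using y(1) by (intro perm_prob_mono) (simp add: s_def)
          then show ?case using elim by simp
        qed
        then show False using C(2)[OF s] by (simp add: frequently_def)
      qed
      moreover have "1 - prob {\<omega> \<in> space M. W \<omega> \<le> y} = prob (space M - {\<omega> \<in> space M. W \<omega> \<le> y})"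
        using W by (intro prob_compl[symmetric]) measurable
      moreover have "prob {\<omega> \<in> space M. t < W \<omega>} \<le> prob (space M - {\<omega> \<in> space M. W \<omega> \<le> y})"
        using W y(2) by (intro finite_measure_mono) auto
      ultimately show ?thesis by linarith
    qed
    have left: "prob {\<omega> \<in> space M. W \<omega> < - t} \<le> C * exp (- (\<kappa> * s))"
    proof -
      obtain y where y: "- t < y" "y < - t + 1" "isCont (cdf (distr M borel W)) y" by (rule continuity_point[of "- t" "- t + 1"]) auto
      note lim = cdf_limit[OF y(3)]
      have "prob {\<omega> \<in> space M. W \<omega> \<le> y} \<le> C * exp (- (\<kappa> * s))"
      proof (rule ccontr)
        assume "\<not> ?thesis"
        then have "\<forall>\<^sub>F n in sequentially. C * exp (- (\<kappa> * s)) < perm_prob n (\<lambda>w. w / real n \<le> y)"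
          by (intro order_tendstoD(1)[OF lim]) simp
        then have "\<forall>\<^sub>F n in sequentially. \<not> perm_prob n (\<lambda>w. s < w / real n) \<le> C * exp (- (\<kappa> * s))"
        proof eventually_elim
          case (elim n)
          have "perm_prob n (\<lambda>w. w / real n \<le> y) = perm_prob n (\<lambda>w. - w / real n \<le> y)"
            by (rule perm_prob_uminus[symmetric])
          also have "\<dots> \<le> perm_prob n (\<lambda>w. s < w / real n)"
            using y(2) by (intro perm_prob_mono) (simp add: s_def)
          finally show ?case using elim by simp
        qed
        then show False using C(2)[OF s] by (simp add: frequently_def)
      qed
      moreover have "prob {\<omega> \<in> space M. W \<omega> < - t} \<le> prob {\<omega> \<in> space M. W \<omega> \<le> y}"
        using W y(1) by (intro finite_measure_mono) auto
      ultimately show ?thesis by linarith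
    qed
    have "prob {\<omega> \<in> space M. t < \<bar>W \<omega>\<bar>} \<le> prob ({\<omega> \<in> space M. t < W \<omega>} \<union> {\<omega> \<in> space M. W \<omega> < - t})"
      using W by (intro finite_measure_mono) auto
    also have "\<dots> \<le> prob {\<omega> \<in> space M. t < W \<omega>} + prob {\<omega> \<in> space M. W \<omega> < - t}"
      using W by (intro measure_Un_le) auto
    also have "\<dots> \<le> 2 * C * exp (- (\<kappa> * s))" using left right by simp
    also have "\<dots> = (2 * C * exp (2 * \<kappa>)) * exp (- (\<kappa> * t))"
      by (simp add: s_def exp_add[symmetric] algebra_simps)
    finally show ?thesis .
  qed
  moreover have "0 < 2 * C * exp (2 * \<kappa>)" using C(1) by simp
  ultimately show ?thesis unfolding \<kappa>_def by blast
qed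

lemma lower_tail_limit_law:
  assumes "0 < \<delta>" "\<delta> \<le> 1"
  shows "\<forall>\<^sub>F t in at_top. exp (- (pi\<^sup>2 / 4 * (1 + 2 * \<delta>) * (t + 1) + 1)) / 4 \<le> prob {\<omega> \<in> space M. t < \<bar>W \<omega>\<bar>}"
proof -
  obtain T where T: "\<And>t. T \<le> t \<Longrightarrow> \<forall>\<^sub>F n in sequentially.
      exp (- (pi\<^sup>2 / 4 * (1 + 2 * \<delta>) * t + 1)) / 4 \<le> perm_prob n (\<lambda>w. t < w / real n)"
    using lower_tail_eventually[OF assms] unfolding eventually_at_top_linorder by blast
  have "exp (- (pi\<^sup>2 / 4 * (1 + 2 * \<delta>) * (t + 1) + 1)) / 4 \<le> prob {\<omega> \<in> space M. t < \<bar>W \<omega>\<bar>}" if t: "T \<le> t" for t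
  proof -
    obtain y where y: "t < y" "y < t + 1" "isCont (cdf (distr M borel W)) y" by (rule continuity_point[of t "t + 1"]) auto
    have lim: "(\<lambda>n. perm_prob n (\<lambda>w. y < w / real n)) \<longlonglongrightarrow> 1 - prob {\<omega> \<in> space M. W \<omega> \<le> y}"
      using tendsto_diff[OF tendsto_const[of 1] cdf_limit[OF y(3)]]
      unfolding perm_prob_not[symmetric] by (simp only: not_le)
    have "T \<le> t + 1" using t by simp
    from T[OF this] have "\<forall>\<^sub>F n in sequentially. exp (- (pi\<^sup>2 / 4 * (1 + 2 * \<delta>) * (t + 1) + 1)) / 4 \<le> perm_prob n (\<lambda>w. y < w / real n)"
    proof eventually_elim
      case (elim n)
      have "perm_prob n (\<lambda>w. t + 1 < w / real n) \<le> perm_prob n (\<lambda>w. y < w / real n)"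
        using y(2) by (intro perm_prob_mono) simp
      then show ?case using elim by linarith
    qed
    then have "exp (- (pi\<^sup>2 / 4 * (1 + 2 * \<delta>) * (t + 1) + 1)) / 4 \<le> 1 - prob {\<omega> \<in> space M. W \<omega> \<le> y}"
      by (rule tendsto_lowerbound[OF lim]) simp
    also have "\<dots> = prob (space M - {\<omega> \<in> space M. W \<omega> \<le> y})"
      using W by (intro prob_compl[symmetric]) measurable
    also have "\<dots> \<le> prob {\<omega> \<in> space M. t < \<bar>W \<omega>\<bar>}"
      using W y(1) by (intro finite_measure_mono) auto
    finally show ?thesis .
  qed
  then show ?thesis unfolding eventually_at_top_linorder by blast
qed

end

theorem mainTheorem3:
  fixes M :: "'a measure" and W :: "'a \<Rightarrow> real"
  assumes "prob_space M"
    and "W \<in> borel_measurable M"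
    and "weak_conv_m normalized_writhe_distr (distr M borel W)"
  shows "((\<lambda>t::real. ln (measure M {x \<in> space M. \<bar>W x\<bar> > t}) / t) \<longlongrightarrow> - (pi\<^sup>2 / 4)) at_top"
proof (rule order_tendstoI)
  fix a :: real assume a: "a < - (pi\<^sup>2 / 4)"
  \<comment> \<open>With this choice \<kappa> exceeds pi^2 / 4 by at most half of the gap between
    pi^2 / 4 and \<open>- a\<close>.\<close>
  define \<delta> where "\<delta> = min 1 ((- a - pi\<^sup>2 / 4) / pi\<^sup>2)"
  have \<delta>: "0 < \<delta>" "\<delta> \<le> 1" using a by (auto simp: \<delta>_def)
  define \<kappa> where "\<kappa> = pi\<^sup>2 / 4 * (1 + 2 * \<delta>)"
  have "\<kappa> < - a"
  proof -
    have "pi\<^sup>2 * \<delta> \<le> pi\<^sup>2 * ((- a - pi\<^sup>2 / 4) / pi\<^sup>2)" by (intro mult_left_mono) (auto simp: \<delta>_def)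
    also have "\<dots> = - a - pi\<^sup>2 / 4" by simp
    finally show ?thesis using a by (simp add: \<kappa>_def algebra_simps)
  qed
  moreover have "((\<lambda>t. (- (\<kappa> * (t + 1) + 1) - ln 4) / t) \<longlongrightarrow> - \<kappa>) at_top" by real_asymp
  ultimately have "\<forall>\<^sub>F t in at_top. a < (- (\<kappa> * (t + 1) + 1) - ln 4) / t"
    by (intro order_tendstoD(1)) auto
  then show "\<forall>\<^sub>F t in at_top. a < ln (measure M {x \<in> space M. t < \<bar>W x\<bar>}) / t"
    using lower_tail_limit_law[OF assms \<delta>] eventually_gt_at_top[of 0]
  proof eventually_elim
    case (elim t)
    have "- (\<kappa> * (t + 1) + 1) - ln 4 = ln (exp (- (\<kappa> * (t + 1) + 1)) / 4)" by (simp add: ln_div)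
    also have "\<dots> \<le> ln (measure M {x \<in> space M. t < \<bar>W x\<bar>})"
      using elim(2) unfolding \<kappa>_def by (intro ln_mono) auto
    finally have "(- (\<kappa> * (t + 1) + 1) - ln 4) / t \<le> ln (measure M {x \<in> space M. t < \<bar>W x\<bar>}) / t"
      using elim(3) by (intro divide_right_mono) auto
    then show ?case using elim(1) by linarith
  qed
next
  fix a :: real assume a: "- (pi\<^sup>2 / 4) < a"
  define \<delta> where "\<delta> = min (pi\<^sup>2 / 8) ((a + pi\<^sup>2 / 4) / 2)"
  have "0 < \<delta>" using a by (simp add: \<delta>_def)
  have "\<delta> \<le> pi\<^sup>2 / 8" unfolding \<delta>_def by (rule min.cobounded1)
  also have "\<dots> < pi\<^sup>2 / 4" by simp
  finally have \<delta>: "0 < \<delta>" "\<delta> < pi\<^sup>2 / 4" using \<open>0 < \<delta>\<close> by simp_all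
  define \<kappa> where "\<kappa> = pi\<^sup>2 / 4 - \<delta>"
  have "\<delta> \<le> (a + pi\<^sup>2 / 4) / 2" unfolding \<delta>_def by (rule min.cobounded2)
  then have "- \<kappa> < a" using a by (simp add: \<kappa>_def field_simps)
  obtain C where C: "0 < C" "\<And>t. 2 \<le> t \<Longrightarrow> measure M {x \<in> space M. t < \<bar>W x\<bar>} \<le> C * exp (- (\<kappa> * t))"
    using upper_tail_limit_law[OF assms \<delta>] unfolding \<kappa>_def by blast
  have "((\<lambda>t. (ln C - \<kappa> * t) / t) \<longlongrightarrow> - \<kappa>) at_top" by real_asymp
  then have "\<forall>\<^sub>F t in at_top. (ln C - \<kappa> * t) / t < a" using \<open>- \<kappa> < a\<close> by (rule order_tendstoD(2))
  then show "\<forall>\<^sub>F t in at_top. ln (measure M {x \<in> space M. t < \<bar>W x\<bar>}) / t < a"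
    using lower_tail_limit_law[OF assms zero_less_one order_refl] eventually_ge_at_top[of 2]
  proof eventually_elim
    case (elim t)
    \<comment> \<open>Positivity comes from the lower tail; at probability 0 the default value ln 0
      = 0 would break the estimate.\<close>
    have "0 < measure M {x \<in> space M. t < \<bar>W x\<bar>}" by (rule less_le_trans[OF _ elim(2)]) simp
    then have "ln (measure M {x \<in> space M. t < \<bar>W x\<bar>}) \<le> ln (C * exp (- (\<kappa> * t)))"
      using C(2)[OF elim(3)] by (intro ln_mono) auto
    also have "\<dots> = ln C - \<kappa> * t" using C(1) by (simp add: ln_mult)
    finally have "ln (measure M {x \<in> space M. t < \<bar>W x\<bar>}) / t \<le> (ln C - \<kappa> * t) / t"
      using elim(3) by (intro divide_right_mono) auto
    then show ?case using elim(1) by linarith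
  qed
qed

end
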